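(* Let $(P=\mathbf k[\partial]\otimes_{\mathbf k}A,[\cdot_\lambda\cdot],\cdot_\lambda\cdot)$ be the Poisson conformal algebra corresponding to a PGD-algebra $(A,\circ,\cdot,[\cdot,\cdot])$, i.e. $$[a_\lambda b]=\partial(b\circ a)+\lambda(a\circ b+b\circ a)+[a,b],\qquad a_\lambda b=a\cdot b,\qquad a,b\in A.$$ Suppose that $\Delta_1,\Delta_2,\delta_0$ are $\mathbf k[\partial]$-module homomorphisms from $P$ to $P\otimes P$ such that $\Delta_i(A)\subseteq A\otimes A$ for $i=1,2$ and $\delta_0(A)\subseteq A\otimes A$. Define two $\mathbf k[\partial]$-module homomorphisms $\delta,\Delta:P\to P\otimes P$ by $$\delta(a):=(\partial\otimes I)\Delta_1(a)-\tau(\partial\otimes I)\Delta_1(a)+\delta_0(a),\qquad\Delta(a):=\Delta_2(a),\qquad a\in A,$$ extended to $P$. Then $(P,[\cdot_\lambda\cdot],\cdot_\lambda\cdot,\delta,\Delta)$ is a Poisson conformal bialgebra if and only if $(A,\circ,\cdot,[\cdot,\cdot],\Delta_1,\Delta_2,\delta_0)$ is a PGD-bialgebra.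
   Context: Let $\mathbf k$ be a field of characteristic $0$. Vector spaces are finite-dimensional and $\mathbf k[\partial]$-modules finitely generated; $\otimes$ is over $\mathbf k$, $I$ is the identity, $\tau(u\otimes v)=v\otimes u$. For a product $\ast$ on $A$, $L_{A,\ast}(a)b=a\ast b$, $R_{A,\ast}(a)b=b\ast a$; $\mathrm{ad}_A(a)b=[a,b]$. PGD-algebras. A Novikov algebra $(A,\circ)$ satisfies $(a\circ b)\circ c-a\circ(b\circ c)=(b\circ a)\circ c-b\circ(a\circ c)$ and $(a\circ b)\circ c=(a\circ c)\circ b$. A Gel'fand-Dorfman (GD) algebra $(A,\circ,[\cdot,\cdot])$ is a Novikov algebra and a Lie algebra with $[a\circ b,c]-[a\circ c,b]+[a,b]\circ c-[a,c]\circ b-a\circ[b,c]=0$. A Poisson algebra $(A,\cdot,[\cdot,\cdot])$ is a commutative associative algebra and a Lie algebra with $[a,b\cdot c]=[a,b]\cdot c+b\cdot[a,c]$. A differential Novikov-Poisson algebra $(A,\circ,\cdot)$ is a Novikov algebra and a commutative associative algebra with $(a\cdot b)\circ c=a\cdot(b\circ c)$ and $a\circ(b\cdot c)=(a\circ b)\cdot c+b\cdot(a\circ c)$. A PGD-algebra (Poisson-Gel'fand-Dorfman algebra) $(A,\circ,\cdot,[\cdot,\cdot])$ is such that $(A,\circ,[\cdot,\cdot])$ is a GD-algebra, $(A,\cdot,[\cdot,\cdot])$ a Poisson algebra and $(A,\circ,\cdot)$ a differential Novikov-Poisson algebra. Put $a\star b=a\circ b+b\circ a$. PGD-coalgebras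 (linear maps $A\to A\otimes A$). Novikov coalgebra $(A,\Delta_1)$: $(I\otimes\Delta_1)\Delta_1-(\tau\otimes I)(I\otimes\Delta_1)\Delta_1=(\Delta_1\otimes I)\Delta_1-(\tau\otimes I)(\Delta_1\otimes I)\Delta_1$ and $(\tau\otimes I)(I\otimes\Delta_1)\tau\Delta_1=(\Delta_1\otimes I)\Delta_1$. Cocommutative associative coalgebra $(A,\Delta_2)$: $(\Delta_2\otimes I)\Delta_2=(I\otimes\Delta_2)\Delta_2$, $\Delta_2=\tau\Delta_2$. Lie coalgebra $(A,\delta_0)$: $\delta_0=-\tau\delta_0$, $(I\otimes\delta_0)\delta_0-(\tau\otimes I)(I\otimes\delta_0)\delta_0=(\delta_0\otimes I)\delta_0$. GD-coalgebra $(A,\Delta_1,\delta_0)$: Novikov coalgebra, Lie coalgebra and $(I\otimes\delta_0)\Delta_1-(\tau\otimes I)(I\otimes\Delta_1)\delta_0+(\tau\otimes I)(I\otimes\delta_0)\tau\Delta_1=(\Delta_1\otimes I)\delta_0+(\delta_0\otimes I)\Delta_1$. Poisson coalgebra $(A,\Delta_2,\delta_0)$: cocommutative associative coalgebra, Lie coalgebra and $(I\otimes\Delta_2)\delta_0=(\delta_0\otimes I)\Delta_2+(\tau\otimes I)(I\otimes\delta_0)\Delta_2$. Differential Novikov-Poisson coalgebra $(A,\Delta_1,\Delta_2)$: Novikov coalgebra, cocommutative associative coalgebra, $(I\otimes\Delta_2)\Delta_1=(\Delta_1\otimes I)\Delta_2+(\tau\otimes I)(I\otimes\Delta_1)\Delta_2$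 and $(I\otimes\Delta_2)\tau\Delta_1=(\tau\otimes I)(\Delta_1\otimes I)\Delta_2$. PGD-bialgebras. All identities are for all $a,b\in A$. Novikov bialgebra $(A,\circ,\Delta_1)$: Novikov algebra, Novikov coalgebra, and $\Delta_1(a\circ b)=(R_{A,\circ}(b)\otimes I)\Delta_1(a)+(I\otimes L_{A,\star}(a))(\Delta_1(b)+\tau\Delta_1(b))$; $(L_{A,\star}(a)\otimes I)\Delta_1(b)-(I\otimes L_{A,\star}(a))\tau\Delta_1(b)=(L_{A,\star}(b)\otimes I)\Delta_1(a)-(I\otimes L_{A,\star}(b))\tau\Delta_1(a)$; $(I\otimes R_{A,\circ}(a)-R_{A,\circ}(a)\otimes I)(\Delta_1(b)+\tau\Delta_1(b))=(I\otimes R_{A,\circ}(b)-R_{A,\circ}(b)\otimes I)(\Delta_1(a)+\tau\Delta_1(a))$. Commutative and cocommutative ASI bialgebra $(A,\cdot,\Delta_2)$: commutative associative algebra, cocommutative associative coalgebra, $\Delta_2(a\cdot b)=(I\otimes L_{A,\cdot}(a))\Delta_2(b)+(L_{A,\cdot}(b)\otimes I)\Delta_2(a)$. Lie bialgebra $(A,[\cdot,\cdot],\delta_0)$: Lie algebra, Lie coalgebra, $\delta_0([a,b])=(\mathrm{ad}_A(a)\otimes I+I\otimes\mathrm{ad}_A(a))\delta_0(b)-(\mathrm{ad}_A(b)\otimes I+I\otimes\mathrm{ad}_A(b))\delta_0(a)$. GD-bialgebra $(A,\circ,[\cdot,\cdot],\Delta_1,\delta_0)$: GD-algebra, GD-coalgebra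 $(A,\Delta_1,\delta_0)$, Novikov bialgebra, Lie bialgebra, and $\delta_0(b\circ a)+\Delta_1([a,b])=(R_{A,\circ}(a)\otimes I)\delta_0(b)+(L_{A,\circ}(b)\otimes I)\delta_0(a)+(I\otimes L_{A,\star}(b))\delta_0(a)+(\mathrm{ad}_A(a)\otimes I+I\otimes\mathrm{ad}_A(a))\Delta_1(b)-(I\otimes\mathrm{ad}_A(b))(\Delta_1(a)+\tau\Delta_1(a))$. Poisson bialgebra $(A,\cdot,[\cdot,\cdot],\Delta_2,\delta_0)$: Poisson algebra, Poisson coalgebra, commutative and cocommutative ASI bialgebra, Lie bialgebra, and $\delta_0(a\cdot b)=(L_{A,\cdot}(a)\otimes I)\delta_0(b)+(L_{A,\cdot}(b)\otimes I)\delta_0(a)+(I\otimes\mathrm{ad}_A(a))\Delta_2(b)+(I\otimes\mathrm{ad}_A(b))\Delta_2(a)$; $\Delta_2([a,b])=(\mathrm{ad}_A(a)\otimes I+I\otimes\mathrm{ad}_A(a))\Delta_2(b)-(I\otimes L_{A,\cdot}(b))\delta_0(a)+(L_{A,\cdot}(b)\otimes I)\delta_0(a)$. Differential Novikov-Poisson bialgebra $(A,\circ,\cdot,\Delta_1,\Delta_2)$: differential Novikov-Poisson algebra and coalgebra, Novikov bialgebra, commutative and cocommutative ASI bialgebra, and $\Delta_1(a\cdot b)=(L_{A,\cdot}(a)\otimes I)\Delta_1(b)-(I\otimes L_{A,\star}(b))\Delta_2(a)$; $\Delta_2(a\circ b)=(R_{A,\circ}(b)\otimes I)\Delta_2(a)-(I\otimes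 L_{A,\cdot}(a))(\Delta_1(b)+\tau\Delta_1(b))$; $(L_{A,\circ}(a)\otimes I)\Delta_2(b)+(I\otimes L_{A,\circ}(b))\Delta_2(a)+(I\otimes L_{A,\cdot}(b))\Delta_1(a)+(L_{A,\cdot}(a)\otimes I)\tau\Delta_1(b)=0$. PGD-bialgebra $(A,\circ,\cdot,[\cdot,\cdot],\Delta_1,\Delta_2,\delta_0)$: $(A,\circ,[\cdot,\cdot],\Delta_1,\delta_0)$ is a GD-bialgebra, $(A,\cdot,[\cdot,\cdot],\Delta_2,\delta_0)$ a Poisson bialgebra, $(A,\circ,\cdot,\Delta_1,\Delta_2)$ a differential Novikov-Poisson bialgebra (here $\Delta_1,\Delta_2,\delta_0$ denote the restrictions to $A$). Poisson conformal bialgebras. A Poisson conformal algebra $(P,[\cdot_\lambda\cdot],\cdot_\lambda\cdot)$ is a $\mathbf k[\partial]$-module with $\mathbf k$-bilinear maps $P\times P\to P[\lambda]$ such that $[(\partial a)_\lambda b]=-\lambda[a_\lambda b]$, $[a_\lambda(\partial b)]=(\partial+\lambda)[a_\lambda b]$, $[a_\lambda b]=-[b_{-\lambda-\partial}a]$, $[a_\lambda[b_\mu c]]=[[a_\lambda b]_{\lambda+\mu}c]+[b_\mu[a_\lambda c]]$; $(\partial a)_\lambda b=-\lambda a_\lambda b$, $a_\lambda(\partial b)=(\partial+\lambda)a_\lambda b$, $(a_\lambda b)_{\lambda+\mu}c=a_\lambda(b_\mu c)$, $a_\lambda b=b_{-\lambda-\partial}a$; $[a_\lambda(b_\mu c)]=[a_\lambda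 b]_{\lambda+\mu}c+b_\mu[a_\lambda c]$. (If $b_\nu a=\sum_k\nu^kc_k$, then $b_{-\lambda-\partial}a=\sum_k(-\lambda-\partial)^kc_k$.) The formulas in the claim determine the structure on $\mathbf k[\partial]\otimes A$ by these sesquilinearity rules. Write $\mathfrak{ad}_P(a)_\lambda b=[a_\lambda b]$, $\mathfrak L_P(a)_\lambda b=a_\lambda b$, $\partial^{\otimes^2}=\partial\otimes I+I\otimes\partial$ (the $\mathbf k[\partial]$-action on $P\otimes P$); if $T_\nu u=\sum_k\nu^kw_k$ then $(T_{-\lambda-\partial^{\otimes^2}}\otimes I)(u\otimes v)=\sum_k(-\lambda-\partial^{\otimes^2})^k(w_k\otimes v)$, similarly in the second factor. For $\mathbf k[\partial]$-module homomorphisms $\delta,\Delta:P\to P\otimes P$, $(P,\delta,\Delta)$ is a Poisson conformal coalgebra if $(I\otimes\Delta)\Delta=(\Delta\otimes I)\Delta$, $\Delta=\tau\Delta$, $\delta=-\tau\delta$, $(I\otimes\delta)\delta-(\tau\otimes I)(I\otimes\delta)\delta=(\delta\otimes I)\delta$, $(I\otimes\Delta)\delta=(\delta\otimes I)\Delta+(\tau\otimes I)(I\otimes\delta)\Delta$. $(P,[\cdot_\lambda\cdot],\cdot_\lambda\cdot,\delta,\Delta)$ is a Poisson conformal bialgebra if it is a Poisson conformal algebra and coalgebra and for all $a,b\in P$: (i) $\delta([a_\lambda b])=(\mathfrak{ad}_P(a)_\lambda\otimes I+I\otimes\mathfrak{ad}_P(a)_\lambda)\delta(b)-(\mathfrak{ad}_P(b)_{-\lambda-\partial^{\otimes^2}}\otimes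 I+I\otimes\mathfrak{ad}_P(b)_{-\lambda-\partial^{\otimes^2}})\delta(a)$; (ii) $\Delta(a_\lambda b)=(I\otimes\mathfrak L_P(a)_\lambda)\Delta(b)+(\mathfrak L_P(b)_{-\lambda-\partial^{\otimes^2}}\otimes I)\Delta(a)$; (iii) $\delta(a_\lambda b)=(\mathfrak L_P(a)_\lambda\otimes I)\delta(b)+(\mathfrak L_P(b)_{-\lambda-\partial^{\otimes^2}}\otimes I)\delta(a)+(I\otimes\mathfrak{ad}_P(a)_\lambda)\Delta(b)+(I\otimes\mathfrak{ad}_P(b)_{-\lambda-\partial^{\otimes^2}})\Delta(a)$; (iv) $\Delta([a_\lambda b])=(\mathfrak{ad}_P(a)_\lambda\otimes I+I\otimes\mathfrak{ad}_P(a)_\lambda)\Delta(b)-(I\otimes\mathfrak L_P(b)_{-\lambda-\partial^{\otimes^2}})\delta(a)+(\mathfrak L_P(b)_{-\lambda-\partial^{\otimes^2}}\otimes I)\delta(a)$. *)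

theory Defs
  imports
    Complex_Main
    "HOL-Library.Function_Algebras"
    "HOL-Computational_Algebra.Polynomial"
begin

text \<open>
  A vector space over the field \<^typ>\<open>'k\<close> is a type \<^typ>\<open>'v\<close> together with a scalar multiplication
  \<open>s :: 'k \<Rightarrow> 'v \<Rightarrow> 'v\<close> such that \<open>vector_space s\<close> holds.
\<close>

section \<open>Tensor squares and tensor cubes\<close>

definition bilin_map ::
  "('k::field \<Rightarrow> 'v::ab_group_add \<Rightarrow> 'v) \<Rightarrow> ('k \<Rightarrow> 'w::ab_group_add \<Rightarrow> 'w) \<Rightarrow> ('v \<Rightarrow> 'v \<Rightarrow> 'w) \<Rightarrow> bool" where
  "bilin_map s t f \<longleftrightarrow>
     (\<forall>x. Vector_Spaces.linear s t (\<lambda>y. f x y)) \<and>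
     (\<forall>y. Vector_Spaces.linear s t (\<lambda>x. f x y))"

definition trilin_map ::
  "('k::field \<Rightarrow> 'v::ab_group_add \<Rightarrow> 'v) \<Rightarrow> ('k \<Rightarrow> 'w::ab_group_add \<Rightarrow> 'w) \<Rightarrow> ('v \<Rightarrow> 'v \<Rightarrow> 'v \<Rightarrow> 'w) \<Rightarrow> bool" where
  "trilin_map s t f \<longleftrightarrow>
     (\<forall>x y. Vector_Spaces.linear s t (\<lambda>z. f x y z)) \<and>
     (\<forall>x z. Vector_Spaces.linear s t (\<lambda>y. f x y z)) \<and>
     (\<forall>y z. Vector_Spaces.linear s t (\<lambda>x. f x y z))"

text \<open>
  The tensor product \<open>V \<otimes> V\<close> is realised inside the dual of the space of bilinear forms on \<open>V\<close>:
  \<open>u \<otimes> v\<close> is evaluation at \<open>(u, v)\<close>, and \<open>V \<otimes> V\<close> is the span of these elements. A functional is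
  made total by giving it the value 0 on functions that are not bilinear. Over a field this is a
  tensor product for spaces of any dimension: see the theorems \<open>lift2_pure2\<close> and \<open>lift2_linear\<close> below
  for the universal property. \<open>V \<otimes> V \<otimes> V\<close> is treated in the same way with trilinear forms, so that
  both \<open>(V \<otimes> V) \<otimes> V\<close> and \<open>V \<otimes> (V \<otimes> V)\<close> are identified with it.
\<close>

type_synonym ('k, 'v) tens2 = "('v \<Rightarrow> 'v \<Rightarrow> 'k) \<Rightarrow> 'k"
type_synonym ('k, 'v) tens3 = "('v \<Rightarrow> 'v \<Rightarrow> 'v \<Rightarrow> 'k) \<Rightarrow> 'k"

definition fun_scale :: "'k::field \<Rightarrow> ('b \<Rightarrow> 'k) \<Rightarrow> 'b \<Rightarrow> 'k" where
  "fun_scale c t = (\<lambda>x. c * t x)"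

definition pure2 :: "('k::field \<Rightarrow> 'v::ab_group_add \<Rightarrow> 'v) \<Rightarrow> 'v \<Rightarrow> 'v \<Rightarrow> ('k, 'v) tens2" where
  "pure2 s u v = (\<lambda>\<beta>. if bilin_map s (*) \<beta> then \<beta> u v else 0)"

definition pure3 :: "('k::field \<Rightarrow> 'v::ab_group_add \<Rightarrow> 'v) \<Rightarrow> 'v \<Rightarrow> 'v \<Rightarrow> 'v \<Rightarrow> ('k, 'v) tens3" where
  "pure3 s u v w = (\<lambda>\<beta>. if trilin_map s (*) \<beta> then \<beta> u v w else 0)"

definition tensor2 :: "('k::field \<Rightarrow> 'v::ab_group_add \<Rightarrow> 'v) \<Rightarrow> ('k, 'v) tens2 set" where
  "tensor2 s = module.span fun_scale {pure2 s u v | u v. True}"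

definition tensor3 :: "('k::field \<Rightarrow> 'v::ab_group_add \<Rightarrow> 'v) \<Rightarrow> ('k, 'v) tens3 set" where
  "tensor3 s = module.span fun_scale {pure3 s u v w | u v w. True}"

text \<open>
  The linear map on the tensor square (cube) induced by a bilinear (trilinear) map \<open>f\<close>. The value is
  independent of the chosen expression as a sum of pure tensors; every linear map on tensors below
  is defined by its values on pure tensors in this way.
\<close>

definition lift2 :: "('k::field \<Rightarrow> 'v::ab_group_add \<Rightarrow> 'v) \<Rightarrow> ('v \<Rightarrow> 'v \<Rightarrow> 'w::ab_group_add) \<Rightarrow> ('k, 'v) tens2 \<Rightarrow> 'w" where
  "lift2 s f t = (THE w. \<exists>xs. t = (\<Sum>(u, v)\<leftarrow>xs. pure2 s u v) \<and> w = (\<Sum>(u, v)\<leftarrow>xs. f u v))"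

definition lift3 :: "('k::field \<Rightarrow> 'v::ab_group_add \<Rightarrow> 'v) \<Rightarrow> ('v \<Rightarrow> 'v \<Rightarrow> 'v \<Rightarrow> 'w::ab_group_add) \<Rightarrow> ('k, 'v) tens3 \<Rightarrow> 'w" where
  "lift3 s f t = (THE w. \<exists>xs. t = (\<Sum>(x, y, z)\<leftarrow>xs. pure3 s x y z) \<and> w = (\<Sum>(x, y, z)\<leftarrow>xs. f x y z))"

subsection \<open>The universal property\<close>

lemma vector_space_fun_scale: "vector_space fun_scale"
  by unfold_locales (auto simp: fun_scale_def fun_eq_iff algebra_simps)

lemma linear_functional_separates:
  fixes t :: "'k::field \<Rightarrow> 'w::ab_group_add \<Rightarrow> 'w"
  assumes "vector_space t" and "\<And>\<phi>. Vector_Spaces.linear t (*) \<phi> \<Longrightarrow> \<phi> x = 0"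
  shows "x = 0"
proof (rule ccontr)
  assume "x \<noteq> 0"
  interpret V: vector_space t by fact
  interpret K: vector_space "(*) :: 'k \<Rightarrow> 'k \<Rightarrow> 'k"
    by unfold_locales (auto simp: algebra_simps)
  interpret VK: vector_space_pair t "(*) :: 'k \<Rightarrow> 'k \<Rightarrow> 'k" ..
  have "V.independent {x}" using \<open>x \<noteq> 0\<close> by simp
  from VK.linear_independent_extend[OF this, of "\<lambda>_. 1"] obtain g
    where "Vector_Spaces.linear t (*) g" "g x = 1" by auto
  with assms(2)[of g] show False by simp
qed

lemma linear_sum_list:
  "Vector_Spaces.linear s t f \<Longrightarrow> f (\<Sum>x\<leftarrow>xs. g x) = (\<Sum>x\<leftarrow>xs. f (g x))"
  by (induction xs)
    (auto simp: Vector_Spaces.linear_def module_hom.zero module_hom.add)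

lemma sum_list_fun_apply: "(\<Sum>x\<leftarrow>xs. g x) y = (\<Sum>x\<leftarrow>xs. g x y)"
  by (induction xs) auto

lemma pure2_bilin: "vector_space s \<Longrightarrow> bilin_map s fun_scale (pure2 s)"
  unfolding bilin_map_def Vector_Spaces.linear_iff
  by (auto simp: vector_space_fun_scale pure2_def fun_scale_def fun_eq_iff bilin_map_def Vector_Spaces.linear_iff)

lemma pure3_trilin: "vector_space s \<Longrightarrow> trilin_map s fun_scale (pure3 s)"
  unfolding trilin_map_def Vector_Spaces.linear_iff
  by (auto simp: vector_space_fun_scale pure3_def fun_scale_def fun_eq_iff trilin_map_def Vector_Spaces.linear_iff)

lemma fun_scale_sum_list: "fun_scale c (\<Sum>x\<leftarrow>xs. g x) = (\<Sum>x\<leftarrow>xs. fun_scale c (g x))"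
  by (induction xs) (auto simp: fun_scale_def fun_eq_iff algebra_simps)

lemma tensor2_eq_sums:
  assumes "vector_space s"
  shows "tensor2 s = {\<Sum>(u, v)\<leftarrow>xs. pure2 s u v | xs. True}" (is "_ = ?R")
proof -
  interpret F: vector_space "fun_scale :: 'a \<Rightarrow> ('a, 'b) tens2 \<Rightarrow> _"
    by (rule vector_space_fun_scale)
  have sc: "fun_scale c (pure2 s u v) = pure2 s (s c u) v" for c u v
    using pure2_bilin[OF assms] by (simp add: bilin_map_def Vector_Spaces.linear_iff)
  have "(\<Sum>(u, v)\<leftarrow>xs. pure2 s u v) \<in> tensor2 s" for xs
  proof (induction xs)
    case Nil
    show ?case unfolding tensor2_def list.map sum_list.Nil by (rule F.span_zero)
  next
    case (Cons a xs)
    then show ?case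
      unfolding tensor2_def list.map sum_list.Cons
      by (intro F.span_add[OF F.span_base]) (auto simp: case_prod_beta')
  qed
  moreover have "tensor2 s \<subseteq> ?R"
    unfolding tensor2_def
  proof (rule F.span_minimal)
    show "{pure2 s u v |u v. True} \<subseteq> ?R"
    proof clarify
      fix u v show "\<exists>xs. pure2 s u v = (\<Sum>(u, v)\<leftarrow>xs. pure2 s u v) \<and> True"
        by (rule exI[of _ "[(u, v)]"]) simp
    qed
    show "F.subspace ?R"
    proof (rule F.subspaceI)
      show "0 \<in> ?R" by (auto intro!: exI[of _ "[]"])
      fix x y assume "x \<in> ?R" "y \<in> ?R"
      then obtain xs ys where "x = (\<Sum>(u, v)\<leftarrow>xs. pure2 s u v)" "y = (\<Sum>(u, v)\<leftarrow>ys. pure2 s u v)"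
        by auto
      then show "x + y \<in> ?R" by (auto intro!: exI[of _ "xs @ ys"])
    next
      fix c x assume "x \<in> ?R"
      then obtain xs where "x = (\<Sum>(u, v)\<leftarrow>xs. pure2 s u v)" by auto
      then have "fun_scale c x = (\<Sum>(u, v)\<leftarrow>map (\<lambda>(u, v). (s c u, v)) xs. pure2 s u v)"
        by (simp add: fun_scale_sum_list sc case_prod_beta' o_def)
      then show "fun_scale c x \<in> ?R" by blast
    qed
  qed
  ultimately show ?thesis by blast
qed

lemma tensor3_eq_sums:
  assumes "vector_space s"
  shows "tensor3 s = {\<Sum>(x, y, z)\<leftarrow>xs. pure3 s x y z | xs. True}" (is "_ = ?R")
proof -
  interpret F: vector_space "fun_scale :: 'a \<Rightarrow> ('a, 'b) tens3 \<Rightarrow> _"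
    by (rule vector_space_fun_scale)
  have sc: "fun_scale c (pure3 s u v w) = pure3 s (s c u) v w" for c u v w
    using pure3_trilin[OF assms] by (simp add: trilin_map_def Vector_Spaces.linear_iff)
  have "(\<Sum>(x, y, z)\<leftarrow>xs. pure3 s x y z) \<in> tensor3 s" for xs
  proof (induction xs)
    case Nil
    show ?case unfolding tensor3_def list.map sum_list.Nil by (rule F.span_zero)
  next
    case (Cons a xs)
    then show ?case
      unfolding tensor3_def list.map sum_list.Cons
      by (intro F.span_add[OF F.span_base]) (auto simp: case_prod_beta')
  qed
  moreover have "tensor3 s \<subseteq> ?R"
    unfolding tensor3_def
  proof (rule F.span_minimal)
    show "{pure3 s u v w |u v w. True} \<subseteq> ?R"
    proof clarify
      fix u v w show "\<exists>xs. pure3 s u v w = (\<Sum>(x, y, z)\<leftarrow>xs. pure3 s x y z) \<and> True"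
        by (rule exI[of _ "[(u, v, w)]"]) simp
    qed
    show "F.subspace ?R"
    proof (rule F.subspaceI)
      show "0 \<in> ?R" by (auto intro!: exI[of _ "[]"])
      fix x y assume "x \<in> ?R" "y \<in> ?R"
      then obtain xs ys where "x = (\<Sum>(x, y, z)\<leftarrow>xs. pure3 s x y z)" "y = (\<Sum>(x, y, z)\<leftarrow>ys. pure3 s x y z)"
        by auto
      then show "x + y \<in> ?R" by (auto intro!: exI[of _ "xs @ ys"])
    next
      fix c x assume "x \<in> ?R"
      then obtain xs where "x = (\<Sum>(x, y, z)\<leftarrow>xs. pure3 s x y z)" by auto
      then have "fun_scale c x = (\<Sum>(x, y, z)\<leftarrow>map (\<lambda>(x, y, z). (s c x, y, z)) xs. pure3 s x y z)"
        by (simp add: fun_scale_sum_list sc case_prod_beta' o_def)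
      then show "fun_scale c x \<in> ?R" by blast
    qed
  qed
  ultimately show ?thesis by blast
qed

lemma lift2_sums:
  assumes "bilin_map s t f"
  shows "lift2 s f (\<Sum>(u, v)\<leftarrow>xs. pure2 s u v) = (\<Sum>(u, v)\<leftarrow>xs. f u v)"
  unfolding lift2_def
proof (rule the_equality, blast, clarify)
  fix ys assume eq: "(\<Sum>(u, v)\<leftarrow>xs. pure2 s u v) = (\<Sum>(u, v)\<leftarrow>ys. pure2 s u v)"
  have t: "vector_space t" using assms by (auto simp: bilin_map_def Vector_Spaces.linear_def)
  have "(\<Sum>(u, v)\<leftarrow>ys. f u v) - (\<Sum>(u, v)\<leftarrow>xs. f u v) = 0"
  proof (rule linear_functional_separates[OF t])
    fix \<phi> assume \<phi>: "Vector_Spaces.linear t (*) \<phi>"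
    then have "bilin_map s (*) (\<lambda>u v. \<phi> (f u v))"
      using assms unfolding bilin_map_def Vector_Spaces.linear_iff by simp
    then have *: "\<phi> (\<Sum>(u, v)\<leftarrow>zs. f u v) = (\<Sum>(u, v)\<leftarrow>zs. pure2 s u v) (\<lambda>u v. \<phi> (f u v))" for zs
      by (auto simp: linear_sum_list[OF \<phi>] sum_list_fun_apply pure2_def case_prod_beta')
    show "\<phi> ((\<Sum>(u, v)\<leftarrow>ys. f u v) - (\<Sum>(u, v)\<leftarrow>xs. f u v)) = 0"
      using eq by (simp add: module_hom.diff[OF Vector_Spaces.linear.axioms(3)[OF \<phi>]] *)
  qed
  then show "(\<Sum>(u, v)\<leftarrow>ys. f u v) = (\<Sum>(u, v)\<leftarrow>xs. f u v)" by simp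
qed

lemma lift3_sums:
  assumes "trilin_map s t f"
  shows "lift3 s f (\<Sum>(x, y, z)\<leftarrow>xs. pure3 s x y z) = (\<Sum>(x, y, z)\<leftarrow>xs. f x y z)"
  unfolding lift3_def
proof (rule the_equality, blast, clarify)
  fix ys assume eq: "(\<Sum>(x, y, z)\<leftarrow>xs. pure3 s x y z) = (\<Sum>(x, y, z)\<leftarrow>ys. pure3 s x y z)"
  have t: "vector_space t" using assms by (auto simp: trilin_map_def Vector_Spaces.linear_def)
  have "(\<Sum>(x, y, z)\<leftarrow>ys. f x y z) - (\<Sum>(x, y, z)\<leftarrow>xs. f x y z) = 0"
  proof (rule linear_functional_separates[OF t])
    fix \<phi> assume \<phi>: "Vector_Spaces.linear t (*) \<phi>"
    then have "trilin_map s (*) (\<lambda>x y z. \<phi> (f x y z))"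
      using assms unfolding trilin_map_def Vector_Spaces.linear_iff by simp
    then have *: "\<phi> (\<Sum>(x, y, z)\<leftarrow>zs. f x y z) = (\<Sum>(x, y, z)\<leftarrow>zs. pure3 s x y z) (\<lambda>x y z. \<phi> (f x y z))" for zs
      by (auto simp: linear_sum_list[OF \<phi>] sum_list_fun_apply pure3_def case_prod_beta')
    show "\<phi> ((\<Sum>(x, y, z)\<leftarrow>ys. f x y z) - (\<Sum>(x, y, z)\<leftarrow>xs. f x y z)) = 0"
      using eq by (simp add: module_hom.diff[OF Vector_Spaces.linear.axioms(3)[OF \<phi>]] *)
  qed
  then show "(\<Sum>(x, y, z)\<leftarrow>ys. f x y z) = (\<Sum>(x, y, z)\<leftarrow>xs. f x y z)" by simp
qed

theorem lift2_pure2: "bilin_map s t f \<Longrightarrow> lift2 s f (pure2 s u v) = f u v"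
  using lift2_sums[of s t f "[(u, v)]"] by simp

theorem lift2_linear:
  assumes "bilin_map s t f"
  shows "x \<in> tensor2 s \<Longrightarrow> y \<in> tensor2 s \<Longrightarrow> lift2 s f (x + y) = lift2 s f x + lift2 s f y"
    and "x \<in> tensor2 s \<Longrightarrow> lift2 s f (fun_scale c x) = t c (lift2 s f x)"
proof -
  have s: "vector_space s" and t: "vector_space t"
    using assms by (auto simp: bilin_map_def Vector_Spaces.linear_def)
  interpret T: vector_space t by (rule t)
  { assume "x \<in> tensor2 s" "y \<in> tensor2 s"
    then obtain xs ys where "x = (\<Sum>(u, v)\<leftarrow>xs. pure2 s u v)" "y = (\<Sum>(u, v)\<leftarrow>ys. pure2 s u v)"
      by (auto simp: tensor2_eq_sums[OF s])
    then show "lift2 s f (x + y) = lift2 s f x + lift2 s f y"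
      using lift2_sums[OF assms, of "xs @ ys"] by (simp add: lift2_sums[OF assms]) }
  { assume "x \<in> tensor2 s"
    then obtain xs where x: "x = (\<Sum>(u, v)\<leftarrow>xs. pure2 s u v)"
      by (auto simp: tensor2_eq_sums[OF s])
    have "fun_scale c x = (\<Sum>(u, v)\<leftarrow>map (\<lambda>(u, v). (s c u, v)) xs. pure2 s u v)"
      using pure2_bilin[OF s]
      by (simp add: x bilin_map_def Vector_Spaces.linear_iff fun_scale_sum_list case_prod_beta' o_def)
    moreover have "t c (\<Sum>(u, v)\<leftarrow>xs. f u v) = (\<Sum>(u, v)\<leftarrow>map (\<lambda>(u, v). (s c u, v)) xs. f u v)"
      using assms
      by (induction xs)
        (auto simp: bilin_map_def Vector_Spaces.linear_iff T.scale_zero_right T.scale_right_distrib)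
    ultimately show "lift2 s f (fun_scale c x) = t c (lift2 s f x)"
      by (simp only: x lift2_sums[OF assms]) }
qed

theorem lift3_pure3: "trilin_map s t f \<Longrightarrow> lift3 s f (pure3 s x y z) = f x y z"
  using lift3_sums[of s t f "[(x, y, z)]"] by simp


section \<open>Linear maps between tensor powers\<close>

definition map_left :: "('k::field \<Rightarrow> 'v::ab_group_add \<Rightarrow> 'v) \<Rightarrow> ('v \<Rightarrow> 'v) \<Rightarrow> ('k, 'v) tens2 \<Rightarrow> ('k, 'v) tens2" where
  \<comment> \<open>\<open>f \<otimes> I\<close>\<close>
  "map_left s f = lift2 s (\<lambda>u v. pure2 s (f u) v)"

definition map_right :: "('k::field \<Rightarrow> 'v::ab_group_add \<Rightarrow> 'v) \<Rightarrow> ('v \<Rightarrow> 'v) \<Rightarrow> ('k, 'v) tens2 \<Rightarrow> ('k, 'v) tens2" where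
  \<comment> \<open>\<open>I \<otimes> f\<close>\<close>
  "map_right s f = lift2 s (\<lambda>u v. pure2 s u (f v))"

definition flip :: "('k::field \<Rightarrow> 'v::ab_group_add \<Rightarrow> 'v) \<Rightarrow> ('k, 'v) tens2 \<Rightarrow> ('k, 'v) tens2" where
  \<comment> \<open>\<open>\<tau>\<close>\<close>
  "flip s = lift2 s (\<lambda>u v. pure2 s v u)"

definition flip12 :: "('k::field \<Rightarrow> 'v::ab_group_add \<Rightarrow> 'v) \<Rightarrow> ('k, 'v) tens3 \<Rightarrow> ('k, 'v) tens3" where
  \<comment> \<open>\<open>\<tau> \<otimes> I\<close>\<close>
  "flip12 s = lift3 s (\<lambda>x y z. pure3 s y x z)"

definition comul_left :: "('k::field \<Rightarrow> 'v::ab_group_add \<Rightarrow> 'v) \<Rightarrow> ('v \<Rightarrow> ('k, 'v) tens2) \<Rightarrow> ('k, 'v) tens2 \<Rightarrow> ('k, 'v) tens3" where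
  \<comment> \<open>\<open>D \<otimes> I\<close>\<close>
  "comul_left s D = lift2 s (\<lambda>u v. lift2 s (\<lambda>x y. pure3 s x y v) (D u))"

definition comul_right :: "('k::field \<Rightarrow> 'v::ab_group_add \<Rightarrow> 'v) \<Rightarrow> ('v \<Rightarrow> ('k, 'v) tens2) \<Rightarrow> ('k, 'v) tens2 \<Rightarrow> ('k, 'v) tens3" where
  \<comment> \<open>\<open>I \<otimes> D\<close>\<close>
  "comul_right s D = lift2 s (\<lambda>u v. lift2 s (\<lambda>x y. pure3 s u x y) (D v))"

definition comul :: "('k::field \<Rightarrow> 'v::ab_group_add \<Rightarrow> 'v) \<Rightarrow> ('v \<Rightarrow> ('k, 'v) tens2) \<Rightarrow> bool" where
  "comul s D \<longleftrightarrow> Vector_Spaces.linear s fun_scale D \<and> range D \<subseteq> tensor2 s"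


section \<open>PGD-algebras\<close>

definition novikov_algebra :: "('k::field \<Rightarrow> 'v::ab_group_add \<Rightarrow> 'v) \<Rightarrow> ('v \<Rightarrow> 'v \<Rightarrow> 'v) \<Rightarrow> bool" where
  "novikov_algebra s m \<longleftrightarrow> bilin_map s s m \<and>
     (\<forall>a b c. m (m a b) c - m a (m b c) = m (m b a) c - m b (m a c)) \<and>
     (\<forall>a b c. m (m a b) c = m (m a c) b)"

definition lie_algebra :: "('k::field \<Rightarrow> 'v::ab_group_add \<Rightarrow> 'v) \<Rightarrow> ('v \<Rightarrow> 'v \<Rightarrow> 'v) \<Rightarrow> bool" where
  "lie_algebra s br \<longleftrightarrow> bilin_map s s br \<and>
     (\<forall>a. br a a = 0) \<and>
     (\<forall>a b c. br a (br b c) + br b (br c a) + br c (br a b) = 0)"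

definition comm_assoc_algebra :: "('k::field \<Rightarrow> 'v::ab_group_add \<Rightarrow> 'v) \<Rightarrow> ('v \<Rightarrow> 'v \<Rightarrow> 'v) \<Rightarrow> bool" where
  "comm_assoc_algebra s d \<longleftrightarrow> bilin_map s s d \<and>
     (\<forall>a b. d a b = d b a) \<and>
     (\<forall>a b c. d (d a b) c = d a (d b c))"

definition gd_algebra ::
  "('k::field \<Rightarrow> 'v::ab_group_add \<Rightarrow> 'v) \<Rightarrow> ('v \<Rightarrow> 'v \<Rightarrow> 'v) \<Rightarrow> ('v \<Rightarrow> 'v \<Rightarrow> 'v) \<Rightarrow> bool" where
  "gd_algebra s m br \<longleftrightarrow> novikov_algebra s m \<and> lie_algebra s br \<and>
     (\<forall>a b c. br (m a b) c - br (m a c) b + m (br a b) c - m (br a c) b - m a (br b c) = 0)"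

definition poisson_algebra ::
  "('k::field \<Rightarrow> 'v::ab_group_add \<Rightarrow> 'v) \<Rightarrow> ('v \<Rightarrow> 'v \<Rightarrow> 'v) \<Rightarrow> ('v \<Rightarrow> 'v \<Rightarrow> 'v) \<Rightarrow> bool" where
  "poisson_algebra s d br \<longleftrightarrow> comm_assoc_algebra s d \<and> lie_algebra s br \<and>
     (\<forall>a b c. br a (d b c) = d (br a b) c + d b (br a c))"

definition diff_novikov_poisson_algebra ::
  "('k::field \<Rightarrow> 'v::ab_group_add \<Rightarrow> 'v) \<Rightarrow> ('v \<Rightarrow> 'v \<Rightarrow> 'v) \<Rightarrow> ('v \<Rightarrow> 'v \<Rightarrow> 'v) \<Rightarrow> bool" where
  "diff_novikov_poisson_algebra s m d \<longleftrightarrow> novikov_algebra s m \<and> comm_assoc_algebra s d \<and>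
     (\<forall>a b c. m (d a b) c = d a (m b c)) \<and>
     (\<forall>a b c. m a (d b c) = d (m a b) c + d b (m a c))"

definition pgd_algebra ::
  "('k::field \<Rightarrow> 'v::ab_group_add \<Rightarrow> 'v) \<Rightarrow> ('v \<Rightarrow> 'v \<Rightarrow> 'v) \<Rightarrow> ('v \<Rightarrow> 'v \<Rightarrow> 'v) \<Rightarrow> ('v \<Rightarrow> 'v \<Rightarrow> 'v) \<Rightarrow> bool" where
  "pgd_algebra s m d br \<longleftrightarrow>
     gd_algebra s m br \<and> poisson_algebra s d br \<and> diff_novikov_poisson_algebra s m d"

definition star :: "('v::ab_group_add \<Rightarrow> 'v \<Rightarrow> 'v) \<Rightarrow> 'v \<Rightarrow> 'v \<Rightarrow> 'v" where
  "star m a b = m a b + m b a"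


section \<open>PGD-coalgebras\<close>

definition novikov_coalgebra :: "('k::field \<Rightarrow> 'v::ab_group_add \<Rightarrow> 'v) \<Rightarrow> ('v \<Rightarrow> ('k, 'v) tens2) \<Rightarrow> bool" where
  "novikov_coalgebra s D1 \<longleftrightarrow> comul s D1 \<and>
     (\<forall>a. comul_right s D1 (D1 a) - flip12 s (comul_right s D1 (D1 a))
        = comul_left s D1 (D1 a) - flip12 s (comul_left s D1 (D1 a))) \<and>
     (\<forall>a. flip12 s (comul_right s D1 (flip s (D1 a))) = comul_left s D1 (D1 a))"

definition cocomm_coassoc_coalgebra :: "('k::field \<Rightarrow> 'v::ab_group_add \<Rightarrow> 'v) \<Rightarrow> ('v \<Rightarrow> ('k, 'v) tens2) \<Rightarrow> bool" where
  "cocomm_coassoc_coalgebra s D2 \<longleftrightarrow> comul s D2 \<and>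
     (\<forall>a. comul_left s D2 (D2 a) = comul_right s D2 (D2 a)) \<and>
     (\<forall>a. D2 a = flip s (D2 a))"

definition lie_coalgebra :: "('k::field \<Rightarrow> 'v::ab_group_add \<Rightarrow> 'v) \<Rightarrow> ('v \<Rightarrow> ('k, 'v) tens2) \<Rightarrow> bool" where
  "lie_coalgebra s D0 \<longleftrightarrow> comul s D0 \<and>
     (\<forall>a. D0 a = - flip s (D0 a)) \<and>
     (\<forall>a. comul_right s D0 (D0 a) - flip12 s (comul_right s D0 (D0 a)) = comul_left s D0 (D0 a))"

definition gd_coalgebra ::
  "('k::field \<Rightarrow> 'v::ab_group_add \<Rightarrow> 'v) \<Rightarrow> ('v \<Rightarrow> ('k, 'v) tens2) \<Rightarrow> ('v \<Rightarrow> ('k, 'v) tens2) \<Rightarrow> bool" where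
  "gd_coalgebra s D1 D0 \<longleftrightarrow> novikov_coalgebra s D1 \<and> lie_coalgebra s D0 \<and>
     (\<forall>a. comul_right s D0 (D1 a) - flip12 s (comul_right s D1 (D0 a))
            + flip12 s (comul_right s D0 (flip s (D1 a)))
        = comul_left s D1 (D0 a) + comul_left s D0 (D1 a))"

definition poisson_coalgebra ::
  "('k::field \<Rightarrow> 'v::ab_group_add \<Rightarrow> 'v) \<Rightarrow> ('v \<Rightarrow> ('k, 'v) tens2) \<Rightarrow> ('v \<Rightarrow> ('k, 'v) tens2) \<Rightarrow> bool" where
  "poisson_coalgebra s D2 D0 \<longleftrightarrow> cocomm_coassoc_coalgebra s D2 \<and> lie_coalgebra s D0 \<and>
     (\<forall>a. comul_right s D2 (D0 a) = comul_left s D0 (D2 a) + flip12 s (comul_right s D0 (D2 a)))"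

definition diff_novikov_poisson_coalgebra ::
  "('k::field \<Rightarrow> 'v::ab_group_add \<Rightarrow> 'v) \<Rightarrow> ('v \<Rightarrow> ('k, 'v) tens2) \<Rightarrow> ('v \<Rightarrow> ('k, 'v) tens2) \<Rightarrow> bool" where
  "diff_novikov_poisson_coalgebra s D1 D2 \<longleftrightarrow> novikov_coalgebra s D1 \<and> cocomm_coassoc_coalgebra s D2 \<and>
     (\<forall>a. comul_right s D2 (D1 a) = comul_left s D1 (D2 a) + flip12 s (comul_right s D1 (D2 a))) \<and>
     (\<forall>a. comul_right s D2 (flip s (D1 a)) = flip12 s (comul_left s D1 (D2 a)))"


section \<open>PGD-bialgebras\<close>

definition novikov_bialgebra ::
  "('k::field \<Rightarrow> 'v::ab_group_add \<Rightarrow> 'v) \<Rightarrow> ('v \<Rightarrow> 'v \<Rightarrow> 'v) \<Rightarrow> ('v \<Rightarrow> ('k, 'v) tens2) \<Rightarrow> bool" where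
  "novikov_bialgebra s m D1 \<longleftrightarrow> novikov_algebra s m \<and> novikov_coalgebra s D1 \<and>
     (\<forall>a b. D1 (m a b) = map_left s (\<lambda>x. m x b) (D1 a) + map_right s (star m a) (D1 b + flip s (D1 b))) \<and>
     (\<forall>a b. map_left s (star m a) (D1 b) - map_right s (star m a) (flip s (D1 b))
          = map_left s (star m b) (D1 a) - map_right s (star m b) (flip s (D1 a))) \<and>
     (\<forall>a b. map_right s (\<lambda>x. m x a) (D1 b + flip s (D1 b)) - map_left s (\<lambda>x. m x a) (D1 b + flip s (D1 b))
          = map_right s (\<lambda>x. m x b) (D1 a + flip s (D1 a)) - map_left s (\<lambda>x. m x b) (D1 a + flip s (D1 a)))"

definition comm_cocomm_asi_bialgebra ::
  "('k::field \<Rightarrow> 'v::ab_group_add \<Rightarrow> 'v) \<Rightarrow> ('v \<Rightarrow> 'v \<Rightarrow> 'v) \<Rightarrow> ('v \<Rightarrow> ('k, 'v) tens2) \<Rightarrow> bool" where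
  "comm_cocomm_asi_bialgebra s d D2 \<longleftrightarrow> comm_assoc_algebra s d \<and> cocomm_coassoc_coalgebra s D2 \<and>
     (\<forall>a b. D2 (d a b) = map_right s (d a) (D2 b) + map_left s (d b) (D2 a))"

definition lie_bialgebra ::
  "('k::field \<Rightarrow> 'v::ab_group_add \<Rightarrow> 'v) \<Rightarrow> ('v \<Rightarrow> 'v \<Rightarrow> 'v) \<Rightarrow> ('v \<Rightarrow> ('k, 'v) tens2) \<Rightarrow> bool" where
  "lie_bialgebra s br D0 \<longleftrightarrow> lie_algebra s br \<and> lie_coalgebra s D0 \<and>
     (\<forall>a b. D0 (br a b) = (map_left s (br a) (D0 b) + map_right s (br a) (D0 b))
                        - (map_left s (br b) (D0 a) + map_right s (br b) (D0 a)))"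

definition gd_bialgebra ::
  "('k::field \<Rightarrow> 'v::ab_group_add \<Rightarrow> 'v) \<Rightarrow> ('v \<Rightarrow> 'v \<Rightarrow> 'v) \<Rightarrow> ('v \<Rightarrow> 'v \<Rightarrow> 'v) \<Rightarrow>
   ('v \<Rightarrow> ('k, 'v) tens2) \<Rightarrow> ('v \<Rightarrow> ('k, 'v) tens2) \<Rightarrow> bool" where
  "gd_bialgebra s m br D1 D0 \<longleftrightarrow>
     gd_algebra s m br \<and> gd_coalgebra s D1 D0 \<and> novikov_bialgebra s m D1 \<and> lie_bialgebra s br D0 \<and>
     (\<forall>a b. D0 (m b a) + D1 (br a b)
          = map_left s (\<lambda>x. m x a) (D0 b) + map_left s (m b) (D0 a) + map_right s (star m b) (D0 a)
            + (map_left s (br a) (D1 b) + map_right s (br a) (D1 b))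
            - map_right s (br b) (D1 a + flip s (D1 a)))"

definition poisson_bialgebra ::
  "('k::field \<Rightarrow> 'v::ab_group_add \<Rightarrow> 'v) \<Rightarrow> ('v \<Rightarrow> 'v \<Rightarrow> 'v) \<Rightarrow> ('v \<Rightarrow> 'v \<Rightarrow> 'v) \<Rightarrow>
   ('v \<Rightarrow> ('k, 'v) tens2) \<Rightarrow> ('v \<Rightarrow> ('k, 'v) tens2) \<Rightarrow> bool" where
  "poisson_bialgebra s d br D2 D0 \<longleftrightarrow>
     poisson_algebra s d br \<and> poisson_coalgebra s D2 D0 \<and>
     comm_cocomm_asi_bialgebra s d D2 \<and> lie_bialgebra s br D0 \<and>
     (\<forall>a b. D0 (d a b) = map_left s (d a) (D0 b) + map_left s (d b) (D0 a)
                       + map_right s (br a) (D2 b) + map_right s (br b) (D2 a)) \<and>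
     (\<forall>a b. D2 (br a b) = map_left s (br a) (D2 b) + map_right s (br a) (D2 b)
                        - map_right s (d b) (D0 a) + map_left s (d b) (D0 a))"

definition diff_novikov_poisson_bialgebra ::
  "('k::field \<Rightarrow> 'v::ab_group_add \<Rightarrow> 'v) \<Rightarrow> ('v \<Rightarrow> 'v \<Rightarrow> 'v) \<Rightarrow> ('v \<Rightarrow> 'v \<Rightarrow> 'v) \<Rightarrow>
   ('v \<Rightarrow> ('k, 'v) tens2) \<Rightarrow> ('v \<Rightarrow> ('k, 'v) tens2) \<Rightarrow> bool" where
  "diff_novikov_poisson_bialgebra s m d D1 D2 \<longleftrightarrow>
     diff_novikov_poisson_algebra s m d \<and> diff_novikov_poisson_coalgebra s D1 D2 \<and>
     novikov_bialgebra s m D1 \<and> comm_cocomm_asi_bialgebra s d D2 \<and>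
     (\<forall>a b. D1 (d a b) = map_left s (d a) (D1 b) - map_right s (star m b) (D2 a)) \<and>
     (\<forall>a b. D2 (m a b) = map_left s (\<lambda>x. m x b) (D2 a) - map_right s (d a) (D1 b + flip s (D1 b))) \<and>
     (\<forall>a b. map_left s (m a) (D2 b) + map_right s (m b) (D2 a) + map_right s (d b) (D1 a)
            + map_left s (d a) (flip s (D1 b)) = 0)"

definition pgd_bialgebra ::
  "('k::field \<Rightarrow> 'v::ab_group_add \<Rightarrow> 'v) \<Rightarrow> ('v \<Rightarrow> 'v \<Rightarrow> 'v) \<Rightarrow> ('v \<Rightarrow> 'v \<Rightarrow> 'v) \<Rightarrow> ('v \<Rightarrow> 'v \<Rightarrow> 'v) \<Rightarrow>
   ('v \<Rightarrow> ('k, 'v) tens2) \<Rightarrow> ('v \<Rightarrow> ('k, 'v) tens2) \<Rightarrow> ('v \<Rightarrow> ('k, 'v) tens2) \<Rightarrow> bool" where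
  "pgd_bialgebra s m d br D1 D2 D0 \<longleftrightarrow>
     gd_bialgebra s m br D1 D0 \<and> poisson_bialgebra s d br D2 D0 \<and>
     diff_novikov_poisson_bialgebra s m d D1 D2"


section \<open>Poisson conformal bialgebras\<close>

text \<open>
  A \<open>k[\<partial>]\<close>-module is a vector space \<open>(P, s)\<close> with a linear endomorphism \<open>\<partial>\<close>, here the parameter \<open>del\<close>.
  For an abelian group \<open>W\<close> of type \<^typ>\<open>'w\<close>, the group \<open>W[\<lambda>]\<close> is \<^typ>\<open>'w poly\<close>: multiplication by \<open>\<lambda>\<close>
  is \<open>pCons 0\<close>, the constant \<open>w\<close> is \<open>[:w:]\<close>, and \<open>map_poly T\<close> is the extension of an endomorphism \<open>T\<close>
  of \<open>W\<close>. In \<open>W[\<lambda>,\<mu>]\<close>, of type \<^typ>\<open>'w poly poly\<close>, the outer variable is \<open>\<mu>\<close>.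
\<close>

definition poly_scale :: "('k \<Rightarrow> 'v \<Rightarrow> 'v) \<Rightarrow> 'k \<Rightarrow> 'v::zero poly \<Rightarrow> 'v poly" where
  "poly_scale s c = map_poly (s c)"

definition subst_poly :: "('w \<Rightarrow> 'w) \<Rightarrow> ('v::zero \<Rightarrow> 'w::comm_monoid_add) \<Rightarrow> 'v poly \<Rightarrow> 'w" where
  \<comment> \<open>sends \<open>\<Sum>\<^sub>k \<nu>\<^sup>k c\<^sub>k\<close> to \<open>\<Sum>\<^sub>k T\<^sup>k (f c\<^sub>k)\<close>\<close>
  "subst_poly T f p = (\<Sum>k\<le>degree p. (T ^^ k) (f (coeff p k)))"

definition minus_lam_del :: "('w::ab_group_add \<Rightarrow> 'w) \<Rightarrow> 'w poly \<Rightarrow> 'w poly" where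
  \<comment> \<open>the operator \<open>-\<lambda> - \<partial>\<close> on \<open>W[\<lambda>]\<close>\<close>
  "minus_lam_del del X = - pCons 0 X - map_poly del X"

definition lam2 :: "'w::zero poly poly \<Rightarrow> 'w poly poly" where
  \<comment> \<open>multiplication by \<open>\<lambda>\<close> on \<open>W[\<lambda>,\<mu>]\<close>\<close>
  "lam2 = map_poly (pCons 0)"

definition mu2 :: "'w::zero poly poly \<Rightarrow> 'w poly poly" where
  "mu2 = pCons 0"

definition kdel_module :: "('k::field \<Rightarrow> 'p::ab_group_add \<Rightarrow> 'p) \<Rightarrow> ('p \<Rightarrow> 'p) \<Rightarrow> bool" where
  \<comment> \<open>finitely generated, by convention\<close>
  "kdel_module s del \<longleftrightarrow> Vector_Spaces.linear s s del \<and>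
     (\<exists>G. finite G \<and> module.span s {(del ^^ i) g | i g. g \<in> G} = UNIV)"

definition sesquilinear ::
  "('k::field \<Rightarrow> 'p::ab_group_add \<Rightarrow> 'p) \<Rightarrow> ('p \<Rightarrow> 'p) \<Rightarrow> ('p \<Rightarrow> 'p \<Rightarrow> 'p poly) \<Rightarrow> bool" where
  "sesquilinear s del f \<longleftrightarrow> bilin_map s (poly_scale s) f \<and>
     (\<forall>a b. f (del a) b = - pCons 0 (f a b)) \<and>
     (\<forall>a b. f a (del b) = map_poly del (f a b) + pCons 0 (f a b))"

definition at_minus_lam_del :: "('p::ab_group_add \<Rightarrow> 'p) \<Rightarrow> 'p poly \<Rightarrow> 'p poly" where
  \<comment> \<open>\<open>f\<^sub>\<nu>\<close> at \<open>\<nu> = -\<lambda> - \<partial>\<close>\<close>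
  "at_minus_lam_del del = subst_poly (minus_lam_del del) (\<lambda>c. [:c:])"

text \<open>
  The iterated operations \<open>a\<^sub>\<lambda>(b\<^sub>\<mu> c)\<close>, \<open>b\<^sub>\<mu>(a\<^sub>\<lambda> c)\<close> and \<open>(a\<^sub>\<lambda> b)\<^sub>\<lambda>\<^sub>+\<^sub>\<mu> c\<close>; the outer operation is \<open>f\<close>, the inner one \<open>g\<close>.
\<close>

definition nest_lam_mu :: "('p::ab_group_add \<Rightarrow> 'p \<Rightarrow> 'p poly) \<Rightarrow> ('p \<Rightarrow> 'p \<Rightarrow> 'p poly) \<Rightarrow> 'p \<Rightarrow> 'p \<Rightarrow> 'p \<Rightarrow> 'p poly poly" where
  "nest_lam_mu f g a b c = subst_poly mu2 (\<lambda>w. subst_poly lam2 (\<lambda>x. [:[:x:]:]) (f a w)) (g b c)"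

definition nest_mu_lam :: "('p::ab_group_add \<Rightarrow> 'p \<Rightarrow> 'p poly) \<Rightarrow> ('p \<Rightarrow> 'p \<Rightarrow> 'p poly) \<Rightarrow> 'p \<Rightarrow> 'p \<Rightarrow> 'p \<Rightarrow> 'p poly poly" where
  "nest_mu_lam f g b a c = subst_poly lam2 (\<lambda>w. subst_poly mu2 (\<lambda>x. [:[:x:]:]) (f b w)) (g a c)"

definition nest_sum :: "('p::ab_group_add \<Rightarrow> 'p \<Rightarrow> 'p poly) \<Rightarrow> ('p \<Rightarrow> 'p \<Rightarrow> 'p poly) \<Rightarrow> 'p \<Rightarrow> 'p \<Rightarrow> 'p \<Rightarrow> 'p poly poly" where
  "nest_sum f g a b c =
     subst_poly lam2 (\<lambda>w. subst_poly (\<lambda>X. lam2 X + mu2 X) (\<lambda>x. [:[:x:]:]) (f w c)) (g a b)"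

definition poisson_conformal_algebra ::
  "('k::field \<Rightarrow> 'p::ab_group_add \<Rightarrow> 'p) \<Rightarrow> ('p \<Rightarrow> 'p) \<Rightarrow> ('p \<Rightarrow> 'p \<Rightarrow> 'p poly) \<Rightarrow> ('p \<Rightarrow> 'p \<Rightarrow> 'p poly) \<Rightarrow> bool" where
  "poisson_conformal_algebra s del br pr \<longleftrightarrow> kdel_module s del \<and>
     sesquilinear s del br \<and>
     (\<forall>a b. br a b = - at_minus_lam_del del (br b a)) \<and>
     (\<forall>a b c. nest_lam_mu br br a b c = nest_sum br br a b c + nest_mu_lam br br b a c) \<and>
     sesquilinear s del pr \<and>
     (\<forall>a b c. nest_sum pr pr a b c = nest_lam_mu pr pr a b c) \<and>
     (\<forall>a b. pr a b = at_minus_lam_del del (pr b a)) \<and>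
     (\<forall>a b c. nest_lam_mu br pr a b c = nest_sum pr br a b c + nest_mu_lam pr br b a c)"

definition del2 :: "('k::field \<Rightarrow> 'p::ab_group_add \<Rightarrow> 'p) \<Rightarrow> ('p \<Rightarrow> 'p) \<Rightarrow> ('k, 'p) tens2 \<Rightarrow> ('k, 'p) tens2" where
  \<comment> \<open>\<open>\<partial> \<otimes> I + I \<otimes> \<partial>\<close>\<close>
  "del2 s del t = map_left s del t + map_right s del t"

definition kdel_comul :: "('k::field \<Rightarrow> 'p::ab_group_add \<Rightarrow> 'p) \<Rightarrow> ('p \<Rightarrow> 'p) \<Rightarrow> ('p \<Rightarrow> ('k, 'p) tens2) \<Rightarrow> bool" where
  \<comment> \<open>\<open>k[\<partial>]\<close>-module homomorphisms from \<open>P\<close> to \<open>P \<otimes> P\<close>\<close>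
  "kdel_comul s del D \<longleftrightarrow> comul s D \<and> (\<forall>p. D (del p) = del2 s del (D p))"

definition poisson_conformal_coalgebra ::
  "('k::field \<Rightarrow> 'p::ab_group_add \<Rightarrow> 'p) \<Rightarrow> ('p \<Rightarrow> 'p) \<Rightarrow> ('p \<Rightarrow> ('k, 'p) tens2) \<Rightarrow> ('p \<Rightarrow> ('k, 'p) tens2) \<Rightarrow> bool" where
  "poisson_conformal_coalgebra s del \<delta> \<Delta> \<longleftrightarrow> kdel_comul s del \<delta> \<and> kdel_comul s del \<Delta> \<and>
     (\<forall>a. comul_right s \<Delta> (\<Delta> a) = comul_left s \<Delta> (\<Delta> a)) \<and>
     (\<forall>a. \<Delta> a = flip s (\<Delta> a)) \<and>
     (\<forall>a. \<delta> a = - flip s (\<delta> a)) \<and>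
     (\<forall>a. comul_right s \<delta> (\<delta> a) - flip12 s (comul_right s \<delta> (\<delta> a)) = comul_left s \<delta> (\<delta> a)) \<and>
     (\<forall>a. comul_right s \<Delta> (\<delta> a) = comul_left s \<delta> (\<Delta> a) + flip12 s (comul_right s \<delta> (\<Delta> a)))"

text \<open>
  For \<open>T\<^sub>\<nu> : P \<rightarrow> P[\<nu>]\<close> and an operator \<open>\<Theta>\<close> on \<open>(P \<otimes> P)[\<lambda>]\<close>, the maps \<open>T\<^sub>\<Theta> \<otimes> I\<close> and \<open>I \<otimes> T\<^sub>\<Theta>\<close> from \<open>P \<otimes> P\<close> to
  \<open>(P \<otimes> P)[\<lambda>]\<close>. Below, \<open>\<Theta>\<close> is multiplication by \<open>\<lambda>\<close> (that is, \<open>pCons 0\<close>) or \<open>-\<lambda> - \<partial> \<otimes> I - I \<otimes> \<partial>\<close>.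
\<close>

definition cmap_left ::
  "('k::field \<Rightarrow> 'p::ab_group_add \<Rightarrow> 'p) \<Rightarrow> (('k, 'p) tens2 poly \<Rightarrow> ('k, 'p) tens2 poly) \<Rightarrow>
   ('p \<Rightarrow> 'p poly) \<Rightarrow> ('k, 'p) tens2 \<Rightarrow> ('k, 'p) tens2 poly" where
  "cmap_left s \<Theta> T = lift2 s (\<lambda>u v. subst_poly \<Theta> (\<lambda>w. [:pure2 s w v:]) (T u))"

definition cmap_right ::
  "('k::field \<Rightarrow> 'p::ab_group_add \<Rightarrow> 'p) \<Rightarrow> (('k, 'p) tens2 poly \<Rightarrow> ('k, 'p) tens2 poly) \<Rightarrow>
   ('p \<Rightarrow> 'p poly) \<Rightarrow> ('k, 'p) tens2 \<Rightarrow> ('k, 'p) tens2 poly" where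
  "cmap_right s \<Theta> T = lift2 s (\<lambda>u v. subst_poly \<Theta> (\<lambda>w. [:pure2 s u w:]) (T v))"

definition poisson_conformal_bialgebra ::
  "('k::field \<Rightarrow> 'p::ab_group_add \<Rightarrow> 'p) \<Rightarrow> ('p \<Rightarrow> 'p) \<Rightarrow> ('p \<Rightarrow> 'p \<Rightarrow> 'p poly) \<Rightarrow> ('p \<Rightarrow> 'p \<Rightarrow> 'p poly) \<Rightarrow>
   ('p \<Rightarrow> ('k, 'p) tens2) \<Rightarrow> ('p \<Rightarrow> ('k, 'p) tens2) \<Rightarrow> bool" where
  "poisson_conformal_bialgebra s del br pr \<delta> \<Delta> \<longleftrightarrow>
     poisson_conformal_algebra s del br pr \<and> poisson_conformal_coalgebra s del \<delta> \<Delta> \<and>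
     (let lam = pCons 0; mld = minus_lam_del (del2 s del) in
       (\<forall>a b. map_poly \<delta> (br a b)
            = (cmap_left s lam (br a) (\<delta> b) + cmap_right s lam (br a) (\<delta> b))
            - (cmap_left s mld (br b) (\<delta> a) + cmap_right s mld (br b) (\<delta> a))) \<and>
       (\<forall>a b. map_poly \<Delta> (pr a b)
            = cmap_right s lam (pr a) (\<Delta> b) + cmap_left s mld (pr b) (\<Delta> a)) \<and>
       (\<forall>a b. map_poly \<delta> (pr a b)
            = cmap_left s lam (pr a) (\<delta> b) + cmap_left s mld (pr b) (\<delta> a)
            + cmap_right s lam (br a) (\<Delta> b) + cmap_right s mld (br b) (\<Delta> a)) \<and>
       (\<forall>a b. map_poly \<Delta> (br a b)
            = cmap_left s lam (br a) (\<Delta> b) + cmap_right s lam (br a) (\<Delta> b)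
            - cmap_right s mld (pr b) (\<delta> a) + cmap_left s mld (pr b) (\<delta> a)))"


section \<open>The Poisson conformal algebra of a PGD-algebra\<close>

text \<open>
  \<open>P = k[\<partial>] \<otimes> A\<close> is the space of polynomials in \<open>\<partial>\<close> with coefficients in \<open>A\<close>, of type \<^typ>\<open>'a poly\<close>, with
  scalar multiplication \<open>poly_scale s\<close>, \<open>\<partial>\<close> acting as \<open>pCons 0\<close>, and \<open>a \<in> A\<close> identified with \<open>[:a:]\<close>.
  Hence in \<open>P[\<lambda>]\<close>, of type \<^typ>\<open>'a poly poly\<close>, the outer variable is \<open>\<lambda>\<close> and the inner one is \<open>\<partial>\<close>.
\<close>

definition sesqui_ext :: "('a::ab_group_add \<Rightarrow> 'a \<Rightarrow> 'a poly poly) \<Rightarrow> 'a poly \<Rightarrow> 'a poly \<Rightarrow> 'a poly poly" where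
  \<comment> \<open>\<open>(\<partial>\<^sup>i a)\<^sub>\<lambda> (\<partial>\<^sup>j b) = (-\<lambda>)\<^sup>i (\<partial> + \<lambda>)\<^sup>j (a\<^sub>\<lambda> b)\<close>\<close>
  "sesqui_ext B p q =
     subst_poly (\<lambda>X. - pCons 0 X)
       (\<lambda>a. subst_poly (\<lambda>X. map_poly (pCons 0) X + pCons 0 X) (\<lambda>b. B a b) q) p"

definition pgd_bracket ::
  "('a::ab_group_add \<Rightarrow> 'a \<Rightarrow> 'a) \<Rightarrow> ('a \<Rightarrow> 'a \<Rightarrow> 'a) \<Rightarrow> 'a poly \<Rightarrow> 'a poly \<Rightarrow> 'a poly poly" where
  "pgd_bracket m br =
     sesqui_ext (\<lambda>a b. [: pCons 0 [:m b a:] :] + pCons 0 [: [:m a b + m b a:] :] + [: [:br a b:] :])"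

definition pgd_product :: "('a::ab_group_add \<Rightarrow> 'a \<Rightarrow> 'a) \<Rightarrow> 'a poly \<Rightarrow> 'a poly \<Rightarrow> 'a poly poly" where
  "pgd_product d = sesqui_ext (\<lambda>a b. [: [:d a b:] :])"

definition kdel_ext ::
  "('k::field \<Rightarrow> 'a::ab_group_add \<Rightarrow> 'a) \<Rightarrow> ('a \<Rightarrow> ('k, 'a poly) tens2) \<Rightarrow> 'a poly \<Rightarrow> ('k, 'a poly) tens2" where
  \<comment> \<open>the \<open>k[\<partial>]\<close>-linear extension of a linear map \<open>A \<rightarrow> P \<otimes> P\<close> to \<open>P\<close>\<close>
  "kdel_ext s = subst_poly (del2 (poly_scale s) (pCons 0))"

definition const_tensor :: "('k::field \<Rightarrow> 'a::ab_group_add \<Rightarrow> 'a) \<Rightarrow> ('k, 'a) tens2 \<Rightarrow> ('k, 'a poly) tens2" where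
  \<comment> \<open>the inclusion of \<open>A \<otimes> A\<close> in \<open>P \<otimes> P\<close>\<close>
  "const_tensor s = lift2 s (\<lambda>a b. pure2 (poly_scale s) [:a:] [:b:])"

definition restr :: "('k::field \<Rightarrow> 'a::ab_group_add \<Rightarrow> 'a) \<Rightarrow> ('a poly \<Rightarrow> ('k, 'a poly) tens2) \<Rightarrow> 'a \<Rightarrow> ('k, 'a) tens2" where
  \<comment> \<open>the restriction \<open>A \<rightarrow> A \<otimes> A\<close> of \<open>D : P \<rightarrow> P \<otimes> P\<close> with \<open>D(A) \<subseteq> A \<otimes> A\<close>\<close>
  "restr s D a = (THE t. t \<in> tensor2 s \<and> const_tensor s t = D [:a:])"

end

theory Submission
  imports Defs
begin

text \<open>
  The field is infinite, so identities between polynomials in \<open>\<partial>\<close>, \<open>\<lambda>\<close>, \<open>\<mu>\<close> may be checked after scalars have been substituted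
  for the variables. Let \<open>p(X)\<close> be the value in \<open>A\<close> of \<open>p\<close> in \<open>P = A[\<partial>]\<close> at \<open>\<partial> = X\<close>. Sesquilinearity says that
  \<open>[p\<^sub>\<lambda> q]\<close>, taken at \<open>\<partial> = X\<close> and \<open>\<lambda> = L\<close>, equals \<open>F\<^bsub>X,L\<^esub>(p(-L), q(X + L))\<close>, where
  \<open>F\<^bsub>X,L\<^esub>(a, b) = X(b \<circ> a) + L(a \<star> b) + [a, b]\<close> is a bilinear product on \<open>A\<close>. Linearity over \<open>k[\<partial>]\<close> says that \<open>\<delta>(p)\<close>, taken at
  \<open>\<partial> \<otimes> I = X\<close> and \<open>I \<otimes> \<partial> = Y\<close>, equals \<open>\<delta>\<^bsub>X,Y\<^esub>(p(X + Y))\<close> with \<open>\<delta>\<^bsub>X,Y\<^esub> = X\<Delta>\<^sub>1 - Y\<tau>\<Delta>\<^sub>1 + \<delta>\<^sub>0\<close>. These families on \<open>A\<close> are called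
  symbols below. The conformal product and \<open>\<Delta>\<close> have the constant symbols \<open>\<cdot>\<close> and \<open>\<Delta>\<^sub>2\<close>.

  All terms of an axiom of Poisson conformal bialgebras involve their arguments at the same points. So every axiom is
  equivalent to an identity in \<open>A\<close>, \<open>A \<otimes> A\<close> or \<open>A \<otimes> A \<otimes> A\<close> between symbols, with scalar parameters and
  without any variable (\<open>poisson_conformal_algebraI\<close>, \<open>poisson_conformal_coalgebra_iff\<close>, \<open>poisson_conformal_bialgebra_iff\<close>).

  These identities have degree at most two in the parameters, and hold if and only if all their coefficients vanish. The first
  compatibility condition has as coefficients of \<open>X\<^sup>2\<close>, \<open>L\<^sup>2\<close> and \<open>XY\<close> essentially the three Novikov conditions, as coefficient
  of \<open>X\<close> the Gel'fand-Dorfman one and as constant term that of Lie bialgebras; the other coefficients follow from these by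
  \<open>\<tau>\<close> and by exchanging \<open>a\<close> and \<open>b\<close> (\<open>bracket_compat_expand\<close>). The two conditions that mix the bracket with the
  product give in the same way the Poisson and the differential Novikov-Poisson conditions (\<open>product_cobracket_expand\<close>,
  \<open>bracket_coproduct_expand\<close>). The coalgebra axioms are treated alike (\<open>lie_coalgebra_expand\<close>,
  \<open>poisson_coalgebra_expand\<close>). Coassociativity, cocommutativity and the second compatibility condition
  contain no parameter at all.
\<close>

section \<open>Evaluation of vector-valued polynomials\<close>

text \<open>
  For \<open>p\<close> in \<open>W[x]\<close>, with \<open>t\<close> the scalar multiplication of \<open>W\<close>, this is \<open>p(c)\<close> in \<open>W\<close>. Iterated, it also evaluates \<open>W[\<partial>][\<lambda>]\<close> and
  \<open>W[\<partial>][\<lambda>][\<mu>]\<close> at scalars, the outermost variable first.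
\<close>

definition veval :: "('k::field \<Rightarrow> 'w::ab_group_add \<Rightarrow> 'w) \<Rightarrow> 'k \<Rightarrow> 'w poly \<Rightarrow> 'w" where
  "veval t c p = (\<Sum>k\<le>degree p. t (c ^ k) (coeff p k))"

lemma linI:
  assumes "vector_space s" "vector_space t"
    and "\<And>x y. f (x + y) = f x + f y" and "\<And>c x. f (s c x) = t c (f x)"
  shows "Vector_Spaces.linear s t f"
  using assms by (simp add: Vector_Spaces.linear_iff)

lemma lin_add: "Vector_Spaces.linear s t f \<Longrightarrow> f (x + y) = f x + f y"
  and lin_scale: "Vector_Spaces.linear s t f \<Longrightarrow> f (s c x) = t c (f x)"
  by (auto simp: Vector_Spaces.linear_iff)

lemma lin_0: "Vector_Spaces.linear s t f \<Longrightarrow> f 0 = 0"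
  by (rule module_hom.zero[OF Vector_Spaces.linear.axioms(3)])

lemma lin_neg: "Vector_Spaces.linear s t f \<Longrightarrow> f (- x) = - f x"
  by (rule module_hom.neg[OF Vector_Spaces.linear.axioms(3)])

lemma lin_diff: "Vector_Spaces.linear s t f \<Longrightarrow> f (x - y) = f x - f y"
  by (rule module_hom.diff[OF Vector_Spaces.linear.axioms(3)])

lemma lin_sum: "Vector_Spaces.linear s t f \<Longrightarrow> f (\<Sum>i\<in>I. g i) = (\<Sum>i\<in>I. f (g i))"
  by (rule module_hom.sum[OF Vector_Spaces.linear.axioms(3)])

lemma lin_compose:
  "Vector_Spaces.linear s t f \<Longrightarrow> Vector_Spaces.linear t r g \<Longrightarrow> Vector_Spaces.linear s r (\<lambda>x. g (f x))"
  by (simp add: Vector_Spaces.linear_iff)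

lemma lin_vs: "Vector_Spaces.linear s t f \<Longrightarrow> vector_space s"
   "Vector_Spaces.linear s t f \<Longrightarrow> vector_space t"
  by (simp_all add: Vector_Spaces.linear_iff)

lemma vector_space_module: "vector_space s \<Longrightarrow> module s"
  by (simp add: vector_space_def module_def)

lemma vector_space_mult: "vector_space ((*) :: 'k::field \<Rightarrow> 'k \<Rightarrow> 'k)"
  by unfold_locales (auto simp: algebra_simps)

lemma coeff_poly_scale: "vector_space t \<Longrightarrow> coeff (poly_scale t c p) n = t c (coeff p n)"
  by (simp add: poly_scale_def coeff_map_poly module.scale_zero_right[OF vector_space_module])

lemma vector_space_poly_scale:
  assumes "vector_space t" shows "vector_space (poly_scale t)"
proof -
  interpret vector_space t by fact
  show ?thesis
    by unfold_locales (auto simp: poly_eq_iff coeff_poly_scale[OF assms] algebra_simps)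
qed

lemma veval_bound:
  assumes "vector_space t" "degree p \<le> n"
  shows "veval t c p = (\<Sum>k\<le>n. t (c ^ k) (coeff p k))"
  unfolding veval_def using assms
  by (intro sum.mono_neutral_left)
    (auto simp: coeff_eq_0 module.scale_zero_right[OF vector_space_module])

lemma veval_linear:
  assumes "vector_space t"
  shows "Vector_Spaces.linear (poly_scale t) t (veval t c)"
proof (rule linI[OF vector_space_poly_scale[OF assms] assms])
  interpret vector_space t by fact
  fix p q :: "'b poly"
  let ?n = "max (degree p) (degree q)"
  show "veval t c (p + q) = veval t c p + veval t c q"
    by (simp add: veval_bound[OF assms, of _ ?n] degree_add_le scale_right_distrib sum.distrib)
next
  interpret vector_space t by fact
  fix a and p :: "'b poly"
  have "degree (poly_scale t a p) \<le> degree p"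
    by (rule degree_le) (auto simp: coeff_poly_scale[OF assms] coeff_eq_0)
  then show "veval t c (poly_scale t a p) = t a (veval t c p)"
    by (simp add: veval_bound[OF assms, of _ "degree p"] coeff_poly_scale[OF assms] scale_sum_right mult.commute)
qed

lemma veval_pCons:
  assumes "vector_space t"
  shows "veval t c (pCons a p) = a + t c (veval t c p)"
proof -
  interpret vector_space t by fact
  have "veval t c (pCons a p) = (\<Sum>k\<le>Suc (degree p). t (c ^ k) (coeff (pCons a p) k))"
    by (rule veval_bound[OF assms]) (rule degree_pCons_le)
  then show ?thesis
    by (simp add: sum.atMost_Suc_shift scale_sum_right veval_def del: sum.atMost_Suc)
qed

lemma veval_0: "vector_space t \<Longrightarrow> veval t c 0 = 0"
  by (rule lin_0[OF veval_linear])

lemma veval_map_poly: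
  assumes "Vector_Spaces.linear s t f"
  shows "veval t c (map_poly f p) = f (veval s c p)"
proof -
  have "degree (map_poly f p) \<le> degree p"
    by (rule degree_le) (auto simp: coeff_map_poly lin_0[OF assms] coeff_eq_0)
  from veval_bound[OF lin_vs(2)[OF assms] this] show ?thesis
    using assms by (simp add: veval_def coeff_map_poly lin_0 lin_sum lin_scale)
qed

text \<open>
  A functional on \<open>W\<close> turns a polynomial over \<open>W\<close> into one over the infinite field, and functionals separate the
  points of \<open>W\<close>.
\<close>

lemma veval_separates:
  fixes t :: "'k::field_char_0 \<Rightarrow> 'w::ab_group_add \<Rightarrow> 'w"
  assumes t: "vector_space t" and 0: "\<And>c. veval t c p = 0"
  shows "p = 0"
proof (rule poly_eqI)
  fix n
  have "coeff p n = 0"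
  proof (rule linear_functional_separates[OF t])
    fix \<phi> assume \<phi>: "Vector_Spaces.linear t (*) \<phi>"
    have "poly (map_poly \<phi> p) = poly 0"
    proof
      fix c
      have "degree (map_poly \<phi> p) \<le> degree p" 
    by (rule degree_le) (auto simp: coeff_map_poly lin_0[OF \<phi>] coeff_eq_0)
      then have "poly (map_poly \<phi> p) c = veval (*) c (map_poly \<phi> p)"
        by (simp add: veval_def poly_altdef mult.commute)
      also have "\<dots> = 0" by (simp add: veval_map_poly[OF \<phi>] 0 lin_0[OF \<phi>])
      finally show "poly (map_poly \<phi> p) c = poly 0 c" by simp
    qed
    then have "map_poly \<phi> p = 0" by (simp only: poly_eq_poly_eq_iff)
    then have "coeff (map_poly \<phi> p) n = 0" by simp
    then show "\<phi> (coeff p n) = 0" by (simp add: coeff_map_poly lin_0[OF \<phi>])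
  qed
  then show "coeff p n = coeff 0 n" by simp
qed

lemma poly_eq_iff_veval:
  fixes t :: "'k::field_char_0 \<Rightarrow> 'w::ab_group_add \<Rightarrow> 'w"
  assumes t: "vector_space t"
  shows "p = q \<longleftrightarrow> (\<forall>c. veval t c p = veval t c q)"
  using veval_separates[OF t, of "p - q"] by (auto simp: lin_diff[OF veval_linear[OF t]])

text \<open>
  The reason why every operator substitution in a conformal identity disappears after evaluation: if \<open>h\<close> sees the
  operator \<open>T\<close> as the scalar \<open>c\<close>, then \<open>h\<close> sees the substitution of \<open>T\<close> as evaluation at \<open>c\<close>. The set \<open>S\<close> is there because
  \<open>\<partial> \<otimes> I + I \<otimes> \<partial>\<close> is under control on tensors only.
\<close>

lemma subst_poly_eval:
  assumes h: "\<And>x y. h (x + y) = h x + h y"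
    and T: "\<And>w. w \<in> S \<Longrightarrow> T w \<in> S \<and> h (T w) = t c (h w)"
    and f: "\<And>a. f a \<in> S" and hf: "\<And>a. h (f a) = g a"
    and g: "Vector_Spaces.linear s t g"
  shows "h (subst_poly T f p) = g (veval s c p)"
proof -
  interpret t: vector_space t by (rule lin_vs[OF g])
  have h0: "h 0 = 0" using h[of 0 0] by simp
  have hsum: "h (sum F I) = (\<Sum>i\<in>I. h (F i))" for F and I :: "nat set"
    by (induction I rule: infinite_finite_induct) (auto simp: h h0)
  have Tk: "w \<in> S \<Longrightarrow> (T ^^ k) w \<in> S \<and> h ((T ^^ k) w) = t (c ^ k) (h w)" for w k
    by (induction k) (auto simp: T)
  show ?thesis
    unfolding subst_poly_def veval_def lin_sum[OF g] lin_scale[OF g] hsum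
    by (simp add: Tk f hf)
qed

lemma subst_poly_closed:
  assumes "\<And>w. w \<in> S \<Longrightarrow> T w \<in> S" "\<And>a. f a \<in> S" "0 \<in> S" "\<And>x y. x \<in> S \<Longrightarrow> y \<in> S \<Longrightarrow> x + y \<in> S"
  shows "subst_poly T f p \<in> S"
proof -
  have "w \<in> S \<Longrightarrow> (T ^^ k) w \<in> S" for w k by (induction k) (auto simp: assms)
  then have *: "(T ^^ k) (f a) \<in> S" for k a using assms(2) by blast
  have "sum F I \<in> S" if "\<And>i. F i \<in> S" for F and I :: "nat set"
    by (induction I rule: infinite_finite_induct) (auto simp: assms that)
  then show ?thesis using * by (simp add: subst_poly_def)
qed

section \<open>Tensors as functionals on multilinear forms\<close>

lemma bilin_iff:
  "bilin_map s t f \<longleftrightarrow> vector_space s \<and> vector_space t \<and>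
     (\<forall>x y z. f (x + y) z = f x z + f y z) \<and> (\<forall>x y z. f x (y + z) = f x y + f x z) \<and>
     (\<forall>c x y. f (s c x) y = t c (f x y)) \<and> (\<forall>c x y. f x (s c y) = t c (f x y))"
  unfolding bilin_map_def Vector_Spaces.linear_iff by blast

lemma trilin_iff:
  "trilin_map s t f \<longleftrightarrow> vector_space s \<and> vector_space t \<and>
     (\<forall>x x' y z. f (x + x') y z = f x y z + f x' y z) \<and>
     (\<forall>x y y' z. f x (y + y') z = f x y z + f x y' z) \<and>
     (\<forall>x y z z'. f x y (z + z') = f x y z + f x y z') \<and>
     (\<forall>c x y z. f (s c x) y z = t c (f x y z)) \<and> (\<forall>c x y z. f x (s c y) z = t c (f x y z)) \<and>
     (\<forall>c x y z. f x y (s c z) = t c (f x y z))"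
  unfolding trilin_map_def Vector_Spaces.linear_iff by (rule iffI) simp_all

lemma lin_apply: "Vector_Spaces.linear fun_scale (*) (\<lambda>t. t \<beta>)"
  by (rule linI[OF vector_space_fun_scale vector_space_mult]) (auto simp: fun_scale_def)

text \<open>
  Tensors are functionals on bilinear forms, so a map induced from a bilinear one is computed by evaluating the
  tensor at a form; no representation as a sum of pure tensors appears. The rules for \<open>map_left\<close>, \<open>flip\<close>, \<open>comul_left\<close> and
  their companions below rest on this.
\<close>

lemma lift2_apply:
  assumes F: "bilin_map s t F" and \<phi>: "Vector_Spaces.linear t (*) \<phi>" and x: "x \<in> tensor2 s"
  shows "\<phi> (lift2 s F x) = x (\<lambda>u v. \<phi> (F u v))"
proof -
  have b: "bilin_map s (*) (\<lambda>u v. \<phi> (F u v))"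
    using F \<phi> unfolding bilin_map_def Vector_Spaces.linear_iff by simp
  have s: "vector_space s" using F by (simp add: bilin_iff)
  obtain xs where x: "x = (\<Sum>(u, v)\<leftarrow>xs. pure2 s u v)" using x by (auto simp: tensor2_eq_sums[OF s])
  show ?thesis unfolding x lift2_sums[OF F] using b
    by (simp add: sum_list_fun_apply pure2_def case_prod_beta' linear_sum_list[OF \<phi>])
qed

lemma lift3_apply:
  assumes F: "trilin_map s t F" and \<phi>: "Vector_Spaces.linear t (*) \<phi>" and x: "x \<in> tensor3 s"
  shows "\<phi> (lift3 s F x) = x (\<lambda>u v w. \<phi> (F u v w))"
proof -
  have b: "trilin_map s (*) (\<lambda>u v w. \<phi> (F u v w))"
    using F \<phi> unfolding trilin_map_def Vector_Spaces.linear_iff by simp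
  have s: "vector_space s" using F by (simp add: trilin_iff)
  obtain xs where x: "x = (\<Sum>(u, v, w)\<leftarrow>xs. pure3 s u v w)" using x by (auto simp: tensor3_eq_sums[OF s])
  show ?thesis unfolding x lift3_sums[OF F] using b
    by (simp add: sum_list_fun_apply pure3_def case_prod_beta' linear_sum_list[OF \<phi>])
qed

lemma lift2_closed:
  assumes F: "bilin_map s t F" and x: "x \<in> tensor2 s"
    and "\<And>u v. F u v \<in> S" "0 \<in> S" "\<And>a b. a \<in> S \<Longrightarrow> b \<in> S \<Longrightarrow> a + b \<in> S"
  shows "lift2 s F x \<in> S"
proof -
  have s: "vector_space s" using F by (simp add: bilin_iff)
  obtain xs where x: "x = (\<Sum>(u, v)\<leftarrow>xs. pure2 s u v)" using x by (auto simp: tensor2_eq_sums[OF s])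
  show ?thesis unfolding x lift2_sums[OF F]
    by (induction xs) (auto intro: assms(3-5))
qed

lemma lift3_closed:
  assumes F: "trilin_map s t F" and x: "x \<in> tensor3 s"
    and "\<And>u v w. F u v w \<in> S" "0 \<in> S" "\<And>a b. a \<in> S \<Longrightarrow> b \<in> S \<Longrightarrow> a + b \<in> S"
  shows "lift3 s F x \<in> S"
proof -
  have s: "vector_space s" using F by (simp add: trilin_iff)
  obtain xs where x: "x = (\<Sum>(u, v, w)\<leftarrow>xs. pure3 s u v w)" using x by (auto simp: tensor3_eq_sums[OF s])
  show ?thesis unfolding x lift3_sums[OF F]
    by (induction xs) (auto intro: assms(3-5))
qed

lemma subspace_tensor2: "module.subspace fun_scale (tensor2 s)"
  unfolding tensor2_def by (rule module.subspace_span[OF vector_space_module[OF vector_space_fun_scale]])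

lemma subspace_tensor3: "module.subspace fun_scale (tensor3 s)"
  unfolding tensor3_def by (rule module.subspace_span[OF vector_space_module[OF vector_space_fun_scale]])

lemma tensor2_closed [simp, intro]:
  fixes s :: "'k::field \<Rightarrow> 'v::ab_group_add \<Rightarrow> 'v"
  shows "0 \<in> tensor2 s"
    and "x \<in> tensor2 s \<Longrightarrow> y \<in> tensor2 s \<Longrightarrow> x + y \<in> tensor2 s"
    and "x \<in> tensor2 s \<Longrightarrow> y \<in> tensor2 s \<Longrightarrow> x - y \<in> tensor2 s"
    and "x \<in> tensor2 s \<Longrightarrow> - x \<in> tensor2 s"
    and "x \<in> tensor2 s \<Longrightarrow> fun_scale c x \<in> tensor2 s"
    and "pure2 s u v \<in> tensor2 s"
proof -
  interpret F: vector_space "fun_scale :: 'k \<Rightarrow> ('k, 'v) tens2 \<Rightarrow> _" by (rule vector_space_fun_scale)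
  note S = subspace_tensor2[of s]
  show "0 \<in> tensor2 s" by (rule F.subspace_0[OF S])
  show "x \<in> tensor2 s \<Longrightarrow> y \<in> tensor2 s \<Longrightarrow> x + y \<in> tensor2 s" by (rule F.subspace_add[OF S])
  show "x \<in> tensor2 s \<Longrightarrow> y \<in> tensor2 s \<Longrightarrow> x - y \<in> tensor2 s" by (rule F.subspace_diff[OF S])
  show "x \<in> tensor2 s \<Longrightarrow> - x \<in> tensor2 s" by (rule F.subspace_neg[OF S])
  show "x \<in> tensor2 s \<Longrightarrow> fun_scale c x \<in> tensor2 s" by (rule F.subspace_scale[OF S])
  show "pure2 s u v \<in> tensor2 s" unfolding tensor2_def by (rule F.span_base) auto
qed

lemma tensor3_closed [simp, intro]:
  fixes s :: "'k::field \<Rightarrow> 'v::ab_group_add \<Rightarrow> 'v"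
  shows "0 \<in> tensor3 s"
    and "x \<in> tensor3 s \<Longrightarrow> y \<in> tensor3 s \<Longrightarrow> x + y \<in> tensor3 s"
    and "x \<in> tensor3 s \<Longrightarrow> y \<in> tensor3 s \<Longrightarrow> x - y \<in> tensor3 s"
    and "pure3 s u v w \<in> tensor3 s"
proof -
  interpret F: vector_space "fun_scale :: 'k \<Rightarrow> ('k, 'v) tens3 \<Rightarrow> _" by (rule vector_space_fun_scale)
  note S = subspace_tensor3[of s]
  show "0 \<in> tensor3 s" by (rule F.subspace_0[OF S])
  show "x \<in> tensor3 s \<Longrightarrow> y \<in> tensor3 s \<Longrightarrow> x + y \<in> tensor3 s" by (rule F.subspace_add[OF S])
  show "x \<in> tensor3 s \<Longrightarrow> y \<in> tensor3 s \<Longrightarrow> x - y \<in> tensor3 s" by (rule F.subspace_diff[OF S])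
  show "pure3 s u v w \<in> tensor3 s" unfolding tensor3_def by (rule F.span_base) auto
qed

text \<open>
  As a function of the form, a tensor is linear only where the form is bilinear, whence the side conditions.
\<close>

lemma tensor2_form_lin:
  assumes s: "vector_space s" and t: "t \<in> tensor2 s"
  shows "\<not> bilin_map s (*) \<beta> \<Longrightarrow> t \<beta> = 0"
    and "t (\<lambda>u v. 0) = 0"
    and "bilin_map s (*) \<beta> \<Longrightarrow> bilin_map s (*) \<gamma> \<Longrightarrow> t (\<lambda>u v. \<beta> u v + \<gamma> u v) = t \<beta> + t \<gamma>"
    and "bilin_map s (*) \<beta> \<Longrightarrow> t (\<lambda>u v. c * \<beta> u v) = c * t \<beta>"
proof -
  obtain xs where t: "t = (\<Sum>(u, v)\<leftarrow>xs. pure2 s u v)" using t by (auto simp: tensor2_eq_sums[OF s])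
  have b: "t \<beta> = (\<Sum>(u, v)\<leftarrow>xs. \<beta> u v)" if "bilin_map s (*) \<beta>" for \<beta>
    using that by (simp add: t sum_list_fun_apply pure2_def case_prod_beta')
  have 0: "t \<beta> = 0" if "\<not> bilin_map s (*) \<beta>" for \<beta>
    using that by (simp add: t sum_list_fun_apply pure2_def case_prod_beta')
  show "\<not> bilin_map s (*) \<beta> \<Longrightarrow> t \<beta> = 0" by (rule 0)
  show "t (\<lambda>u v. 0) = 0"
    by (subst b) (auto simp: bilin_iff s vector_space_mult sum_list_0 case_prod_beta')
  { assume \<beta>: "bilin_map s (*) \<beta>" 
    then have "bilin_map s (*) (\<lambda>u v. c * \<beta> u v)" by (simp add: bilin_iff algebra_simps)
    then show "t (\<lambda>u v. c * \<beta> u v) = c * t \<beta>"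
      using \<beta> by (simp add: b sum_list_const_mult case_prod_beta') 
    assume \<gamma>: "bilin_map s (*) \<gamma>"
    with \<beta> have "bilin_map s (*) (\<lambda>u v. \<beta> u v + \<gamma> u v)" by (simp add: bilin_iff algebra_simps)
    with \<beta> \<gamma> show "t (\<lambda>u v. \<beta> u v + \<gamma> u v) = t \<beta> + t \<gamma>" by (simp add: b sum_list_addf case_prod_beta') }
qed

lemma tensor3_form_0:
  assumes s: "vector_space s" and t: "t \<in> tensor3 s"
  shows "\<not> trilin_map s (*) \<beta> \<Longrightarrow> t \<beta> = 0"
proof -
  obtain xs where t: "t = (\<Sum>(u, v, w)\<leftarrow>xs. pure3 s u v w)" using t by (auto simp: tensor3_eq_sums[OF s])
  show "\<not> trilin_map s (*) \<beta> \<Longrightarrow> t \<beta> = 0"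
    by (simp add: t sum_list_fun_apply pure3_def case_prod_beta')
qed

lemma tensor2_eq_iff:
  assumes "vector_space s" "t \<in> tensor2 s" "t' \<in> tensor2 s"
  shows "t = t' \<longleftrightarrow> (\<forall>\<beta>. bilin_map s (*) \<beta> \<longrightarrow> t \<beta> = t' \<beta>)"
  using tensor2_form_lin(1)[OF assms(1)] assms(2-) by (auto simp: fun_eq_iff) metis

lemma tensor3_eq_iff:
  assumes "vector_space s" "t \<in> tensor3 s" "t' \<in> tensor3 s"
  shows "t = t' \<longleftrightarrow> (\<forall>\<beta>. trilin_map s (*) \<beta> \<longrightarrow> t \<beta> = t' \<beta>)"
  using tensor3_form_0[OF assms(1)] assms(2-) by (auto simp: fun_eq_iff) metis

lemma lift2_apply_tensor:
  "bilin_map s fun_scale F \<Longrightarrow> x \<in> tensor2 s \<Longrightarrow> lift2 s F x \<beta> = x (\<lambda>u v. F u v \<beta>)"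
  by (rule lift2_apply[OF _ lin_apply])

lemma bilin_pure:
  assumes "Vector_Spaces.linear s t f" "Vector_Spaces.linear s t g"
  shows "bilin_map s fun_scale (\<lambda>u v. pure2 t (f u) (g v))"
    and "bilin_map s fun_scale (\<lambda>u v. pure2 t (g v) (f u))"
  using assms pure2_bilin[OF lin_vs(2)[OF assms(1)]]
  by (simp_all add: bilin_iff lin_vs lin_add lin_scale)

lemma lin_id: "vector_space s \<Longrightarrow> Vector_Spaces.linear s s (\<lambda>x. x)"
  by (rule linI) auto

lemma map_left_closed:
  "Vector_Spaces.linear s s f \<Longrightarrow> t \<in> tensor2 s \<Longrightarrow> map_left s f t \<in> tensor2 s"
  unfolding map_left_def
  by (rule lift2_closed[OF bilin_pure(1)[OF _ lin_id]]) (auto simp: lin_vs)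

lemma map_right_closed:
  "Vector_Spaces.linear s s f \<Longrightarrow> t \<in> tensor2 s \<Longrightarrow> map_right s f t \<in> tensor2 s"
  unfolding map_right_def
  by (rule lift2_closed[OF bilin_pure(1)[OF lin_id]]) (auto simp: lin_vs)

lemma flip_closed: "vector_space s \<Longrightarrow> t \<in> tensor2 s \<Longrightarrow> flip s t \<in> tensor2 s"
  unfolding flip_def
  by (rule lift2_closed[OF bilin_pure(2)[OF lin_id lin_id]]) (auto simp: lin_vs)

lemma map_left_apply:
  assumes "Vector_Spaces.linear s s f" "t \<in> tensor2 s" "bilin_map s (*) \<beta>"
  shows "map_left s f t \<beta> = t (\<lambda>u v. \<beta> (f u) v)"
  unfolding map_left_def
  by (subst lift2_apply_tensor[OF bilin_pure(1)[OF _ lin_id]])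
    (use assms in \<open>auto simp: lin_vs pure2_def\<close>)

lemma map_right_apply:
  assumes "Vector_Spaces.linear s s f" "t \<in> tensor2 s" "bilin_map s (*) \<beta>"
  shows "map_right s f t \<beta> = t (\<lambda>u v. \<beta> u (f v))"
  unfolding map_right_def
  by (subst lift2_apply_tensor[OF bilin_pure(1)[OF lin_id]])
    (use assms in \<open>auto simp: lin_vs pure2_def\<close>)

lemma flip_apply:
  assumes "t \<in> tensor2 s" "bilin_map s (*) \<beta>"
  shows "flip s t \<beta> = t (\<lambda>u v. \<beta> v u)"
  unfolding flip_def
  by (subst lift2_apply_tensor[OF bilin_pure(2)[OF lin_id lin_id]])
    (use assms in \<open>auto simp: bilin_iff pure2_def\<close>)

lemma flip12_trilin: "vector_space s \<Longrightarrow> trilin_map s fun_scale (\<lambda>x y z. pure3 s y x z)"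
  using pure3_trilin[of s] by (simp add: trilin_iff)

lemma flip12_closed: "vector_space s \<Longrightarrow> t \<in> tensor3 s \<Longrightarrow> flip12 s t \<in> tensor3 s"
  unfolding flip12_def by (rule lift3_closed[OF flip12_trilin]) auto

lemma flip12_apply:
  assumes "t \<in> tensor3 s" "trilin_map s (*) \<beta>"
  shows "flip12 s t \<beta> = t (\<lambda>x y z. \<beta> y x z)"
proof -
  have s: "vector_space s" using assms by (simp add: trilin_iff)
  have "flip12 s t \<beta> = t (\<lambda>x y z. pure3 s y x z \<beta>)"
    unfolding flip12_def by (rule lift3_apply[OF flip12_trilin[OF s] lin_apply assms(1)])
  then show ?thesis using assms by (simp add: pure3_def)
qed

lemma comulD:
  assumes "comul s D"
  shows "D a \<in> tensor2 s" "D (a + b) = D a + D b" "D (s c a) = fun_scale c (D a)" "vector_space s"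
  using assms unfolding comul_def by (auto simp: lin_add lin_scale lin_vs)

lemma bilin_slices:
  assumes "vector_space s"
  shows "bilin_map s fun_scale (\<lambda>x y. pure3 s x y v)" "bilin_map s fun_scale (\<lambda>x y. pure3 s v x y)"
  using pure3_trilin[OF assms] by (auto simp: bilin_iff trilin_iff)

lemma trilin_slices:
  assumes "trilin_map s t \<beta>"
  shows "bilin_map s t (\<lambda>x y. \<beta> x y v)" "bilin_map s t (\<beta> v)"
  using assms by (auto simp: bilin_iff trilin_iff)

lemma trilin_perms:
  assumes "trilin_map s t \<gamma>"
  shows "trilin_map s t (\<lambda>x y z. \<gamma> x z y)" "trilin_map s t (\<lambda>x y z. \<gamma> y x z)" "trilin_map s t (\<lambda>x y z. \<gamma> y z x)"
    "trilin_map s t (\<lambda>x y z. \<gamma> z x y)" "trilin_map s t (\<lambda>x y z. \<gamma> z y x)"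
  using assms by (simp_all add: trilin_iff)

lemma comul_slice_apply:
  assumes D: "comul s D"
  shows "lift2 s (\<lambda>x y. pure3 s x y v) (D u) \<beta> = (if trilin_map s (*) \<beta> then D u (\<lambda>x y. \<beta> x y v) else 0)"
    and "lift2 s (\<lambda>x y. pure3 s u x y) (D v) \<beta> = (if trilin_map s (*) \<beta> then D v (\<lambda>x y. \<beta> u x y) else 0)"
  unfolding lift2_apply_tensor[OF bilin_slices(1)[OF comulD(4)[OF D]] comulD(1)[OF D]]
    lift2_apply_tensor[OF bilin_slices(2)[OF comulD(4)[OF D]] comulD(1)[OF D]]
  using comulD[OF D] by (simp_all add: pure3_def tensor2_form_lin(2))

lemma comul_form_lin:
  assumes D: "comul s D" and \<beta>: "bilin_map s (*) \<beta>"
  shows "bilin_map s (*) \<gamma> \<Longrightarrow> D a (\<lambda>u v. \<beta> u v + \<gamma> u v) = D a \<beta> + D a \<gamma>"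
    and "D a (\<lambda>u v. c * \<beta> u v) = c * D a \<beta>"
    and "D (a + b) \<beta> = D a \<beta> + D b \<beta>"
    and "D (s c a) \<beta> = c * D a \<beta>"
  using comulD[OF D] \<beta> by (simp_all add: tensor2_form_lin fun_scale_def)

text \<open>
  These are the forms at which \<open>(D \<otimes> I)t\<close> and \<open>(I \<otimes> D)t\<close> evaluate \<open>t\<close>.
\<close>

lemma comul_slice_bilin:
  assumes D: "comul s D" and \<beta>: "trilin_map s (*) \<beta>"
  shows "bilin_map s (*) (\<lambda>u v. D u (\<lambda>x y. \<beta> x y v))"
    and "bilin_map s (*) (\<lambda>u v. D v (\<lambda>x y. \<beta> u x y))"
proof -
  note slices = comul_form_lin[OF D trilin_slices(1)[OF \<beta>]] comul_form_lin[OF D trilin_slices(2)[OF \<beta>]]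
    trilin_slices[OF \<beta>]
  have "(\<lambda>x y. \<beta> x y (v + v')) = (\<lambda>x y. \<beta> x y v + \<beta> x y v')"
    "(\<lambda>x y. \<beta> x y (s c v)) = (\<lambda>x y. c * \<beta> x y v)"
    "\<beta> (v + v') = (\<lambda>x y. \<beta> v x y + \<beta> v' x y)" "\<beta> (s c v) = (\<lambda>x y. c * \<beta> v x y)" for v v' c
    using \<beta> by (auto simp: trilin_iff fun_eq_iff)
  note lin = this
  show "bilin_map s (*) (\<lambda>u v. D u (\<lambda>x y. \<beta> x y v))" "bilin_map s (*) (\<lambda>u v. D v (\<lambda>x y. \<beta> u x y))"
    unfolding bilin_iff by (simp_all add: slices lin comulD(4)[OF D] vector_space_mult)
qed

lemma comul_bilin:
  assumes D: "comul s D"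
  shows "bilin_map s fun_scale (\<lambda>u v. lift2 s (\<lambda>x y. pure3 s x y v) (D u))"
    and "bilin_map s fun_scale (\<lambda>u v. lift2 s (\<lambda>x y. pure3 s u x y) (D v))"
  using comul_slice_bilin(1)[OF D] comul_slice_bilin(2)[OF D] comulD(4)[OF D]
  by (simp_all add: bilin_iff vector_space_fun_scale fun_eq_iff comul_slice_apply[OF D] fun_scale_def)

lemma comul_left_closed: "comul s D \<Longrightarrow> t \<in> tensor2 s \<Longrightarrow> comul_left s D t \<in> tensor3 s"
  unfolding comul_left_def
  by (rule lift2_closed[OF comul_bilin(1)])
    (auto intro!: lift2_closed[OF bilin_slices(1)] dest: comulD)

lemma comul_right_closed: "comul s D \<Longrightarrow> t \<in> tensor2 s \<Longrightarrow> comul_right s D t \<in> tensor3 s"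
  unfolding comul_right_def
  by (rule lift2_closed[OF comul_bilin(2)])
    (auto intro!: lift2_closed[OF bilin_slices(2)] dest: comulD)

lemma comul_left_apply:
  assumes "comul s D" "t \<in> tensor2 s" "trilin_map s (*) \<beta>"
  shows "comul_left s D t \<beta> = t (\<lambda>u v. D u (\<lambda>x y. \<beta> x y v))"
  unfolding comul_left_def
  using assms by (simp add: lift2_apply_tensor[OF comul_bilin(1)] comul_slice_apply)

lemma comul_right_apply:
  assumes "comul s D" "t \<in> tensor2 s" "trilin_map s (*) \<beta>"
  shows "comul_right s D t \<beta> = t (\<lambda>u v. D v (\<lambda>x y. \<beta> u x y))"
  unfolding comul_right_def
  using assms by (simp add: lift2_apply_tensor[OF comul_bilin(2)] comul_slice_apply)

section \<open>Evaluation of tensors over \<open>k[\<partial>] \<otimes> A\<close>\<close>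

lemma tensor2_induct:
  assumes s: "vector_space s" and t: "t \<in> tensor2 s" and 0: "P 0"
    and add: "\<And>u v t. t \<in> tensor2 s \<Longrightarrow> P t \<Longrightarrow> P (pure2 s u v + t)"
  shows "P t"
proof -
  obtain xs where t: "t = (\<Sum>(u, v)\<leftarrow>xs. pure2 s u v)" using t by (auto simp: tensor2_eq_sums[OF s])
  have "(\<Sum>(u, v)\<leftarrow>xs. pure2 s u v) \<in> tensor2 s" for xs unfolding tensor2_eq_sums[OF s] by blast
  then show ?thesis unfolding t
    by (induction xs) (simp_all only: list.map sum_list.Nil sum_list.Cons 0 add case_prod_beta')
qed

lemma tensor3_induct:
  assumes s: "vector_space s" and t: "t \<in> tensor3 s" and 0: "P 0"
    and add: "\<And>u v w t. t \<in> tensor3 s \<Longrightarrow> P t \<Longrightarrow> P (pure3 s u v w + t)"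
  shows "P t"
proof -
  obtain xs where t: "t = (\<Sum>(u, v, w)\<leftarrow>xs. pure3 s u v w)" using t by (auto simp: tensor3_eq_sums[OF s])
  have "(\<Sum>(u, v, w)\<leftarrow>xs. pure3 s u v w) \<in> tensor3 s" for xs unfolding tensor3_eq_sums[OF s] by blast
  then show ?thesis unfolding t
    by (induction xs) (simp_all only: list.map sum_list.Nil sum_list.Cons 0 add case_prod_beta')
qed

text \<open>
  The maps \<open>ev\<^sub>X \<otimes> ev\<^sub>Y : P \<otimes> P \<rightarrow> A \<otimes> A\<close> and \<open>ev\<^sub>X \<otimes> ev\<^sub>Y \<otimes> ev\<^sub>Z\<close>, where \<open>ev\<^sub>X : A[\<partial>] \<rightarrow> A\<close> puts \<open>\<partial> = X\<close>. Defined by pulling back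
  forms instead of by \<open>lift2\<close>, they are linear on all functionals, tensors or not.
\<close>

definition teval :: "('k::field \<Rightarrow> 'a::ab_group_add \<Rightarrow> 'a) \<Rightarrow> 'k \<Rightarrow> 'k \<Rightarrow> ('k, 'a poly) tens2 \<Rightarrow> ('k, 'a) tens2" where
  "teval s X Y t = (\<lambda>\<beta>. if bilin_map s (*) \<beta> then t (\<lambda>p q. \<beta> (veval s X p) (veval s Y q)) else 0)"

definition teval3 :: "('k::field \<Rightarrow> 'a::ab_group_add \<Rightarrow> 'a) \<Rightarrow> 'k \<Rightarrow> 'k \<Rightarrow> 'k \<Rightarrow> ('k, 'a poly) tens3 \<Rightarrow> ('k, 'a) tens3" where
  "teval3 s X Y Z t =
     (\<lambda>\<beta>. if trilin_map s (*) \<beta> then t (\<lambda>p q r. \<beta> (veval s X p) (veval s Y q) (veval s Z r)) else 0)"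

lemma bilin_veval:
  assumes "bilin_map s t \<beta>"
  shows "bilin_map (poly_scale s) t (\<lambda>p q. \<beta> (veval s X p) (veval s Y q))"
proof -
  have s: "vector_space s" using assms by (simp add: bilin_iff)
  show ?thesis using assms
    by (simp add: bilin_iff vector_space_poly_scale lin_add[OF veval_linear[OF s]] lin_scale[OF veval_linear[OF s]])
qed

lemma trilin_veval:
  assumes "trilin_map s t \<beta>"
  shows "trilin_map (poly_scale s) t (\<lambda>p q r. \<beta> (veval s X p) (veval s Y q) (veval s Z r))"
proof -
  have s: "vector_space s" using assms by (simp add: trilin_iff)
  show ?thesis using assms
    by (simp add: trilin_iff vector_space_poly_scale lin_add[OF veval_linear[OF s]] lin_scale[OF veval_linear[OF s]])
qed

lemma teval_apply:
  "bilin_map s (*) \<beta> \<Longrightarrow> teval s X Y t \<beta> = t (\<lambda>p q. \<beta> (veval s X p) (veval s Y q))"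
  by (simp add: teval_def)

lemma teval3_apply:
  "trilin_map s (*) \<beta> \<Longrightarrow>
     teval3 s X Y Z t \<beta> = t (\<lambda>p q r. \<beta> (veval s X p) (veval s Y q) (veval s Z r))"
  by (simp add: teval3_def)

lemma teval_pure: "teval s X Y (pure2 (poly_scale s) p q) = pure2 s (veval s X p) (veval s Y q)"
  by (auto simp: teval_def pure2_def fun_eq_iff bilin_veval)

lemma teval3_pure:
  "teval3 s X Y Z (pure3 (poly_scale s) p q r) = pure3 s (veval s X p) (veval s Y q) (veval s Z r)"
  by (auto simp: teval3_def pure3_def fun_eq_iff trilin_veval)

lemma teval_linear: "Vector_Spaces.linear fun_scale fun_scale (teval s X Y)"
  by (rule linI[OF vector_space_fun_scale vector_space_fun_scale]) (auto simp: teval_def fun_scale_def)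

lemma teval3_linear: "Vector_Spaces.linear fun_scale fun_scale (teval3 s X Y Z)"
  by (rule linI[OF vector_space_fun_scale vector_space_fun_scale]) (auto simp: teval3_def fun_scale_def)

lemmas teval_simps = lin_add[OF teval_linear] lin_scale[OF teval_linear] lin_0[OF teval_linear]
  lin_diff[OF teval_linear] lin_neg[OF teval_linear]

lemma teval_closed:
  assumes s: "vector_space s" and t: "t \<in> tensor2 (poly_scale s)"
  shows "teval s X Y t \<in> tensor2 s"
  by (rule tensor2_induct[OF vector_space_poly_scale[OF s] t])
    (simp_all only: teval_simps teval_pure tensor2_closed)

lemma power_sum_separates:
  fixes c :: "nat \<Rightarrow> 'k::field_char_0"
  assumes "\<And>X. (\<Sum>i\<le>N. X ^ i * c i) = 0" and "i \<le> N"
  shows "c i = 0"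
proof -
  let ?p = "\<Sum>i\<le>N. monom (c i) i"
  have "poly ?p = poly 0"
    using assms(1) by (simp add: poly_sum poly_monom fun_eq_iff mult.commute)
  then have "coeff ?p i = 0" by (simp add: poly_eq_poly_eq_iff)
  then show ?thesis using \<open>i \<le> N\<close> by (simp add: coeff_sum)
qed

lemma sum_list_sum: "(\<Sum>x\<leftarrow>xs. \<Sum>i\<in>I. f x i) = (\<Sum>i\<in>I. \<Sum>x\<leftarrow>xs. f x i)"
  by (induction xs) (auto simp: sum.distrib)

lemma poly_as_monoms: "degree p \<le> N \<Longrightarrow> p = (\<Sum>i\<le>N. monom (coeff p i) i)"
  by (rule poly_eqI) (auto simp: coeff_sum coeff_eq_0)

lemma monom_add_scale:
  "vector_space s \<Longrightarrow> monom (a + b) i = monom a i + monom b i"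
  "vector_space s \<Longrightarrow> monom (s c a) i = poly_scale s c (monom a i)"
  by (auto simp: add_monom poly_eq_iff coeff_poly_scale module.scale_zero_right[OF vector_space_module])

lemma bilin_sum:
  assumes "bilin_map s t \<beta>"
  shows "\<beta> (\<Sum>i\<in>I. f i) v = (\<Sum>i\<in>I. \<beta> (f i) v)" "\<beta> u (\<Sum>i\<in>I. g i) = (\<Sum>i\<in>I. \<beta> u (g i))"
  using assms by (auto simp: bilin_map_def intro!: lin_sum)

lemma trilin_sum:
  assumes "trilin_map s t \<beta>"
  shows "\<beta> (\<Sum>i\<in>I. f i) v w = (\<Sum>i\<in>I. \<beta> (f i) v w)" "\<beta> u (\<Sum>i\<in>I. g i) w = (\<Sum>i\<in>I. \<beta> u (g i) w)"
    "\<beta> u v (\<Sum>i\<in>I. g i) = (\<Sum>i\<in>I. \<beta> u v (g i))"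
  using assms lin_sum[of s t "\<lambda>x. \<beta> x v w"] lin_sum[of s t "\<lambda>x. \<beta> u x w"] lin_sum[of s t "\<lambda>x. \<beta> u v x"]
  by (auto simp: trilin_map_def)

text \<open>
  Write \<open>t\<close> as a finite sum of pure tensors. At a form \<open>\<beta>\<close> on \<open>A\<close>, its values under \<open>ev\<^sub>X \<otimes> ev\<^sub>Y\<close> form a polynomial in \<open>X\<close> and \<open>Y\<close>,
  whose coefficients therefore vanish. A form on \<open>P\<close> restricts to a form on \<open>\<partial>\<^sup>iA \<times> \<partial>\<^sup>jA\<close> for each \<open>i\<close> and \<open>j\<close>, so its
  value at \<open>t\<close> is a sum of such coefficients.
\<close>

lemma teval_separates:
  fixes s :: "'k::field_char_0 \<Rightarrow> 'a::ab_group_add \<Rightarrow> 'a"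
  assumes s: "vector_space s" and t: "t \<in> tensor2 (poly_scale s)" and 0: "\<And>X Y. teval s X Y t = 0"
  shows "t = 0"
proof -
  note ps = vector_space_poly_scale[OF s]
  obtain xs where xs: "t = (\<Sum>(p, q)\<leftarrow>xs. pure2 (poly_scale s) p q)"
    using t by (auto simp: tensor2_eq_sums[OF ps])
  have t_eq: "t \<gamma> = (\<Sum>(p, q)\<leftarrow>xs. \<gamma> p q)" if "bilin_map (poly_scale s) (*) \<gamma>" for \<gamma>
    using that by (simp add: xs sum_list_fun_apply pure2_def case_prod_beta')
  \<comment> \<open>a degree bound common to all terms, so that the sums over exponents can be exchanged with the sum over terms\<close>
  define N where "N = Max (insert 0 ((\<lambda>(p, q). max (degree p) (degree q)) ` set xs))"
  have N: "degree p \<le> N" "degree q \<le> N" if "(p, q) \<in> set xs" for p q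
  proof -
    have "max (degree p) (degree q) \<le> N" unfolding N_def
      by (rule Max_ge) (use that in \<open>auto simp: rev_image_eqI\<close>)
    then show "degree p \<le> N" "degree q \<le> N" by auto
  qed
  have coeffs: "(\<Sum>(p, q)\<leftarrow>xs. \<beta> (coeff p i) (coeff q j)) = 0"
    if \<beta>: "bilin_map s (*) \<beta>" and "i \<le> N" "j \<le> N" for \<beta> i j
  proof -
    have "(\<Sum>i\<le>N. X ^ i * (\<Sum>j\<le>N. Y ^ j * (\<Sum>(p, q)\<leftarrow>xs. \<beta> (coeff p i) (coeff q j)))) = 0" for X Y
    proof -
      have "\<beta> (veval s X p) (veval s Y q) = (\<Sum>i\<le>N. \<Sum>j\<le>N. X ^ i * (Y ^ j * \<beta> (coeff p i) (coeff q j)))"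
        if "(p, q) \<in> set xs" for p q
        unfolding veval_bound[OF s N(1)[OF that]] veval_bound[OF s N(2)[OF that]]
        unfolding bilin_sum(1)[OF \<beta>] unfolding bilin_sum(2)[OF \<beta>]
        using \<beta> by (simp add: bilin_iff mult.left_commute)
      then have "(\<Sum>(p, q)\<leftarrow>xs. \<beta> (veval s X p) (veval s Y q))
          = (\<Sum>(p, q)\<leftarrow>xs. \<Sum>i\<le>N. \<Sum>j\<le>N. X ^ i * (Y ^ j * \<beta> (coeff p i) (coeff q j)))"
        by (intro arg_cong[of _ _ sum_list] map_cong) auto
      moreover have "(\<Sum>(p, q)\<leftarrow>xs. \<beta> (veval s X p) (veval s Y q)) = teval s X Y t \<beta>"
        using \<beta> by (simp add: teval_def t_eq bilin_veval)
      ultimately show ?thesis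
        by (simp add: 0 case_prod_beta' sum_list_sum sum_list_const_mult sum_distrib_left)
    qed
    from power_sum_separates[OF power_sum_separates[OF this \<open>i \<le> N\<close>] \<open>j \<le> N\<close>]
    show ?thesis .
  qed
  have "t \<gamma> = 0" if \<gamma>: "bilin_map (poly_scale s) (*) \<gamma>" for \<gamma>
  proof -
    have "\<gamma> p q = (\<Sum>i\<le>N. \<Sum>j\<le>N. \<gamma> (monom (coeff p i) i) (monom (coeff q j) j))"
      if "(p, q) \<in> set xs" for p q
      by (subst poly_as_monoms[OF N(1)[OF that]], subst poly_as_monoms[OF N(2)[OF that]])
        (simp only: bilin_sum(1)[OF \<gamma>], simp only: bilin_sum(2)[OF \<gamma>])
    then have "t \<gamma> = (\<Sum>(p, q)\<leftarrow>xs. \<Sum>i\<le>N. \<Sum>j\<le>N. \<gamma> (monom (coeff p i) i) (monom (coeff q j) j))"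
      unfolding t_eq[OF \<gamma>] by (intro arg_cong[of _ _ sum_list] map_cong) auto
    also have "\<dots> = (\<Sum>i\<le>N. \<Sum>j\<le>N. \<Sum>(p, q)\<leftarrow>xs. \<gamma> (monom (coeff p i) i) (monom (coeff q j) j))"
      by (simp add: case_prod_beta' sum_list_sum)
    also have "\<dots> = 0"
    proof (intro sum.neutral ballI)
      fix i j assume "i \<in> {..N}" "j \<in> {..N}"
      moreover have "bilin_map s (*) (\<lambda>a b. \<gamma> (monom a i) (monom b j))"
        using \<gamma> by (simp add: bilin_iff s monom_add_scale[OF s])
      ultimately show "(\<Sum>(p, q)\<leftarrow>xs. \<gamma> (monom (coeff p i) i) (monom (coeff q j) j)) = 0"
        using coeffs[of "\<lambda>a b. \<gamma> (monom a i) (monom b j)" i j] by simp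
    qed
    finally show ?thesis .
  qed
  then show ?thesis by (subst tensor2_eq_iff[OF ps t]) auto
qed

lemma teval3_separates:
  fixes s :: "'k::field_char_0 \<Rightarrow> 'a::ab_group_add \<Rightarrow> 'a"
  assumes s: "vector_space s" and t: "t \<in> tensor3 (poly_scale s)" and 0: "\<And>X Y Z. teval3 s X Y Z t = 0"
  shows "t = 0"
proof -
  note ps = vector_space_poly_scale[OF s]
  obtain xs where xs: "t = (\<Sum>(p, q, r)\<leftarrow>xs. pure3 (poly_scale s) p q r)"
    using t by (auto simp: tensor3_eq_sums[OF ps])
  have t_eq: "t \<gamma> = (\<Sum>(p, q, r)\<leftarrow>xs. \<gamma> p q r)" if "trilin_map (poly_scale s) (*) \<gamma>" for \<gamma>
    using that by (simp add: xs sum_list_fun_apply pure3_def case_prod_beta')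
  \<comment> \<open>again a common degree bound\<close>
  define N where "N = Max (insert 0 ((\<lambda>(p, q, r). max (degree p) (max (degree q) (degree r))) ` set xs))"
  have N: "degree p \<le> N" "degree q \<le> N" "degree r \<le> N" if "(p, q, r) \<in> set xs" for p q r
  proof -
    have "max (degree p) (max (degree q) (degree r)) \<le> N" unfolding N_def
      by (rule Max_ge) (use that in \<open>auto simp: rev_image_eqI\<close>)
    then show "degree p \<le> N" "degree q \<le> N" "degree r \<le> N" by auto
  qed
  have coeffs: "(\<Sum>(p, q, r)\<leftarrow>xs. \<beta> (coeff p i) (coeff q j) (coeff r k)) = 0"
    if \<beta>: "trilin_map s (*) \<beta>" and "i \<le> N" "j \<le> N" "k \<le> N" for \<beta> i j k
  proof -
    have "(\<Sum>i\<le>N. X ^ i * (\<Sum>j\<le>N. Y ^ j * (\<Sum>k\<le>N. Z ^ k *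
        (\<Sum>(p, q, r)\<leftarrow>xs. \<beta> (coeff p i) (coeff q j) (coeff r k))))) = 0" for X Y Z
    proof -
      have "\<beta> (veval s X p) (veval s Y q) (veval s Z r)
          = (\<Sum>i\<le>N. \<Sum>j\<le>N. \<Sum>k\<le>N. X ^ i * (Y ^ j * (Z ^ k * \<beta> (coeff p i) (coeff q j) (coeff r k))))"
        if "(p, q, r) \<in> set xs" for p q r
        unfolding veval_bound[OF s N(1)[OF that]] veval_bound[OF s N(2)[OF that]]
          veval_bound[OF s N(3)[OF that]]
        unfolding trilin_sum(1)[OF \<beta>] unfolding trilin_sum(2)[OF \<beta>] unfolding trilin_sum(3)[OF \<beta>]
        using \<beta> by (simp add: trilin_iff mult.left_commute)
      then have "(\<Sum>(p, q, r)\<leftarrow>xs. \<beta> (veval s X p) (veval s Y q) (veval s Z r))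
          = (\<Sum>(p, q, r)\<leftarrow>xs. \<Sum>i\<le>N. \<Sum>j\<le>N. \<Sum>k\<le>N.
              X ^ i * (Y ^ j * (Z ^ k * \<beta> (coeff p i) (coeff q j) (coeff r k))))"
        by (intro arg_cong[of _ _ sum_list] map_cong) auto
      moreover have "(\<Sum>(p, q, r)\<leftarrow>xs. \<beta> (veval s X p) (veval s Y q) (veval s Z r)) = teval3 s X Y Z t \<beta>"
        using \<beta> by (simp add: teval3_def t_eq trilin_veval)
      ultimately show ?thesis
        by (simp add: 0 case_prod_beta' sum_list_sum sum_list_const_mult sum_distrib_left)
    qed
    from power_sum_separates[OF power_sum_separates[OF power_sum_separates[OF this \<open>i \<le> N\<close>] \<open>j \<le> N\<close>] \<open>k \<le> N\<close>]
    show ?thesis .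
  qed
  have "t \<gamma> = 0" if \<gamma>: "trilin_map (poly_scale s) (*) \<gamma>" for \<gamma>
  proof -
    have "\<gamma> p q r = (\<Sum>i\<le>N. \<Sum>j\<le>N. \<Sum>k\<le>N. \<gamma> (monom (coeff p i) i) (monom (coeff q j) j) (monom (coeff r k) k))"
      if "(p, q, r) \<in> set xs" for p q r
      by (subst poly_as_monoms[OF N(1)[OF that]], subst poly_as_monoms[OF N(2)[OF that]],
          subst poly_as_monoms[OF N(3)[OF that]])
        (simp only: trilin_sum(1)[OF \<gamma>], simp only: trilin_sum(2)[OF \<gamma>], simp only: trilin_sum(3)[OF \<gamma>])
    then have "t \<gamma> = (\<Sum>(p, q, r)\<leftarrow>xs. \<Sum>i\<le>N. \<Sum>j\<le>N. \<Sum>k\<le>N.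
        \<gamma> (monom (coeff p i) i) (monom (coeff q j) j) (monom (coeff r k) k))"
      unfolding t_eq[OF \<gamma>] by (intro arg_cong[of _ _ sum_list] map_cong) auto
    also have "\<dots> = (\<Sum>i\<le>N. \<Sum>j\<le>N. \<Sum>k\<le>N. \<Sum>(p, q, r)\<leftarrow>xs.
        \<gamma> (monom (coeff p i) i) (monom (coeff q j) j) (monom (coeff r k) k))"
      by (simp add: case_prod_beta' sum_list_sum)
    also have "\<dots> = 0"
    proof (intro sum.neutral ballI)
      fix i j k assume "i \<in> {..N}" "j \<in> {..N}" "k \<in> {..N}"
      moreover have "trilin_map s (*) (\<lambda>a b c. \<gamma> (monom a i) (monom b j) (monom c k))"
        using \<gamma> by (simp add: trilin_iff s monom_add_scale[OF s])
      ultimately show "(\<Sum>(p, q, r)\<leftarrow>xs. \<gamma> (monom (coeff p i) i) (monom (coeff q j) j) (monom (coeff r k) k)) = 0"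
        using coeffs[of "\<lambda>a b c. \<gamma> (monom a i) (monom b j) (monom c k)" i j k] by simp
    qed
    finally show ?thesis .
  qed
  then show ?thesis by (subst tensor3_eq_iff[OF ps t]) auto
qed

lemma tensor2_eq_iff_teval:
  fixes s :: "'k::field_char_0 \<Rightarrow> 'a::ab_group_add \<Rightarrow> 'a"
  assumes "vector_space s" "t \<in> tensor2 (poly_scale s)" "t' \<in> tensor2 (poly_scale s)"
  shows "t = t' \<longleftrightarrow> (\<forall>X Y. teval s X Y t = teval s X Y t')"
  using teval_separates[OF assms(1), of "t - t'"] assms(2-)
  by (auto simp: teval_simps)

lemma tensor3_eq_iff_teval3:
  fixes s :: "'k::field_char_0 \<Rightarrow> 'a::ab_group_add \<Rightarrow> 'a"
  assumes "vector_space s" "t \<in> tensor3 (poly_scale s)" "t' \<in> tensor3 (poly_scale s)"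
  shows "t = t' \<longleftrightarrow> (\<forall>X Y Z. teval3 s X Y Z t = teval3 s X Y Z t')"
  using teval3_separates[OF assms(1), of "t - t'"] assms(2-)
  by (auto simp: lin_diff[OF teval3_linear])

lemma teval_map_left:
  assumes f: "Vector_Spaces.linear (poly_scale s) (poly_scale s) f" and g: "Vector_Spaces.linear s s g"
    and fg: "\<And>u. veval s X (f u) = g (veval s X' u)" and t: "t \<in> tensor2 (poly_scale s)"
  shows "teval s X Y (map_left (poly_scale s) f t) = map_left s g (teval s X' Y t)"
proof (subst tensor2_eq_iff)
  show "\<forall>\<beta>. bilin_map s (*) \<beta> \<longrightarrow> teval s X Y (map_left (poly_scale s) f t) \<beta> = map_left s g (teval s X' Y t) \<beta>"
  proof (intro allI impI)
    fix \<beta> assume \<beta>: "bilin_map s (*) \<beta>"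
    moreover from \<beta> g have "bilin_map s (*) (\<lambda>u v. \<beta> (g u) v)"
      by (simp add: bilin_iff lin_add lin_scale)
    ultimately show "teval s X Y (map_left (poly_scale s) f t) \<beta> = map_left s g (teval s X' Y t) \<beta>"
      by (simp add: map_left_apply[OF g teval_closed[OF lin_vs(1)[OF g] t]] teval_apply map_left_apply[OF f t] bilin_veval fg)
  qed
qed (use lin_vs(1)[OF g] f g t in \<open>auto intro: map_left_closed teval_closed\<close>)

lemma teval_map_right:
  assumes f: "Vector_Spaces.linear (poly_scale s) (poly_scale s) f" and g: "Vector_Spaces.linear s s g"
    and fg: "\<And>u. veval s Y (f u) = g (veval s Y' u)" and t: "t \<in> tensor2 (poly_scale s)"
  shows "teval s X Y (map_right (poly_scale s) f t) = map_right s g (teval s X Y' t)"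
proof (subst tensor2_eq_iff)
  show "\<forall>\<beta>. bilin_map s (*) \<beta> \<longrightarrow> teval s X Y (map_right (poly_scale s) f t) \<beta> = map_right s g (teval s X Y' t) \<beta>"
  proof (intro allI impI)
    fix \<beta> assume \<beta>: "bilin_map s (*) \<beta>"
    moreover from \<beta> g have "bilin_map s (*) (\<lambda>u v. \<beta> u (g v))"
      by (simp add: bilin_iff lin_add lin_scale)
    ultimately show "teval s X Y (map_right (poly_scale s) f t) \<beta> = map_right s g (teval s X Y' t) \<beta>"
      by (simp add: map_right_apply[OF g teval_closed[OF lin_vs(1)[OF g] t]] teval_apply map_right_apply[OF f t] bilin_veval fg)
  qed
qed (use lin_vs(1)[OF g] f g t in \<open>auto intro: map_right_closed teval_closed\<close>)

lemma teval_flip: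
  assumes s: "vector_space s" and t: "t \<in> tensor2 (poly_scale s)"
  shows "teval s X Y (flip (poly_scale s) t) = flip s (teval s Y X t)"
proof (subst tensor2_eq_iff)
  show "\<forall>\<beta>. bilin_map s (*) \<beta> \<longrightarrow> teval s X Y (flip (poly_scale s) t) \<beta> = flip s (teval s Y X t) \<beta>"
  proof (intro allI impI)
    fix \<beta> assume \<beta>: "bilin_map s (*) \<beta>"
    moreover from \<beta> have "bilin_map s (*) (\<lambda>u v. \<beta> v u)"
      by (simp add: bilin_iff)
    ultimately show "teval s X Y (flip (poly_scale s) t) \<beta> = flip s (teval s Y X t) \<beta>"
      by (simp add: flip_apply[OF teval_closed[OF s t]] teval_apply flip_apply[OF t] bilin_veval)
  qed
qed (use s t in \<open>auto intro: flip_closed teval_closed vector_space_poly_scale\<close>)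

lemma teval3_closed:
  assumes s: "vector_space s" and t: "t \<in> tensor3 (poly_scale s)"
  shows "teval3 s X Y Z t \<in> tensor3 s"
  by (rule tensor3_induct[OF vector_space_poly_scale[OF s] t])
    (simp_all only: lin_add[OF teval3_linear] lin_0[OF teval3_linear] teval3_pure tensor3_closed)

lemma teval3_flip12:
  assumes s: "vector_space s" and t: "t \<in> tensor3 (poly_scale s)"
  shows "teval3 s X Y Z (flip12 (poly_scale s) t) = flip12 s (teval3 s Y X Z t)"
proof (subst tensor3_eq_iff)
  show "\<forall>\<beta>. trilin_map s (*) \<beta> \<longrightarrow> teval3 s X Y Z (flip12 (poly_scale s) t) \<beta> = flip12 s (teval3 s Y X Z t) \<beta>"
  proof (intro allI impI)
    fix \<beta> assume \<beta>: "trilin_map s (*) \<beta>"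
    moreover from \<beta> have "trilin_map s (*) (\<lambda>u v w. \<beta> v u w)"
      by (simp add: trilin_iff)
    ultimately show "teval3 s X Y Z (flip12 (poly_scale s) t) \<beta> = flip12 s (teval3 s Y X Z t) \<beta>"
      by (simp add: flip12_apply[OF teval3_closed[OF s t]] teval3_apply flip12_apply[OF t] trilin_veval)
  qed
qed (use s t in \<open>auto intro: flip12_closed teval3_closed vector_space_poly_scale\<close>)

lemma teval3_comul_left:
  assumes D: "comul (poly_scale s) D" and c: "comul s c"
    and Dc: "\<And>p. teval s X Y (D p) = c (veval s (X + Y) p)" and t: "t \<in> tensor2 (poly_scale s)"
  shows "teval3 s X Y Z (comul_left (poly_scale s) D t) = comul_left s c (teval s (X + Y) Z t)"
proof (subst tensor3_eq_iff)
  show "\<forall>\<beta>. trilin_map s (*) \<beta> \<longrightarrow>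
      teval3 s X Y Z (comul_left (poly_scale s) D t) \<beta> = comul_left s c (teval s (X + Y) Z t) \<beta>"
  proof (intro allI impI)
    fix \<beta> assume \<beta>: "trilin_map s (*) \<beta>"
    have D': "D u (\<lambda>p q. \<beta> (veval s X p) (veval s Y q) w) = c (veval s (X + Y) u) (\<lambda>x y. \<beta> x y w)" for u w
      using Dc[of u] trilin_slices(1)[OF \<beta>, of w] by (auto simp: teval_def fun_eq_iff split: if_splits)
    show "teval3 s X Y Z (comul_left (poly_scale s) D t) \<beta> = comul_left s c (teval s (X + Y) Z t) \<beta>"
      using \<beta> comul_slice_bilin(1)[OF c \<beta>]
      by (simp add: comul_left_apply[OF c teval_closed[OF comulD(4)[OF c] t]] teval3_apply teval_apply
          comul_left_apply[OF D t] trilin_veval D')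
  qed
qed (use comulD(4)[OF c] D c t in \<open>auto intro: comul_left_closed teval3_closed teval_closed\<close>)

lemma teval3_comul_right:
  assumes D: "comul (poly_scale s) D" and c: "comul s c"
    and Dc: "\<And>p. teval s Y Z (D p) = c (veval s (Y + Z) p)" and t: "t \<in> tensor2 (poly_scale s)"
  shows "teval3 s X Y Z (comul_right (poly_scale s) D t) = comul_right s c (teval s X (Y + Z) t)"
proof (subst tensor3_eq_iff)
  show "\<forall>\<beta>. trilin_map s (*) \<beta> \<longrightarrow>
      teval3 s X Y Z (comul_right (poly_scale s) D t) \<beta> = comul_right s c (teval s X (Y + Z) t) \<beta>"
  proof (intro allI impI)
    fix \<beta> assume \<beta>: "trilin_map s (*) \<beta>"
    have D': "D u (\<lambda>p q. \<beta> w (veval s Y p) (veval s Z q)) = c (veval s (Y + Z) u) (\<beta> w)" for u w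
      using Dc[of u] trilin_slices(2)[OF \<beta>, of w] by (auto simp: teval_def fun_eq_iff split: if_splits)
    show "teval3 s X Y Z (comul_right (poly_scale s) D t) \<beta> = comul_right s c (teval s X (Y + Z) t) \<beta>"
      using \<beta> comul_slice_bilin(2)[OF c \<beta>]
      by (simp add: comul_right_apply[OF c teval_closed[OF comulD(4)[OF c] t]] teval3_apply teval_apply
          comul_right_apply[OF D t] trilin_veval D')
  qed
qed (use comulD(4)[OF c] D c t in \<open>auto intro: comul_right_closed teval3_closed teval_closed\<close>)

section \<open>Operators substituted into polynomials of tensors\<close>

text \<open>
  Multiplication by \<open>\<lambda>\<close> is linear everywhere, but \<open>-\<lambda> - \<partial> \<otimes> I - I \<otimes> \<partial>\<close> only on polynomials whose coefficients are tensors.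
\<close>

definition lin_on :: "'w set \<Rightarrow> ('k \<Rightarrow> 'w::ab_group_add \<Rightarrow> 'w) \<Rightarrow> ('w \<Rightarrow> 'w) \<Rightarrow> bool" where
  "lin_on S t T \<longleftrightarrow> (\<forall>x\<in>S. T x \<in> S) \<and> (\<forall>x\<in>S. \<forall>y\<in>S. T (x + y) = T x + T y) \<and>
     (\<forall>c. \<forall>x\<in>S. T (t c x) = t c (T x))"

lemma lin_on_funpow:
  assumes "lin_on S t T" and "\<And>x y. x \<in> S \<Longrightarrow> y \<in> S \<Longrightarrow> x + y \<in> S" and "\<And>c x. x \<in> S \<Longrightarrow> t c x \<in> S"
  shows "lin_on S t (T ^^ k)"
  by (induction k) (use assms in \<open>auto simp: lin_on_def\<close>)

lemma lin_on_0:
  assumes "vector_space t" "lin_on S t T" "0 \<in> S" shows "T 0 = 0"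
proof -
  interpret vector_space t by fact
  have "T (t 0 0) = t 0 (T 0)" using assms unfolding lin_on_def by blast
  then show ?thesis by simp
qed

context
  fixes S :: "'w::ab_group_add set" and t :: "'k::field \<Rightarrow> 'w \<Rightarrow> 'w" and T
  assumes t: "vector_space t" and S: "module.subspace t S" and T: "lin_on S t T"
begin

interpretation vector_space t by (rule t)

lemma lin_on_power: "lin_on S t (T ^^ k)"
  by (rule lin_on_funpow[OF T]) (auto intro: subspace_add[OF S] subspace_scale[OF S])

lemma subst_poly_bound:
  assumes "f 0 = 0" "degree p \<le> n"
  shows "subst_poly T f p = (\<Sum>k\<le>n. (T ^^ k) (f (coeff p k)))"
  unfolding subst_poly_def using assms lin_on_0[OF t lin_on_power subspace_0[OF S]]
  by (intro sum.mono_neutral_left) (auto simp: coeff_eq_0)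

lemma subst_poly_linear:
  fixes s :: "'k \<Rightarrow> 'v::ab_group_add \<Rightarrow> 'v"
  assumes f: "Vector_Spaces.linear s t f" and fS: "\<And>a. f a \<in> S"
  shows "Vector_Spaces.linear (poly_scale s) t (subst_poly T f)"
proof (rule linI)
  note f0 = lin_0[OF f] and s = lin_vs(1)[OF f]
  show "vector_space (poly_scale s)" by (rule vector_space_poly_scale[OF s])
  show "vector_space t" by (rule t)
  fix p q :: "'v poly"
  let ?n = "max (degree p) (degree q)"
  show "subst_poly T f (p + q) = subst_poly T f p + subst_poly T f q"
    using lin_on_power fS
    by (simp add: subst_poly_bound[of f _ ?n] degree_add_le f0 lin_add[OF f] sum.distrib lin_on_def)
next
  note f0 = lin_0[OF f] and s = lin_vs(1)[OF f]
  fix c and p :: "'v poly"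
  have "degree (poly_scale s c p) \<le> degree p"
    by (rule degree_le) (auto simp: coeff_poly_scale[OF s] coeff_eq_0 module.scale_zero_right[OF vector_space_module[OF s]])
  then show "subst_poly T f (poly_scale s c p) = t c (subst_poly T f p)"
    using lin_on_power fS
    by (simp add: subst_poly_bound[of f _ "degree p"] f0 lin_scale[OF f] coeff_poly_scale[OF s] lin_on_def scale_sum_right)
qed

lemma subst_poly_fun_add:
  "(\<And>a. f a \<in> S) \<Longrightarrow> (\<And>a. g a \<in> S) \<Longrightarrow>
     subst_poly T (\<lambda>a. f a + g a) p = subst_poly T f p + subst_poly T g p"
  using lin_on_power by (simp add: subst_poly_def lin_on_def sum.distrib)

lemma subst_poly_fun_scale:
  "(\<And>a. f a \<in> S) \<Longrightarrow> subst_poly T (\<lambda>a. t c (f a)) p = t c (subst_poly T f p)"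
  using lin_on_power by (simp add: subst_poly_def lin_on_def scale_sum_right)

end

lemma pCons_0_linear: "vector_space s \<Longrightarrow> Vector_Spaces.linear (poly_scale s) (poly_scale s) (pCons 0)"
  by (intro linI vector_space_poly_scale)
    (auto simp: poly_eq_iff coeff_poly_scale coeff_pCons module.scale_zero_right[OF vector_space_module] split: nat.splits)

lemma const_poly_linear: "vector_space s \<Longrightarrow> Vector_Spaces.linear s (poly_scale s) (\<lambda>a. [:a:])"
  by (intro linI vector_space_poly_scale)
    (auto simp: poly_eq_iff coeff_poly_scale coeff_pCons module.scale_zero_right[OF vector_space_module] split: nat.splits)

lemma veval_const: "vector_space s \<Longrightarrow> veval s X [:a:] = a"
  by (simp add: veval_pCons veval_0 module.scale_zero_right[OF vector_space_module])

lemma veval_del: "vector_space s \<Longrightarrow> veval s X (pCons 0 p) = s X (veval s X p)"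
  by (simp add: veval_pCons)

lemma scale_linear:
  assumes "vector_space s" shows "Vector_Spaces.linear s s (s c)"
proof -
  interpret vector_space s by fact
  show ?thesis by (rule linI) (auto simp: scale_right_distrib mult.commute assms)
qed

lemma pure2_linear:
  assumes "vector_space s"
  shows "Vector_Spaces.linear s fun_scale (pure2 s u)" "Vector_Spaces.linear s fun_scale (\<lambda>u. pure2 s u v)"
  using pure2_bilin[OF assms] by (auto simp: bilin_map_def)

lemma map_left_lin:
  assumes "Vector_Spaces.linear s s f"
  shows "x \<in> tensor2 s \<Longrightarrow> y \<in> tensor2 s \<Longrightarrow> map_left s f (x + y) = map_left s f x + map_left s f y"
    and "x \<in> tensor2 s \<Longrightarrow> map_left s f (fun_scale c x) = fun_scale c (map_left s f x)"
    and "map_left s f (pure2 s u v) = pure2 s (f u) v"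
  using bilin_pure(1)[OF assms lin_id[OF lin_vs(1)[OF assms]]]
  by (auto simp: map_left_def lift2_linear lift2_pure2)

lemma map_right_lin:
  assumes "Vector_Spaces.linear s s f"
  shows "x \<in> tensor2 s \<Longrightarrow> y \<in> tensor2 s \<Longrightarrow> map_right s f (x + y) = map_right s f x + map_right s f y"
    and "x \<in> tensor2 s \<Longrightarrow> map_right s f (fun_scale c x) = fun_scale c (map_right s f x)"
    and "map_right s f (pure2 s u v) = pure2 s u (f v)"
  using bilin_pure(1)[OF lin_id[OF lin_vs(1)[OF assms]] assms]
  by (auto simp: map_right_def lift2_linear lift2_pure2)

lemma flip_lin:
  assumes "vector_space s"
  shows "x \<in> tensor2 s \<Longrightarrow> y \<in> tensor2 s \<Longrightarrow> flip s (x + y) = flip s x + flip s y"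
    and "x \<in> tensor2 s \<Longrightarrow> flip s (fun_scale c x) = fun_scale c (flip s x)"
    and "flip s (pure2 s u v) = pure2 s v u"
  using bilin_pure(2)[OF lin_id[OF assms] lin_id[OF assms]]
  by (auto simp: flip_def lift2_linear lift2_pure2)

lemma fun_scale_right:
  "fun_scale c 0 = 0" "fun_scale c (x + y) = fun_scale c x + fun_scale c y"
  "fun_scale c (x - y) = fun_scale c x - fun_scale c y" "fun_scale c (- x) = - fun_scale c x"
  by (auto simp: fun_scale_def fun_eq_iff algebra_simps)

lemma tensor2_lin_0:
  assumes "\<And>c x. x \<in> tensor2 s \<Longrightarrow> h (fun_scale c x) = fun_scale c (h x)"
  shows "h 0 = 0"
proof -
  have "h (fun_scale 0 0) = fun_scale 0 (h 0)" by (rule assms) simp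
  then show ?thesis by (simp add: fun_scale_def fun_eq_iff zero_fun_def)
qed

lemma map_left_0: "Vector_Spaces.linear s s f \<Longrightarrow> map_left s f 0 = 0"
  by (rule tensor2_lin_0) (rule map_left_lin)

lemma map_right_0: "Vector_Spaces.linear s s f \<Longrightarrow> map_right s f 0 = 0"
  by (rule tensor2_lin_0) (rule map_right_lin)

lemma map_left_scale:
  assumes s: "vector_space s" and t: "t \<in> tensor2 s"
  shows "map_left s (s c) t = fun_scale c t"
proof (rule tensor2_induct[OF s t])
  show "map_left s (s c) 0 = fun_scale c 0"
    by (simp only: map_left_0[OF scale_linear[OF s]] fun_scale_right(1))
  fix u v t assume "t \<in> tensor2 s" and IH: "map_left s (s c) t = fun_scale c t"
  moreover have "map_left s (s c) (pure2 s u v) = fun_scale c (pure2 s u v)"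
    unfolding map_left_lin(3)[OF scale_linear[OF s]] using pure2_bilin[OF s] by (simp only: bilin_iff)
  ultimately show "map_left s (s c) (pure2 s u v + t) = fun_scale c (pure2 s u v + t)"
    by (simp only: map_left_lin(1)[OF scale_linear[OF s]] tensor2_closed
        fun_scale_right)
qed

lemma map_right_scale:
  assumes s: "vector_space s" and t: "t \<in> tensor2 s"
  shows "map_right s (s c) t = fun_scale c t"
proof (rule tensor2_induct[OF s t])
  show "map_right s (s c) 0 = fun_scale c 0"
    by (simp only: map_right_0[OF scale_linear[OF s]] fun_scale_right(1))
  fix u v t assume "t \<in> tensor2 s" and IH: "map_right s (s c) t = fun_scale c t"
  moreover have "map_right s (s c) (pure2 s u v) = fun_scale c (pure2 s u v)"
    unfolding map_right_lin(3)[OF scale_linear[OF s]] using pure2_bilin[OF s] by (simp only: bilin_iff)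
  ultimately show "map_right s (s c) (pure2 s u v + t) = fun_scale c (pure2 s u v + t)"
    by (simp only: map_right_lin(1)[OF scale_linear[OF s]] tensor2_closed
        fun_scale_right)
qed

text \<open>
  This is why a \<open>k[\<partial>]\<close>-linear coproduct reads its argument at \<open>X + Y\<close>.
\<close>

lemma teval_del2:
  assumes s: "vector_space s" and t: "t \<in> tensor2 (poly_scale s)"
  shows "teval s X Y (del2 (poly_scale s) (pCons 0) t) = fun_scale (X + Y) (teval s X Y t)"
proof -
  have "teval s X Y (map_left (poly_scale s) (pCons 0) t) = fun_scale X (teval s X Y t)"
    by (subst teval_map_left[OF pCons_0_linear[OF s] scale_linear[OF s] veval_del[OF s] t])
      (rule map_left_scale[OF s teval_closed[OF s t]])
  moreover have "teval s X Y (map_right (poly_scale s) (pCons 0) t) = fun_scale Y (teval s X Y t)"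
    by (subst teval_map_right[OF pCons_0_linear[OF s] scale_linear[OF s] veval_del[OF s] t])
      (rule map_right_scale[OF s teval_closed[OF s t]])
  ultimately show ?thesis
    by (simp add: del2_def teval_simps module.scale_left_distrib[OF vector_space_module[OF vector_space_fun_scale]])
qed

lemma del2_lin_on:
  assumes "Vector_Spaces.linear s s del"
  shows "lin_on (tensor2 s) fun_scale (del2 s del)"
  using assms
  by (simp add: lin_on_def del2_def map_left_closed map_right_closed map_left_lin map_right_lin
      fun_scale_right)

definition tensor_polys :: "('k::field \<Rightarrow> 'v::ab_group_add \<Rightarrow> 'v) \<Rightarrow> ('k, 'v) tens2 poly set" where
  "tensor_polys s = {F. \<forall>i. coeff F i \<in> tensor2 s}"

lemma subspace_tensor_polys: "module.subspace (poly_scale fun_scale) (tensor_polys s)"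
proof -
  interpret V: vector_space "poly_scale fun_scale :: 'a \<Rightarrow> ('a, 'b) tens2 poly \<Rightarrow> _"
    by (rule vector_space_poly_scale[OF vector_space_fun_scale])
  show ?thesis
    by (rule V.subspaceI) (auto simp: tensor_polys_def coeff_poly_scale[OF vector_space_fun_scale])
qed

lemma pure_const_in: "[:pure2 s u v:] \<in> tensor_polys s"
  by (auto simp: tensor_polys_def coeff_pCons split: nat.splits)

lemma veval_tensor_polys: "F \<in> tensor_polys s \<Longrightarrow> veval fun_scale L F \<in> tensor2 s"
proof -
  assume F: "F \<in> tensor_polys s"
  have "(\<Sum>k\<in>I. fun_scale (L ^ k) (coeff F k)) \<in> tensor2 s" for I :: "nat set"
    using F by (induction I rule: infinite_finite_induct) (auto simp: tensor_polys_def)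
  then show ?thesis by (simp add: veval_def)
qed

lemma tensor_polys_eq_iff:
  fixes s :: "'k::field_char_0 \<Rightarrow> 'a::ab_group_add \<Rightarrow> 'a"
  assumes s: "vector_space s" and "F \<in> tensor_polys (poly_scale s)" "G \<in> tensor_polys (poly_scale s)"
  shows "F = G \<longleftrightarrow> (\<forall>L X Y. teval s X Y (veval fun_scale L F) = teval s X Y (veval fun_scale L G))"
  unfolding poly_eq_iff_veval[OF vector_space_fun_scale]
  using assms(2-) by (simp add: tensor2_eq_iff_teval[OF s] veval_tensor_polys)

lemma cmap_left_bilin:
  assumes \<Theta>: "lin_on (tensor_polys s) (poly_scale fun_scale) \<Theta>" and T: "Vector_Spaces.linear s (poly_scale s) T"
  shows "bilin_map s (poly_scale fun_scale) (\<lambda>u v. subst_poly \<Theta> (\<lambda>w. [:pure2 s w v:]) (T u))"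
proof -
  note s = lin_vs(1)[OF T] and V = vector_space_poly_scale[OF vector_space_fun_scale]
  note S = V subspace_tensor_polys \<Theta>
  have lin: "Vector_Spaces.linear s (poly_scale fun_scale) (\<lambda>w. [:pure2 s w v:])" for v
    using pure2_bilin[OF s] lin_compose[OF _ const_poly_linear[OF vector_space_fun_scale]]
    by (auto simp: bilin_map_def)
  have lin': "Vector_Spaces.linear s (poly_scale fun_scale) (\<lambda>v. [:pure2 s w v:])" for w
    using pure2_bilin[OF s] lin_compose[OF _ const_poly_linear[OF vector_space_fun_scale]]
    by (auto simp: bilin_map_def)
  show ?thesis
    unfolding bilin_map_def
  proof (intro conjI allI)
    show "Vector_Spaces.linear s (poly_scale fun_scale) (\<lambda>u. subst_poly \<Theta> (\<lambda>w. [:pure2 s w v:]) (T u))" for v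
      by (rule lin_compose[OF T subst_poly_linear[OF S lin pure_const_in]])
    show "Vector_Spaces.linear s (poly_scale fun_scale) (\<lambda>v. subst_poly \<Theta> (\<lambda>w. [:pure2 s w v:]) (T u))" for u
      by (rule linI[OF s V])
        (simp_all only: lin_add[OF lin'] lin_scale[OF lin'] subst_poly_fun_add[OF S pure_const_in pure_const_in]
          subst_poly_fun_scale[OF S pure_const_in])
  qed
qed

lemma cmap_right_bilin:
  assumes \<Theta>: "lin_on (tensor_polys s) (poly_scale fun_scale) \<Theta>" and T: "Vector_Spaces.linear s (poly_scale s) T"
  shows "bilin_map s (poly_scale fun_scale) (\<lambda>u v. subst_poly \<Theta> (\<lambda>w. [:pure2 s u w:]) (T v))"
proof -
  note s = lin_vs(1)[OF T] and V = vector_space_poly_scale[OF vector_space_fun_scale]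
  note S = V subspace_tensor_polys \<Theta>
  have lin: "Vector_Spaces.linear s (poly_scale fun_scale) (\<lambda>w. [:pure2 s w v:])" for v
    using pure2_bilin[OF s] lin_compose[OF _ const_poly_linear[OF vector_space_fun_scale]]
    by (auto simp: bilin_map_def)
  have lin': "Vector_Spaces.linear s (poly_scale fun_scale) (\<lambda>v. [:pure2 s w v:])" for w
    using pure2_bilin[OF s] lin_compose[OF _ const_poly_linear[OF vector_space_fun_scale]]
    by (auto simp: bilin_map_def)
  show ?thesis
    unfolding bilin_map_def
  proof (intro conjI allI)
    show "Vector_Spaces.linear s (poly_scale fun_scale) (\<lambda>v. subst_poly \<Theta> (\<lambda>w. [:pure2 s u w:]) (T v))" for u
      by (rule lin_compose[OF T subst_poly_linear[OF S lin' pure_const_in]])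
    show "Vector_Spaces.linear s (poly_scale fun_scale) (\<lambda>u. subst_poly \<Theta> (\<lambda>w. [:pure2 s u w:]) (T v))" for v
      by (rule linI[OF s V])
        (simp_all only: lin_add[OF lin] lin_scale[OF lin] subst_poly_fun_add[OF S pure_const_in pure_const_in]
          subst_poly_fun_scale[OF S pure_const_in])
  qed
qed

lemma tensor_polys_closed:
  "0 \<in> tensor_polys s" "F \<in> tensor_polys s \<Longrightarrow> G \<in> tensor_polys s \<Longrightarrow> F + G \<in> tensor_polys s"
  "F \<in> tensor_polys s \<Longrightarrow> G \<in> tensor_polys s \<Longrightarrow> F - G \<in> tensor_polys s"
  by (auto simp: tensor_polys_def)

lemma cmap_closed:
  assumes \<Theta>: "lin_on (tensor_polys s) (poly_scale fun_scale) \<Theta>" and T: "Vector_Spaces.linear s (poly_scale s) T"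
    and t: "t \<in> tensor2 s"
  shows "cmap_left s \<Theta> T t \<in> tensor_polys s" and "cmap_right s \<Theta> T t \<in> tensor_polys s"
  unfolding cmap_left_def cmap_right_def
  using \<Theta>
  by (auto intro!: lift2_closed[OF cmap_left_bilin[OF \<Theta> T] t] lift2_closed[OF cmap_right_bilin[OF \<Theta> T] t]
      subst_poly_closed pure_const_in tensor_polys_closed simp: lin_on_def)

text \<open>
  After evaluation, the conformal operator \<open>T\<^sub>\<Theta> \<otimes> I\<close> is an ordinary \<open>g \<otimes> I\<close> on \<open>A \<otimes> A\<close>. Here \<open>N\<close> is the scalar by which \<open>\<Theta>\<close> acts, and
  the point \<open>X'\<close>, at which the first factor is evaluated on the right, is shifted against \<open>X\<close> by sesquilinearity.
\<close>

lemma teval_cmap_left: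
  assumes \<Theta>: "lin_on (tensor_polys (poly_scale s)) (poly_scale fun_scale) \<Theta>"
    and ev: "\<And>w. w \<in> tensor_polys (poly_scale s) \<Longrightarrow>
      teval s X Y (veval fun_scale L (\<Theta> w)) = fun_scale N (teval s X Y (veval fun_scale L w))"
    and T: "Vector_Spaces.linear (poly_scale s) (poly_scale (poly_scale s)) T"
    and g: "Vector_Spaces.linear s s g"
    and Tg: "\<And>u. veval s X (veval (poly_scale s) N (T u)) = g (veval s X' u)"
    and t: "t \<in> tensor2 (poly_scale s)"
  shows "teval s X Y (veval fun_scale L (cmap_left (poly_scale s) \<Theta> T t)) = map_left s g (teval s X' Y t)"
proof -
  note s = lin_vs(1)[OF g] and b = cmap_left_bilin[OF \<Theta> T]
  note ps = vector_space_poly_scale[OF s] and F = vector_space_fun_scale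
  note h = lin_compose[OF veval_linear[OF F] teval_linear]
  have "teval s X Y (veval fun_scale L (subst_poly \<Theta> (\<lambda>w. [:pure2 (poly_scale s) w v:]) (T u)))
      = pure2 s (veval s X (veval (poly_scale s) N (T u))) (veval s Y v)" for u v
  proof (rule subst_poly_eval[where S = "tensor_polys (poly_scale s)" and t = fun_scale and h = "\<lambda>w. teval s X Y (veval fun_scale L w)"])
    show "Vector_Spaces.linear (poly_scale s) fun_scale (\<lambda>w. pure2 s (veval s X w) (veval s Y v))"
      by (rule lin_compose[OF veval_linear[OF s] pure2_linear(2)[OF s]])
  qed (use \<Theta> ev lin_add[OF h] in \<open>auto simp: lin_on_def pure_const_in veval_const[OF F] teval_pure\<close>)
  then have pure: "teval s X Y (veval fun_scale L (cmap_left (poly_scale s) \<Theta> T (pure2 (poly_scale s) u v)))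
      = map_left s g (teval s X' Y (pure2 (poly_scale s) u v))" for u v
    by (simp add: cmap_left_def lift2_pure2[OF b] teval_pure map_left_lin(3)[OF g] Tg)
  have 0: "cmap_left (poly_scale s) \<Theta> T 0 = 0"
    using lift2_sums[OF b, of "[]"] by (simp add: cmap_left_def)
  show ?thesis
  proof (rule tensor2_induct[OF ps t])
    show "teval s X Y (veval fun_scale L (cmap_left (poly_scale s) \<Theta> T 0)) = map_left s g (teval s X' Y 0)"
      unfolding 0 lin_0[OF h] lin_0[OF teval_linear] map_left_0[OF g] ..
    fix u v t assume t: "t \<in> tensor2 (poly_scale s)"
      and IH: "teval s X Y (veval fun_scale L (cmap_left (poly_scale s) \<Theta> T t)) = map_left s g (teval s X' Y t)"
    have "cmap_left (poly_scale s) \<Theta> T (pure2 (poly_scale s) u v + t)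
        = cmap_left (poly_scale s) \<Theta> T (pure2 (poly_scale s) u v) + cmap_left (poly_scale s) \<Theta> T t"
      unfolding cmap_left_def by (rule lift2_linear(1)[OF b tensor2_closed(6) t])
    then show "teval s X Y (veval fun_scale L (cmap_left (poly_scale s) \<Theta> T (pure2 (poly_scale s) u v + t)))
        = map_left s g (teval s X' Y (pure2 (poly_scale s) u v + t))"
      by (simp only: lin_add[OF h] pure IH teval_simps map_left_lin(1)[OF g] teval_closed[OF s] t tensor2_closed)
  qed
qed

lemma teval_cmap_right:
  assumes \<Theta>: "lin_on (tensor_polys (poly_scale s)) (poly_scale fun_scale) \<Theta>"
    and ev: "\<And>w. w \<in> tensor_polys (poly_scale s) \<Longrightarrow>
      teval s X Y (veval fun_scale L (\<Theta> w)) = fun_scale N (teval s X Y (veval fun_scale L w))"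
    and T: "Vector_Spaces.linear (poly_scale s) (poly_scale (poly_scale s)) T"
    and g: "Vector_Spaces.linear s s g"
    and Tg: "\<And>u. veval s Y (veval (poly_scale s) N (T u)) = g (veval s Y' u)"
    and t: "t \<in> tensor2 (poly_scale s)"
  shows "teval s X Y (veval fun_scale L (cmap_right (poly_scale s) \<Theta> T t)) = map_right s g (teval s X Y' t)"
proof -
  note s = lin_vs(1)[OF g] and b = cmap_right_bilin[OF \<Theta> T]
  note ps = vector_space_poly_scale[OF s] and F = vector_space_fun_scale
  note h = lin_compose[OF veval_linear[OF F] teval_linear]
  have "teval s X Y (veval fun_scale L (subst_poly \<Theta> (\<lambda>w. [:pure2 (poly_scale s) u w:]) (T v)))
      = pure2 s (veval s X u) (veval s Y (veval (poly_scale s) N (T v)))" for u v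
  proof (rule subst_poly_eval[where S = "tensor_polys (poly_scale s)" and t = fun_scale and h = "\<lambda>w. teval s X Y (veval fun_scale L w)"])
    show "Vector_Spaces.linear (poly_scale s) fun_scale (\<lambda>w. pure2 s (veval s X u) (veval s Y w))"
      by (rule lin_compose[OF veval_linear[OF s] pure2_linear(1)[OF s]])
  qed (use \<Theta> ev lin_add[OF h] in \<open>auto simp: lin_on_def pure_const_in veval_const[OF F] teval_pure\<close>)
  then have pure: "teval s X Y (veval fun_scale L (cmap_right (poly_scale s) \<Theta> T (pure2 (poly_scale s) u v)))
      = map_right s g (teval s X Y' (pure2 (poly_scale s) u v))" for u v
    by (simp add: cmap_right_def lift2_pure2[OF b] teval_pure map_right_lin(3)[OF g] Tg)
  have 0: "cmap_right (poly_scale s) \<Theta> T 0 = 0"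
    using lift2_sums[OF b, of "[]"] by (simp add: cmap_right_def)
  show ?thesis
  proof (rule tensor2_induct[OF ps t])
    show "teval s X Y (veval fun_scale L (cmap_right (poly_scale s) \<Theta> T 0)) = map_right s g (teval s X Y' 0)"
      unfolding 0 lin_0[OF h] lin_0[OF teval_linear] map_right_0[OF g] ..
    fix u v t assume t: "t \<in> tensor2 (poly_scale s)"
      and IH: "teval s X Y (veval fun_scale L (cmap_right (poly_scale s) \<Theta> T t)) = map_right s g (teval s X Y' t)"
    have "cmap_right (poly_scale s) \<Theta> T (pure2 (poly_scale s) u v + t)
        = cmap_right (poly_scale s) \<Theta> T (pure2 (poly_scale s) u v) + cmap_right (poly_scale s) \<Theta> T t"
      unfolding cmap_right_def by (rule lift2_linear(1)[OF b tensor2_closed(6) t])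
    then show "teval s X Y (veval fun_scale L (cmap_right (poly_scale s) \<Theta> T (pure2 (poly_scale s) u v + t)))
        = map_right s g (teval s X Y' (pure2 (poly_scale s) u v + t))"
      by (simp only: lin_add[OF h] pure IH teval_simps map_right_lin(1)[OF g] teval_closed[OF s] t tensor2_closed)
  qed
qed

lemma lam_lin_on: "lin_on (tensor_polys s) (poly_scale fun_scale) (pCons 0)"
  using lin_add[OF pCons_0_linear[OF vector_space_fun_scale]] lin_scale[OF pCons_0_linear[OF vector_space_fun_scale]]
  by (auto simp: lin_on_def tensor_polys_def coeff_pCons split: nat.splits)

lemma teval_lam:
  "teval s X Y (veval fun_scale L (pCons 0 w)) = fun_scale L (teval s X Y (veval fun_scale L w))"
  by (simp only: veval_del[OF vector_space_fun_scale] teval_simps)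

lemma mld_lin_on:
  assumes "Vector_Spaces.linear s s del"
  shows "lin_on (tensor_polys s) (poly_scale fun_scale) (minus_lam_del (del2 s del))"
proof -
  note F = vector_space_fun_scale
  note D = del2_lin_on[OF assms]
  have D0: "del2 s del 0 = 0" by (rule lin_on_0[OF F D]) simp
  show ?thesis
    using D
    by (auto simp: lin_on_def tensor_polys_def minus_lam_del_def coeff_map_poly[of "del2 s del", OF D0] coeff_pCons
        poly_eq_iff coeff_poly_scale[OF F] fun_scale_right split: nat.splits)
qed

text \<open>
  So \<open>b\<^bsub>-\<lambda>-\<partial>\<^esub>\<close> with \<open>\<partial>\<close> acting on the tensor square is evaluated at \<open>-L - X - Y\<close>, not at \<open>-L - X\<close>.
\<close>

lemma teval_mld:
  assumes s: "vector_space s" and w: "w \<in> tensor_polys (poly_scale s)"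
  shows "teval s X Y (veval fun_scale L (minus_lam_del (del2 (poly_scale s) (pCons 0)) w))
    = fun_scale (- L - X - Y) (teval s X Y (veval fun_scale L w))"
proof -
  note F = vector_space_fun_scale
  note D = del2_lin_on[OF pCons_0_linear[OF s]]
  let ?D = "del2 (poly_scale s) (pCons 0)"
  have D0: "?D 0 = 0" by (rule lin_on_0[OF F D]) simp
  have deg: "degree (map_poly ?D w) \<le> degree w"
    by (rule degree_le) (auto simp: coeff_map_poly[of ?D, OF D0] D0 coeff_eq_0)
  have Dsum: "?D (\<Sum>k\<in>I. fun_scale (L ^ k) (coeff w k)) = (\<Sum>k\<in>I. fun_scale (L ^ k) (?D (coeff w k)))
      \<and> (\<Sum>k\<in>I. fun_scale (L ^ k) (coeff w k)) \<in> tensor2 (poly_scale s)" for I :: "nat set"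
    using D w by (induction I rule: infinite_finite_induct) (auto simp: D0 lin_on_def tensor_polys_def)
  have "veval fun_scale L (map_poly ?D w) = ?D (veval fun_scale L w)"
    unfolding veval_bound[OF F deg] unfolding veval_def using Dsum
    by (simp add: coeff_map_poly[of ?D, OF D0])
  then have "teval s X Y (veval fun_scale L (map_poly ?D w)) = fun_scale (X + Y) (teval s X Y (veval fun_scale L w))"
    by (simp only: teval_del2[OF s veval_tensor_polys[OF w]])
  then show ?thesis
    unfolding minus_lam_del_def lin_diff[OF veval_linear[OF F]] lin_neg[OF veval_linear[OF F]] teval_simps teval_lam
    by (auto simp: fun_scale_def fun_eq_iff algebra_simps)
qed

section \<open>Symbols of conformal products and coproducts\<close>

text \<open>
  By sesquilinearity, \<open>\<partial>\<close> in the left argument acts as \<open>-\<lambda>\<close> and in the right argument as \<open>\<partial> + \<lambda>\<close>. A sesquilinear product is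
  therefore determined by a family of bilinear products on \<open>A\<close>, one for each pair of values \<open>X\<close> of \<open>\<partial>\<close> and \<open>L\<close> of \<open>\<lambda>\<close>.
\<close>

definition product_symbol ::
  "('k::field \<Rightarrow> 'a::ab_group_add \<Rightarrow> 'a) \<Rightarrow> ('a poly \<Rightarrow> 'a poly \<Rightarrow> 'a poly poly) \<Rightarrow> ('k \<Rightarrow> 'k \<Rightarrow> 'a \<Rightarrow> 'a \<Rightarrow> 'a) \<Rightarrow> bool" where
  "product_symbol s f F \<longleftrightarrow> (\<forall>X L. bilin_map s s (F X L)) \<and>
     (\<forall>X L p q. veval s X (veval (poly_scale s) L (f p q)) = F X L (veval s (- L) p) (veval s (X + L) q))"

text \<open>
  Likewise, \<open>\<partial>\<close> in the argument of a \<open>k[\<partial>]\<close>-linear coproduct acts as \<open>\<partial> \<otimes> I + I \<otimes> \<partial>\<close>, which evaluates to \<open>X + Y\<close>.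
\<close>

definition coproduct_symbol ::
  "('k::field \<Rightarrow> 'a::ab_group_add \<Rightarrow> 'a) \<Rightarrow> ('a poly \<Rightarrow> ('k, 'a poly) tens2) \<Rightarrow> ('k \<Rightarrow> 'k \<Rightarrow> 'a \<Rightarrow> ('k, 'a) tens2) \<Rightarrow> bool" where
  "coproduct_symbol s D c \<longleftrightarrow> comul (poly_scale s) D \<and> (\<forall>X Y. comul s (c X Y)) \<and>
     (\<forall>X Y p. teval s X Y (D p) = c X Y (veval s (X + Y) p))"

lemma veval2_linear:
  "vector_space s \<Longrightarrow>
     Vector_Spaces.linear (poly_scale (poly_scale s)) s (\<lambda>w. veval s X (veval (poly_scale s) L w))"
  by (rule lin_compose[OF veval_linear[OF vector_space_poly_scale] veval_linear])

lemma poly2_eq_iff: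
  fixes s :: "'k::field_char_0 \<Rightarrow> 'a::ab_group_add \<Rightarrow> 'a"
  assumes s: "vector_space s"
  shows "F = G \<longleftrightarrow> (\<forall>X L. veval s X (veval (poly_scale s) L F) = veval s X (veval (poly_scale s) L G))"
  unfolding poly_eq_iff_veval[OF vector_space_poly_scale[OF s], of F] poly_eq_iff_veval[OF s] by blast

lemma poly3_eq_iff:
  fixes s :: "'k::field_char_0 \<Rightarrow> 'a::ab_group_add \<Rightarrow> 'a"
  assumes s: "vector_space s"
  shows "F = G \<longleftrightarrow> (\<forall>X L M. veval s X (veval (poly_scale s) L (veval (poly_scale (poly_scale s)) M F))
     = veval s X (veval (poly_scale s) L (veval (poly_scale (poly_scale s)) M G)))"
  unfolding poly_eq_iff_veval[OF vector_space_poly_scale[OF vector_space_poly_scale[OF s]], of F]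
    poly2_eq_iff[OF s] by blast

lemma veval2_simps:
  assumes s: "vector_space s"
  shows "veval s X (veval (poly_scale s) L (pCons 0 w)) = s L (veval s X (veval (poly_scale s) L w))"
    and "veval s X (veval (poly_scale s) L (map_poly (pCons 0) w)) = s X (veval s X (veval (poly_scale s) L w))"
    and "veval s X (veval (poly_scale s) L [:p:]) = veval s X p"
    and "veval s X (veval (poly_scale s) L (v + w)) =
       veval s X (veval (poly_scale s) L v) + veval s X (veval (poly_scale s) L w)"
    and "veval s X (veval (poly_scale s) L (v - w)) =
       veval s X (veval (poly_scale s) L v) - veval s X (veval (poly_scale s) L w)"
    and "veval s X (veval (poly_scale s) L (- w)) = - veval s X (veval (poly_scale s) L w)"
  using veval2_linear[OF s]
  by (simp_all add: veval_del[OF vector_space_poly_scale[OF s]] lin_scale[OF veval_linear[OF s]]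
      veval_map_poly[OF pCons_0_linear[OF s]] veval_del[OF s] veval_const[OF vector_space_poly_scale[OF s]]
      lin_add[OF veval2_linear[OF s]] lin_diff[OF veval2_linear[OF s]] lin_neg[OF veval2_linear[OF s]])

lemma sesqui_ext_symbol:
  assumes s: "vector_space s" and F: "\<And>X L. bilin_map s s (F X L)"
    and B: "\<And>X L a b. veval s X (veval (poly_scale s) L (B a b)) = F X L a b"
  shows "product_symbol s (sesqui_ext B) F"
  unfolding product_symbol_def
proof (intro conjI allI)
  show "bilin_map s s (F X L)" for X L by (rule F)
  fix X L p q
  note sl = module.scale_left_distrib[OF vector_space_module[OF s]]
  have inner: "veval s X (veval (poly_scale s) L (subst_poly (\<lambda>X. map_poly (pCons 0) X + pCons 0 X) (B a) q))
      = F X L a (veval s (X + L) q)" for a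
    by (rule subst_poly_eval[where S = UNIV and t = s and h = "\<lambda>w. veval s X (veval (poly_scale s) L w)"])
      (use F in \<open>auto simp: veval2_simps[OF s] sl B bilin_map_def\<close>)
  show "veval s X (veval (poly_scale s) L (sesqui_ext B p q)) = F X L (veval s (- L) p) (veval s (X + L) q)"
    unfolding sesqui_ext_def
    by (rule subst_poly_eval[where S = UNIV and t = s and h = "\<lambda>w. veval s X (veval (poly_scale s) L w)"])
      (use F in \<open>auto simp: veval2_simps[OF s] inner bilin_map_def module.scale_minus_left[OF vector_space_module[OF s]]
        module.scale_minus_right[OF vector_space_module[OF s]]\<close>)
qed

context
  fixes s :: "'k::field_char_0 \<Rightarrow> 'a::ab_group_add \<Rightarrow> 'a"
  assumes s: "vector_space s"
begin

interpretation V: vector_space s by (rule s)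

lemma ps: "vector_space (poly_scale s)" and pps: "vector_space (poly_scale (poly_scale s))"
  by (intro vector_space_poly_scale s)+

lemma product_symbol_linear:
  assumes "product_symbol s f F"
  shows "Vector_Spaces.linear s s (F X L a)" "Vector_Spaces.linear s s (\<lambda>a. F X L a b)"
    "veval s X (veval (poly_scale s) L (f p q)) = F X L (veval s (- L) p) (veval s (X + L) q)"
  using assms by (auto simp: product_symbol_def bilin_map_def)

lemma product_symbol_sesquilinear:
  assumes "product_symbol s f F"
  shows "sesquilinear (poly_scale s) (pCons 0) f"
proof -
  note F = product_symbol_linear[OF assms]
  note simps = lin_add[OF F(1)] lin_add[OF F(2)] lin_scale[OF F(1)] lin_scale[OF F(2)] lin_neg[OF F(2)]
    lin_add[OF veval_linear[OF s]] lin_scale[OF veval_linear[OF s]] lin_scale[OF veval2_linear[OF s]]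
    veval2_simps[OF s] veval_del[OF s] F(3) ps pps poly2_eq_iff[OF s]
  show ?thesis
    unfolding sesquilinear_def bilin_map_def Vector_Spaces.linear_iff
    by (simp add: simps V.scale_left_distrib)
qed

lemma veval_at_minus_lam_del:
  "veval s X (veval (poly_scale s) L (at_minus_lam_del (pCons 0) p)) = veval s X (veval (poly_scale s) (- L - X) p)"
  unfolding at_minus_lam_del_def
  by (rule subst_poly_eval[where S = UNIV and t = s and h = "\<lambda>w. veval s X (veval (poly_scale s) L w)"])
    (auto simp: veval2_simps[OF s] minus_lam_del_def veval_linear[OF s] V.scale_left_diff_distrib)

abbreviation veval3 :: "'k \<Rightarrow> 'k \<Rightarrow> 'k \<Rightarrow> 'a poly poly poly \<Rightarrow> 'a" where
  "veval3 X L M w \<equiv> veval s X (veval (poly_scale s) L (veval (poly_scale (poly_scale s)) M w))"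

lemma veval3_linear:
  "Vector_Spaces.linear (poly_scale (poly_scale (poly_scale s))) s (veval3 X L M)"
  by (rule lin_compose[OF veval_linear[OF pps] veval2_linear[OF s]])

lemma veval3_simps:
  "veval3 X L M (lam2 w) = s L (veval3 X L M w)"
  "veval3 X L M (mu2 w) = s M (veval3 X L M w)"
  "veval3 X L M [:[:p:]:] = veval s X p"
  unfolding lam2_def mu2_def
  by (simp_all add: veval_del[OF pps] lin_scale[OF veval2_linear[OF s]] veval_map_poly[OF pCons_0_linear[OF ps]]
      veval2_simps[OF s] veval_const[OF pps])

text \<open>
  The three nestings read their arguments at the same points \<open>-L\<close>, \<open>-M\<close> and \<open>X + L + M\<close>. For this reason the axioms for
  arguments in \<open>P\<close> reduce to identities for arguments in \<open>A\<close>.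
\<close>

lemma veval3_nest:
  assumes f: "product_symbol s f F" and g: "product_symbol s g G"
  shows "veval3 X L M (nest_lam_mu f g a b c)
      = F X L (veval s (- L) a) (G (X + L) M (veval s (- M) b) (veval s (X + L + M) c))"
    and "veval3 X L M (nest_mu_lam f g b a c)
      = F X M (veval s (- M) b) (G (X + M) L (veval s (- L) a) (veval s (X + L + M) c))"
    and "veval3 X L M (nest_sum f g a b c)
      = F X (L + M) (G (- L - M) L (veval s (- L) a) (veval s (- M) b)) (veval s (X + L + M) c)"
proof -
  note F = product_symbol_linear[OF f] and G = product_symbol_linear[OF g]
  note ev = subst_poly_eval[where S = UNIV and t = s and h = "veval3 X L M"]
  note simps = lin_add[OF veval3_linear] veval3_simps V.scale_left_distrib
  have 1: "veval3 X L M (subst_poly lam2 (\<lambda>x. [:[:x:]:]) p) = veval s X (veval (poly_scale s) L p)" for p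
    by (rule ev) (auto simp: simps veval_linear[OF s])
  have 2: "veval3 X L M (subst_poly mu2 (\<lambda>x. [:[:x:]:]) p) = veval s X (veval (poly_scale s) M p)" for p
    by (rule ev) (auto simp: simps veval_linear[OF s])
  have 3: "veval3 X L M (subst_poly (\<lambda>X. lam2 X + mu2 X) (\<lambda>x. [:[:x:]:]) p) = veval s X (veval (poly_scale s) (L + M) p)" for p
    by (rule ev) (auto simp: simps veval_linear[OF s])
  have "veval3 X L M (nest_lam_mu f g a b c)
      = F X L (veval s (- L) a) (veval s (X + L) (veval (poly_scale s) M (g b c)))"
    unfolding nest_lam_mu_def
    by (rule ev) (auto simp: simps 1 F(3) intro!: lin_compose[OF veval_linear[OF s] F(1)])
  then show "veval3 X L M (nest_lam_mu f g a b c)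
      = F X L (veval s (- L) a) (G (X + L) M (veval s (- M) b) (veval s (X + L + M) c))"
    by (simp add: G(3))
  have "veval3 X L M (nest_mu_lam f g b a c)
      = F X M (veval s (- M) b) (veval s (X + M) (veval (poly_scale s) L (g a c)))"
    unfolding nest_mu_lam_def
    by (rule ev) (auto simp: simps 2 F(3) intro!: lin_compose[OF veval_linear[OF s] F(1)])
  then show "veval3 X L M (nest_mu_lam f g b a c)
      = F X M (veval s (- M) b) (G (X + M) L (veval s (- L) a) (veval s (X + L + M) c))"
    by (simp add: G(3) ac_simps)
  have "veval3 X L M (nest_sum f g a b c)
      = F X (L + M) (veval s (- (L + M)) (veval (poly_scale s) L (g a b))) (veval s (X + (L + M)) c)"
    unfolding nest_sum_def
    by (rule ev) (auto simp: simps 3 F(3) intro!: lin_compose[OF veval_linear[OF s] F(2)])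
  then show "veval3 X L M (nest_sum f g a b c)
      = F X (L + M) (G (- L - M) L (veval s (- L) a) (veval s (- M) b)) (veval s (X + L + M) c)"
    by (simp add: G(3) add.assoc)
qed

lemma poisson_conformal_algebraI:
  assumes "kdel_module (poly_scale s) (pCons 0)"
    and f: "product_symbol s f F" and g: "product_symbol s g G"
    and "\<And>X L a b. F X L a b = - F X (- L - X) b a"
    and "\<And>X L M a b c. F X L a (F (X + L) M b c) = F X (L + M) (F (- L - M) L a b) c + F X M b (F (X + M) L a c)"
    and "\<And>X L M a b c. G X (L + M) (G (- L - M) L a b) c = G X L a (G (X + L) M b c)"
    and "\<And>X L a b. G X L a b = G X (- L - X) b a"
    and "\<And>X L M a b c. F X L a (G (X + L) M b c) = G X (L + M) (F (- L - M) L a b) c + G X M b (F (X + M) L a c)"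
  shows "poisson_conformal_algebra (poly_scale s) (pCons 0) f g"
proof -
  note simps = veval_at_minus_lam_del product_symbol_linear(3)[OF f] product_symbol_linear(3)[OF g] 
    veval3_nest[OF f f] veval3_nest[OF f g] veval3_nest[OF g f] veval3_nest[OF g g]
  have comm: "f p q = - at_minus_lam_del (pCons 0) (f q p)" "g p q = at_minus_lam_del (pCons 0) (g q p)" for p q
  proof (subst poly2_eq_iff[OF s], intro allI)
    fix X L
    show "veval s X (veval (poly_scale s) L (f p q)) = veval s X (veval (poly_scale s) L (- at_minus_lam_del (pCons 0) (f q p)))"
      using assms(4)[of X L "veval s (- L) p" "veval s (X + L) q"]
      by (simp add: veval2_simps(6)[OF s] simps add.commute)
  next
    show "g p q = at_minus_lam_del (pCons 0) (g q p)"
    proof (subst poly2_eq_iff[OF s], intro allI)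
      fix X L
      show "veval s X (veval (poly_scale s) L (g p q)) = veval s X (veval (poly_scale s) L (at_minus_lam_del (pCons 0) (g q p)))"
        using assms(7)[of X L "veval s (- L) p" "veval s (X + L) q"]
        by (simp add: simps add.commute)
    qed
  qed
  show ?thesis
    unfolding poisson_conformal_algebra_def poly3_eq_iff[OF s] lin_add[OF veval3_linear] simps
    by (intro conjI allI comm assms(1,5,6,8) product_symbol_sesquilinear[OF f] product_symbol_sesquilinear[OF g])
qed

lemma coproduct_symbolD:
  assumes "coproduct_symbol s D c"
  shows "comul (poly_scale s) D" "comul s (c X Y)" "teval s X Y (D p) = c X Y (veval s (X + Y) p)"
    "D p \<in> tensor2 (poly_scale s)" "c X Y a \<in> tensor2 s" "Vector_Spaces.linear (poly_scale s) fun_scale D"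
  using assms by (auto simp: coproduct_symbol_def comul_def image_subset_iff)

lemma coproduct_symbol_kdel_comul:
  assumes "coproduct_symbol s D c" shows "kdel_comul (poly_scale s) (pCons 0) D"
proof -
  note D = coproduct_symbolD[OF assms]
  have "del2 (poly_scale s) (pCons 0) (D p) \<in> tensor2 (poly_scale s)" for p
    using del2_lin_on[OF pCons_0_linear[OF s]] D(4) by (auto simp: lin_on_def)
  then show ?thesis
    using D comulD(3)[OF D(2)]
    by (simp add: kdel_comul_def tensor2_eq_iff_teval[OF s] teval_del2[OF s] veval_del[OF s])
qed

text \<open>
  In the iterated coproducts, too, the argument is read at one point only, \<open>X + Y + Z\<close>.
\<close>

lemma symbol_comul_right:
  assumes D: "coproduct_symbol s D c" and E: "coproduct_symbol s E e"
  shows "comul_right (poly_scale s) D (E p) \<in> tensor3 (poly_scale s)"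
    and "teval3 s X Y Z (comul_right (poly_scale s) D (E p)) = comul_right s (c Y Z) (e X (Y + Z) (veval s (X + (Y + Z)) p))"
  by (simp_all only: comul_right_closed coproduct_symbolD[OF D] coproduct_symbolD[OF E]
      teval3_comul_right[OF coproduct_symbolD(1,2)[OF D] coproduct_symbolD(3)[OF D]])

lemma symbol_comul_left:
  assumes D: "coproduct_symbol s D c" and E: "coproduct_symbol s E e"
  shows "comul_left (poly_scale s) D (E p) \<in> tensor3 (poly_scale s)"
    and "teval3 s X Y Z (comul_left (poly_scale s) D (E p)) = comul_left s (c X Y) (e (X + Y) Z (veval s (X + Y + Z) p))"
  by (simp_all only: comul_left_closed coproduct_symbolD[OF D] coproduct_symbolD[OF E]
      teval3_comul_left[OF coproduct_symbolD(1,2)[OF D] coproduct_symbolD(3)[OF D]])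

text \<open>
  An identity that mentions \<open>p\<close> only through one value is an identity on \<open>A\<close>, since constant polynomials take all values.
\<close>

lemma all_values_iff:
  "(\<forall>X Y a. P X Y a) \<longleftrightarrow> (\<forall>p X Y. P X Y (veval s (X + Y) p))"
  "(\<forall>X Y Z a. Q X Y Z a) \<longleftrightarrow> (\<forall>p X Y Z. Q X Y Z (veval s (X + Y + Z) p))"
  by (metis veval_const[OF s])+

lemma poisson_conformal_coalgebra_iff:
  assumes d: "coproduct_symbol s \<delta> d" and e: "coproduct_symbol s \<Delta> e"
  shows "poisson_conformal_coalgebra (poly_scale s) (pCons 0) \<delta> \<Delta> \<longleftrightarrow>
     (\<forall>X Y Z a. comul_right s (e Y Z) (e X (Y + Z) a) = comul_left s (e X Y) (e (X + Y) Z a)) \<and>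
     (\<forall>X Y a. e X Y a = flip s (e Y X a)) \<and>
     (\<forall>X Y a. d X Y a = - flip s (d Y X a)) \<and>
     (\<forall>X Y Z a. comul_right s (d Y Z) (d X (Y + Z) a) - flip12 s (comul_right s (d X Z) (d Y (X + Z) a))
        = comul_left s (d X Y) (d (X + Y) Z a)) \<and>
     (\<forall>X Y Z a. comul_right s (e Y Z) (d X (Y + Z) a)
        = comul_left s (d X Y) (e (X + Y) Z a) + flip12 s (comul_right s (d X Z) (e Y (X + Z) a)))"
proof -
  note [simp] = coproduct_symbolD(4)[OF d] coproduct_symbolD(4)[OF e] symbol_comul_right[OF d d]
    symbol_comul_right[OF d e] symbol_comul_right[OF e d] symbol_comul_right[OF e e]
    symbol_comul_left[OF d d] symbol_comul_left[OF d e] symbol_comul_left[OF e d] symbol_comul_left[OF e e]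
    flip_closed[OF ps] flip12_closed[OF ps] teval3_flip12[OF s] teval_flip[OF s]
    lin_add[OF teval3_linear] lin_diff[OF teval3_linear] teval_simps
    coproduct_symbolD(3)[OF d] coproduct_symbolD(3)[OF e]
  note symb = tensor2_eq_iff_teval[OF s] tensor3_eq_iff_teval3[OF s]
  have "(\<forall>a. comul_right (poly_scale s) \<Delta> (\<Delta> a) = comul_left (poly_scale s) \<Delta> (\<Delta> a)) \<longleftrightarrow>
     (\<forall>X Y Z a. comul_right s (e Y Z) (e X (Y + Z) a) = comul_left s (e X Y) (e (X + Y) Z a))"
    by (subst all_values_iff) (simp add: symb add.assoc)
  moreover have "(\<forall>a. \<Delta> a = flip (poly_scale s) (\<Delta> a)) \<longleftrightarrow> (\<forall>X Y a. e X Y a = flip s (e Y X a))"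
    by (subst all_values_iff) (simp add: symb add.commute)
  moreover have "(\<forall>a. \<delta> a = - flip (poly_scale s) (\<delta> a)) \<longleftrightarrow> (\<forall>X Y a. d X Y a = - flip s (d Y X a))"
    by (subst all_values_iff) (simp add: symb add.commute)
  moreover have "(\<forall>a. comul_right (poly_scale s) \<delta> (\<delta> a) - flip12 (poly_scale s) (comul_right (poly_scale s) \<delta> (\<delta> a))
        = comul_left (poly_scale s) \<delta> (\<delta> a)) \<longleftrightarrow>
     (\<forall>X Y Z a. comul_right s (d Y Z) (d X (Y + Z) a) - flip12 s (comul_right s (d X Z) (d Y (X + Z) a))
        = comul_left s (d X Y) (d (X + Y) Z a))"
    by (subst all_values_iff) (simp add: symb add.assoc add.left_commute)
  moreover have "(\<forall>a. comul_right (poly_scale s) \<Delta> (\<delta> a)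
        = comul_left (poly_scale s) \<delta> (\<Delta> a) + flip12 (poly_scale s) (comul_right (poly_scale s) \<delta> (\<Delta> a))) \<longleftrightarrow>
     (\<forall>X Y Z a. comul_right s (e Y Z) (d X (Y + Z) a)
        = comul_left s (d X Y) (e (X + Y) Z a) + flip12 s (comul_right s (d X Z) (e Y (X + Z) a)))"
    by (subst all_values_iff) (simp add: symb add.assoc add.left_commute)
  ultimately show ?thesis
    unfolding poisson_conformal_coalgebra_def
    using coproduct_symbol_kdel_comul[OF d] coproduct_symbol_kdel_comul[OF e] by (simp only: simp_thms)
qed

end

context
  fixes s :: "'k::field_char_0 \<Rightarrow> 'a::ab_group_add \<Rightarrow> 'a"
  assumes s: "vector_space s"
begin

lemma product_symbol_operator:
  assumes f: "product_symbol s f F"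
  shows "Vector_Spaces.linear (poly_scale s) (poly_scale (poly_scale s)) (f p)"
  using product_symbol_sesquilinear[OF s f] by (auto simp: sesquilinear_def bilin_map_def)

text \<open>
  All four operators, and the left-hand sides of the compatibility conditions, read \<open>p\<close> at \<open>-L\<close> and \<open>q\<close> at \<open>X + Y + L\<close>.
\<close>

lemma symbol_cmap:
  fixes X Y L :: 'k
  assumes f: "product_symbol s f F" and D: "coproduct_symbol s D c"
  defines "mld \<equiv> minus_lam_del (del2 (poly_scale s) (pCons 0))"
  shows "teval s X Y (veval fun_scale L (cmap_left (poly_scale s) (pCons 0) (f p) (D q)))
      = map_left s (F X L (veval s (- L) p)) (c (X + L) Y (veval s (X + Y + L) q))"
    and "teval s X Y (veval fun_scale L (cmap_right (poly_scale s) (pCons 0) (f p) (D q)))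
      = map_right s (F Y L (veval s (- L) p)) (c X (Y + L) (veval s (X + Y + L) q))"
    and "teval s X Y (veval fun_scale L (cmap_left (poly_scale s) mld (f q) (D p)))
      = map_left s (F X (- L - X - Y) (veval s (X + Y + L) q)) (c (- L - Y) Y (veval s (- L) p))"
    and "teval s X Y (veval fun_scale L (cmap_right (poly_scale s) mld (f q) (D p)))
      = map_right s (F Y (- L - X - Y) (veval s (X + Y + L) q)) (c X (- L - X) (veval s (- L) p))"
    and "teval s X Y (veval fun_scale L (map_poly D (f p q)))
      = c X Y (F (X + Y) L (veval s (- L) p) (veval s (X + Y + L) q))"
proof -
  note Ds = coproduct_symbolD[OF s D]
  note F = product_symbol_linear[OF s f]
  note T = product_symbol_operator[OF f]
  have mld: "lin_on (tensor_polys (poly_scale s)) (poly_scale fun_scale) mld"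
    unfolding mld_def by (rule mld_lin_on[OF pCons_0_linear[OF s]])
  have "teval s X Y (veval fun_scale L (cmap_left (poly_scale s) (pCons 0) (f p) (D q)))
      = map_left s (F X L (veval s (- L) p)) (teval s (X + L) Y (D q))"
    by (rule teval_cmap_left[OF lam_lin_on teval_lam T F(1) F(3) Ds(4)])
  then show "teval s X Y (veval fun_scale L (cmap_left (poly_scale s) (pCons 0) (f p) (D q)))
      = map_left s (F X L (veval s (- L) p)) (c (X + L) Y (veval s (X + Y + L) q))"
    by (simp add: Ds(3) ac_simps)
  have "teval s X Y (veval fun_scale L (cmap_right (poly_scale s) (pCons 0) (f p) (D q)))
      = map_right s (F Y L (veval s (- L) p)) (teval s X (Y + L) (D q))"
    by (rule teval_cmap_right[OF lam_lin_on teval_lam T F(1) F(3) Ds(4)])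
  then show "teval s X Y (veval fun_scale L (cmap_right (poly_scale s) (pCons 0) (f p) (D q)))
      = map_right s (F Y L (veval s (- L) p)) (c X (Y + L) (veval s (X + Y + L) q))"
    by (simp add: Ds(3) ac_simps)
  have "teval s X Y (veval fun_scale L (cmap_left (poly_scale s) mld (f q) (D p)))
      = map_left s (F X (- L - X - Y) (veval s (- (- L - X - Y)) q)) (teval s (X + (- L - X - Y)) Y (D p))"
    unfolding mld_def
    by (rule teval_cmap_left[OF mld[unfolded mld_def] teval_mld[OF s] T F(1) F(3) Ds(4)])
  then show "teval s X Y (veval fun_scale L (cmap_left (poly_scale s) mld (f q) (D p)))
      = map_left s (F X (- L - X - Y) (veval s (X + Y + L) q)) (c (- L - Y) Y (veval s (- L) p))"
    by (simp add: Ds(3) algebra_simps)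
  have "teval s X Y (veval fun_scale L (cmap_right (poly_scale s) mld (f q) (D p)))
      = map_right s (F Y (- L - X - Y) (veval s (- (- L - X - Y)) q)) (teval s X (Y + (- L - X - Y)) (D p))"
    unfolding mld_def
    by (rule teval_cmap_right[OF mld[unfolded mld_def] teval_mld[OF s] T F(1) F(3) Ds(4)])
  then show "teval s X Y (veval fun_scale L (cmap_right (poly_scale s) mld (f q) (D p)))
      = map_right s (F Y (- L - X - Y) (veval s (X + Y + L) q)) (c X (- L - X) (veval s (- L) p))"
    by (simp add: Ds(3) algebra_simps)
  show "teval s X Y (veval fun_scale L (map_poly D (f p q)))
      = c X Y (F (X + Y) L (veval s (- L) p) (veval s (X + Y + L) q))"
    by (simp only: veval_map_poly[OF Ds(6)] Ds(3) F(3))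
qed

lemma all_value_pairs_iff:
  "(\<forall>X Y L a b. P X Y L a b) \<longleftrightarrow> (\<forall>p q L X Y. P X Y L (veval s (- L) p) (veval s (X + Y + L) q))"
  by (metis veval_const[OF s])

lemma symbol_tensor_polys:
  assumes f: "product_symbol s f F" and D: "coproduct_symbol s D c"
  defines "mld \<equiv> minus_lam_del (del2 (poly_scale s) (pCons 0))"
  shows "map_poly D (f p q) \<in> tensor_polys (poly_scale s)"
    and "cmap_left (poly_scale s) (pCons 0) (f p) (D q) \<in> tensor_polys (poly_scale s)"
    and "cmap_right (poly_scale s) (pCons 0) (f p) (D q) \<in> tensor_polys (poly_scale s)"
    and "cmap_left (poly_scale s) mld (f p) (D q) \<in> tensor_polys (poly_scale s)"
    and "cmap_right (poly_scale s) mld (f p) (D q) \<in> tensor_polys (poly_scale s)"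
proof -
  note Ds = coproduct_symbolD[OF s D]
  show "map_poly D (f p q) \<in> tensor_polys (poly_scale s)"
    by (simp add: tensor_polys_def coeff_map_poly[of D, OF lin_0[OF Ds(6)]] Ds(4))
qed (auto simp: mld_def intro!: cmap_closed lam_lin_on mld_lin_on[OF pCons_0_linear[OF s]]
    product_symbol_operator[OF f] coproduct_symbolD(4)[OF s D])

lemma poisson_conformal_bialgebra_iff:
  assumes f: "product_symbol s f F" and g: "product_symbol s g G"
    and d: "coproduct_symbol s \<delta> d" and e: "coproduct_symbol s \<Delta> e"
  shows "poisson_conformal_bialgebra (poly_scale s) (pCons 0) f g \<delta> \<Delta> \<longleftrightarrow>
     poisson_conformal_algebra (poly_scale s) (pCons 0) f g \<and>
     poisson_conformal_coalgebra (poly_scale s) (pCons 0) \<delta> \<Delta> \<and>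
     (\<forall>X Y L a b. d X Y (F (X + Y) L a b)
        = (map_left s (F X L a) (d (X + L) Y b) + map_right s (F Y L a) (d X (Y + L) b))
        - (map_left s (F X (- L - X - Y) b) (d (- L - Y) Y a) + map_right s (F Y (- L - X - Y) b) (d X (- L - X) a))) \<and>
     (\<forall>X Y L a b. e X Y (G (X + Y) L a b)
        = map_right s (G Y L a) (e X (Y + L) b) + map_left s (G X (- L - X - Y) b) (e (- L - Y) Y a)) \<and>
     (\<forall>X Y L a b. d X Y (G (X + Y) L a b)
        = map_left s (G X L a) (d (X + L) Y b) + map_left s (G X (- L - X - Y) b) (d (- L - Y) Y a)
        + map_right s (F Y L a) (e X (Y + L) b) + map_right s (F Y (- L - X - Y) b) (e X (- L - X) a)) \<and>
     (\<forall>X Y L a b. e X Y (F (X + Y) L a b)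
        = map_left s (F X L a) (e (X + L) Y b) + map_right s (F Y L a) (e X (Y + L) b)
        - map_right s (G Y (- L - X - Y) b) (d X (- L - X) a) + map_left s (G X (- L - X - Y) b) (d (- L - Y) Y a))"
proof -
  note h = lin_compose[OF veval_linear[OF vector_space_fun_scale] teval_linear]
  note closed = symbol_tensor_polys[OF f d] symbol_tensor_polys[OF f e] symbol_tensor_polys[OF g d]
    symbol_tensor_polys[OF g e] tensor_polys_closed
  note symb = tensor_polys_eq_iff[OF s] lin_add[OF h] lin_diff[OF h] symbol_cmap[OF f d] symbol_cmap[OF f e]
    symbol_cmap[OF g d] symbol_cmap[OF g e] closed
  show ?thesis
    unfolding poisson_conformal_bialgebra_def Let_def all_value_pairs_iff by (simp only: symb)
qed

lemma teval_const_tensor: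
  assumes t: "t \<in> tensor2 s"
  shows "const_tensor s t \<in> tensor2 (poly_scale s)" "teval s X Y (const_tensor s t) = t"
proof -
  note b = bilin_pure(1)[OF const_poly_linear[OF s] const_poly_linear[OF s]]
  show "const_tensor s t \<in> tensor2 (poly_scale s)"
    unfolding const_tensor_def by (rule lift2_closed[OF b t]) auto
  show "teval s X Y (const_tensor s t) = t"
  proof (rule tensor2_induct[OF s t])
    show "teval s X Y (const_tensor s 0) = 0"
      using lift2_sums[OF b, of "[]"] by (simp add: const_tensor_def teval_def zero_fun_def)
    fix u v t assume "t \<in> tensor2 s" "teval s X Y (const_tensor s t) = t"
    then show "teval s X Y (const_tensor s (pure2 s u v + t)) = pure2 s u v + t"
      unfolding const_tensor_def
      by (simp only: lift2_linear(1)[OF b] tensor2_closed lift2_pure2[OF b] teval_simps teval_pure veval_const[OF s])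
  qed
qed

lemma restr_eq:
  assumes "D [:a:] \<in> const_tensor s ` tensor2 s"
  shows "teval s X Y (D [:a:]) = restr s D a" "restr s D a \<in> tensor2 s" 
proof -
  obtain t where t: "t \<in> tensor2 s" "D [:a:] = const_tensor s t" using assms by auto
  have "restr s D a = t"
    unfolding restr_def
  proof (rule the_equality)
    fix t' assume "t' \<in> tensor2 s \<and> const_tensor s t' = D [:a:]"
    then show "t' = t" using teval_const_tensor(2)[of t'] teval_const_tensor(2)[of t] t by metis
  qed (use t in auto)
  then show "teval s X Y (D [:a:]) = restr s D a" "restr s D a \<in> tensor2 s"
    using t by (simp_all add: teval_const_tensor)
qed

text \<open>
  If \<open>D(A) \<subseteq> A \<otimes> A\<close>, no variable remains on constants, and the symbol is the restriction of \<open>D\<close> to \<open>A\<close>, independent of \<open>X\<close> and \<open>Y\<close>.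
\<close>

lemma restr_symbol:
  assumes D: "kdel_comul (poly_scale s) (pCons 0) D" and const: "\<forall>a. D [:a:] \<in> const_tensor s ` tensor2 s"
  shows "coproduct_symbol s D (\<lambda>X Y. restr s D)"
proof -
  have c: "comul (poly_scale s) D" and D': "\<And>p. D (pCons 0 p) = del2 (poly_scale s) (pCons 0) (D p)"
    using D by (auto simp: kdel_comul_def)
  have lin: "Vector_Spaces.linear (poly_scale s) fun_scale D" using c by (simp add: comul_def)
  note r = restr_eq[of D, OF const[THEN spec]]
  have R: "Vector_Spaces.linear s fun_scale (restr s D)"
    using lin_compose[OF lin_compose[OF const_poly_linear[OF s] lin] teval_linear, of s 0 0]
    by (simp add: r(1))
  have "teval s X Y (D p) = restr s D (veval s (X + Y) p)" for X Y p
  proof (induction p)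
    case 0
    show ?case by (simp only: lin_0[OF lin] teval_simps veval_0[OF s] lin_0[OF R])
  next
    case (pCons a p)
    have "D (pCons a p) = D [:a:] + del2 (poly_scale s) (pCons 0) (D p)"
      by (simp flip: D' lin_add[OF lin])
    then have "teval s X Y (D (pCons a p)) = restr s D a + fun_scale (X + Y) (restr s D (veval s (X + Y) p))"
      by (simp only: teval_simps r(1) teval_del2[OF s comulD(1)[OF c]] pCons.IH)
    then show ?case by (simp only: veval_pCons[OF s] lin_add[OF R] lin_scale[OF R])
  qed
  then show ?thesis using c R r(2) by (auto simp: coproduct_symbol_def comul_def)
qed

lemma kdel_ext_symbol:
  assumes d: "Vector_Spaces.linear s fun_scale d" "\<And>a. d a \<in> tensor2 (poly_scale s)"
    and c: "\<And>X Y. comul s (c X Y)" and dc: "\<And>X Y a. teval s X Y (d a) = c X Y a"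
  shows "coproduct_symbol s (kdel_ext s d) c"
proof -
  let ?D = "del2 (poly_scale s) (pCons 0)"
  note D = del2_lin_on[OF pCons_0_linear[OF s]]
  have "Vector_Spaces.linear (poly_scale s) fun_scale (kdel_ext s d)"
    unfolding kdel_ext_def
    by (rule subst_poly_linear[OF vector_space_fun_scale subspace_tensor2 D d])
  moreover have "kdel_ext s d p \<in> tensor2 (poly_scale s)" for p
    unfolding kdel_ext_def by (rule subst_poly_closed) (use D d(2) in \<open>auto simp: lin_on_def\<close>)
  moreover have "teval s X Y (kdel_ext s d p) = c X Y (veval s (X + Y) p)" for X Y p
    unfolding kdel_ext_def
    by (rule subst_poly_eval[where S = "tensor2 (poly_scale s)" and t = fun_scale, OF lin_add[OF teval_linear]])
      (use D d(2) dc c in \<open>auto simp: lin_on_def teval_simps teval_del2[OF s] comul_def\<close>)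
  ultimately show ?thesis using c by (auto simp: coproduct_symbol_def comul_def)
qed

end

section \<open>The Poisson conformal algebra of a PGD-algebra\<close>

definition bracket_symbol ::
  "('k::field \<Rightarrow> 'a::ab_group_add \<Rightarrow> 'a) \<Rightarrow> ('a \<Rightarrow> 'a \<Rightarrow> 'a) \<Rightarrow> ('a \<Rightarrow> 'a \<Rightarrow> 'a) \<Rightarrow> 'k \<Rightarrow> 'k \<Rightarrow> 'a \<Rightarrow> 'a \<Rightarrow> 'a" where
  "bracket_symbol s m br X L a b = s X (m b a) + s L (star m a b) + br a b"

lemma bilinD:
  assumes "bilin_map s t f"
  shows "f (x + y) z = f x z + f y z" "f x (y + z) = f x y + f x z"
    "f (s c x) y = t c (f x y)" "f x (s c y) = t c (f x y)"
    "f (- x) y = - f x y" "f x (- y) = - f x y"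
    "f (x - y) z = f x z - f y z" "f x (y - z) = f x y - f x z"
    "Vector_Spaces.linear s t (f x)" "Vector_Spaces.linear s t (\<lambda>x. f x y)"
proof -
  have l: "Vector_Spaces.linear s t (f x)" "Vector_Spaces.linear s t (\<lambda>x. f x y)" for x y
    using assms by (auto simp: bilin_map_def)
  show "f (x + y) z = f x z + f y z" "f x (y + z) = f x y + f x z"
    "f (s c x) y = t c (f x y)" "f x (s c y) = t c (f x y)"
    "f (- x) y = - f x y" "f x (- y) = - f x y"
    "f (x - y) z = f x z - f y z" "f x (y - z) = f x y - f x z"
    "Vector_Spaces.linear s t (f x)" "Vector_Spaces.linear s t (\<lambda>x. f x y)"
    using l lin_add[OF l(1)] lin_add[OF l(2)] lin_scale[OF l(1)] lin_scale[OF l(2)]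
      lin_neg[OF l(1)] lin_neg[OF l(2)] lin_diff[OF l(1)] lin_diff[OF l(2)] by auto
qed

lemma bracket_symbol_bilin:
  assumes m: "bilin_map s s m" and br: "bilin_map s s br"
  shows "bilin_map s s (bracket_symbol s m br X L)"
proof -
  have s: "vector_space s" using m by (simp add: bilin_iff)
  interpret V: vector_space s by (rule s)
  show ?thesis
    using m br
    by (simp add: bilin_iff bracket_symbol_def star_def V.scale_right_distrib algebra_simps V.scale_left_commute)
qed

lemma pgd_bracket_symbol:
  fixes s :: "'k::field_char_0 \<Rightarrow> 'a::ab_group_add \<Rightarrow> 'a"
  assumes m: "bilin_map s s m" and br: "bilin_map s s br"
  shows "product_symbol s (pgd_bracket m br) (bracket_symbol s m br)"
proof -
  have s: "vector_space s" using m by (simp add: bilin_iff)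
  show ?thesis
    unfolding pgd_bracket_def
    by (rule sesqui_ext_symbol[OF s bracket_symbol_bilin[OF m br]])
      (simp only: veval2_simps[OF s] veval_del[OF s] veval_const[OF s] bracket_symbol_def star_def)
qed

lemma pgd_product_symbol:
  fixes s :: "'k::field_char_0 \<Rightarrow> 'a::ab_group_add \<Rightarrow> 'a"
  assumes d: "bilin_map s s d"
  shows "product_symbol s (pgd_product d) (\<lambda>X L. d)"
proof -
  have s: "vector_space s" using d by (simp add: bilin_iff)
  show ?thesis
    unfolding pgd_product_def
    by (rule sesqui_ext_symbol[OF s d]) (simp add: veval2_simps[OF s] veval_const[OF s])
qed

lemma kdel_module_poly:
  assumes "finite_dimensional_vector_space s Basis"
  shows "kdel_module (poly_scale s) (pCons 0)"
proof -
  interpret V: finite_dimensional_vector_space s Basis by fact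
  have s: "vector_space s" by unfold_locales
  interpret P: vector_space "poly_scale s" by (rule vector_space_poly_scale[OF s])
  let ?G = "(\<lambda>b. [:b:]) ` Basis"
  let ?S = "P.span {(pCons 0 ^^ i) g | i g. g \<in> ?G}"
  have monom: "(pCons 0 ^^ i) [:a:] = monom a i" for i and a :: 'b
    by (induction i) (auto simp: monom_Suc monom_0)
  have "monom a i \<in> ?S" for a i
  proof -
    have "a \<in> V.span Basis" by (simp add: V.span_Basis)
    then show ?thesis
    proof (induction rule: V.span_induct_alt)
      case base
      show ?case by (simp add: P.span_zero)
    next
      case (step c b y)
      have "monom b i \<in> ?S" using step(1) by (intro P.span_base) (force simp: monom)
      with step show ?case by (simp add: monom_add_scale[OF s] P.span_add P.span_scale)
    qed
  qed
  then have "(\<Sum>i\<le>degree p. monom (coeff p i) i) \<in> ?S" for p by (intro P.span_sum) auto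
  then have "?S = UNIV" by (auto simp flip: poly_as_monoms[OF order_refl])
  then show ?thesis
    unfolding kdel_module_def using pCons_0_linear[OF s] V.finite_Basis by blast
qed

text \<open>
  Equations between vectors are checked on functionals, where they become equations in a field and ring
  normalisation applies.
\<close>

lemma vector_eqI:
  assumes s: "vector_space s" and "\<And>\<phi>. Vector_Spaces.linear s (*) \<phi> \<Longrightarrow> \<phi> x = \<phi> y"
  shows "x = y"
  using linear_functional_separates[OF s, of "x - y"] assms(2) by (force simp: lin_diff)

text \<open>
  Polarisation of \<open>[a, a] = 0\<close>.
\<close>

lemma lie_algebra_skew:
  assumes "lie_algebra s br"
  shows "br a b = - br b a"
proof -
  have bil: "bilin_map s s br" and alt: "br a a = 0" for a
    using assms by (auto simp: lie_algebra_def)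
  have "br (a + b) (a + b) = (br a a + br b a) + (br a b + br b b)" by (simp only: bilinD(1,2)[OF bil])
  then show ?thesis by (simp add: alt eq_neg_iff_add_eq_0 add.commute)
qed

lemma pgd_algebraD:
  assumes "pgd_algebra s m d br"
  shows "bilin_map s s m" "bilin_map s s d" "bilin_map s s br" "lie_algebra s br" "vector_space s"
proof -
  show "bilin_map s s m" "bilin_map s s d" "bilin_map s s br" "lie_algebra s br"
    using assms by (auto simp: pgd_algebra_def gd_algebra_def novikov_algebra_def poisson_algebra_def
        comm_assoc_algebra_def lie_algebra_def)
  then show "vector_space s" by (simp add: bilin_iff)
qed

text \<open>
  Each axiom becomes a polynomial identity in \<open>X\<close>, \<open>L\<close>, \<open>M\<close> between products of \<open>a\<close>, \<open>b\<close>, \<open>c\<close>. For the Jacobi identity the terms of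
  degree two in the parameters are the Novikov identities, those of degree one the Gel'fand-Dorfman identity, and
  the constant term is the Jacobi identity of \<open>A\<close>.
\<close>

lemma pgd_poisson_conformal_algebra:
  fixes s :: "'k::field_char_0 \<Rightarrow> 'a::ab_group_add \<Rightarrow> 'a"
  assumes fin: "finite_dimensional_vector_space s Basis" and A: "pgd_algebra s m d br"
  shows "poisson_conformal_algebra (poly_scale s) (pCons 0) (pgd_bracket m br) (pgd_product d)"
proof -
  note bil = pgd_algebraD(1-3)[OF A] and s = pgd_algebraD(5)[OF A]
  have lsym: "m a (m b c) = m (m a b) c - m (m b a) c + m b (m a c)" for a b c
    using A by (simp add: pgd_algebra_def gd_algebra_def novikov_algebra_def algebra_simps)
  have rcomm: "m (m a b) c = m (m a c) b" for a b c
    using A by (auto simp: pgd_algebra_def gd_algebra_def novikov_algebra_def)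
  have gd: "m a (br b c) = br (m a b) c - br (m a c) b + m (br a b) c - m (br a c) b" for a b c
    using A by (simp add: pgd_algebra_def gd_algebra_def algebra_simps)
  note skew = lie_algebra_skew[OF pgd_algebraD(4)[OF A]]
  have jac: "br a (br b c) = - br b (br c a) - br c (br a b)" for a b c
  proof -
    have "br a (br b c) + br b (br c a) + br c (br a b) = 0"
      using A by (simp add: pgd_algebra_def gd_algebra_def lie_algebra_def)
    then show ?thesis by (metis add.commute add_diff_cancel_right' diff_0 diff_diff_add minus_diff_commute)
  qed
  have dcomm: "d a b = d b a" and dassoc: "d (d a b) c = d a (d b c)" for a b c
    using A by (auto simp: pgd_algebra_def poisson_algebra_def comm_assoc_algebra_def)
  have leib: "br a (d b c) = d (br a b) c + d b (br a c)" for a b c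
    using A by (simp add: pgd_algebra_def poisson_algebra_def)
  have md: "m (d a b) c = d a (m b c)" "m a (d b c) = d (m a b) c + d b (m a c)" for a b c
    using A by (auto simp: pgd_algebra_def diff_novikov_poisson_algebra_def)
  have dm: "d (m b a) c = d b (m c a)" for a b c
    using md(1)[of b c a] md(1)[of c b a] dcomm[of b c] dcomm[of "m b a" c] by simp
  let ?F = "bracket_symbol s m br"
  note expand = bracket_symbol_def star_def bilinD[OF bil(1)] bilinD[OF bil(2)] bilinD[OF bil(3)]
  show ?thesis
  proof (rule poisson_conformal_algebraI[OF s kdel_module_poly[OF fin] pgd_bracket_symbol[OF bil(1,3)]
        pgd_product_symbol[OF bil(2)]])
    fix X L M a b c
    show "?F X L a b = - ?F X (- L - X) b a"
      by (rule vector_eqI[OF s])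
        (use skew[of b a] in \<open>simp add: bracket_symbol_def star_def lin_add lin_scale lin_neg lin_diff algebra_simps\<close>)
    show "d a b = d b a" by (rule dcomm)
    show "d (d a b) c = d a (d b c)" by (rule dassoc)
    show "?F X L a (d b c) = d (?F (- L - M) L a b) c + d b (?F (X + M) L a c)"
      by (rule vector_eqI[OF s])
        (simp add: expand lin_add lin_scale lin_neg lin_diff leib md dm algebra_simps)
    show "?F X L a (?F (X + L) M b c) = ?F X (L + M) (?F (- L - M) L a b) c + ?F X M b (?F (X + M) L a c)"
    proof (rule vector_eqI[OF s])
      fix \<phi> assume \<phi>: "Vector_Spaces.linear s (*) \<phi>"
      note \<phi>lin = lin_add[OF \<phi>] lin_scale[OF \<phi>] lin_neg[OF \<phi>] lin_diff[OF \<phi>]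
      \<comment> \<open>The rules below eliminate dependent products: right commutativity fixes the order of the last two factors,
        left symmetry, the Gel'fand-Dorfman and the Jacobi identity each remove one term, skew symmetry orients the
        brackets. What is left agrees as a polynomial.\<close>
      have 1: "m (m a c) b = m (m a b) c" "m (m b c) a = m (m b a) c" "m (m c b) a = m (m c a) b"
        by (rule rcomm)+
      have 2: "m a (m b c) = m (m a b) c - m (m b a) c + m b (m a c)"
        "m a (m c b) = m (m a c) b - m (m c a) b + m c (m a b)"
        "m b (m c a) = m (m b c) a - m (m c b) a + m c (m b a)" by (rule lsym)+
      have 3: "br b a = - br a b" "br c a = - br a c" "br c b = - br b c" "br a (m x y) = - br (m x y) a"
        "br b (m x y) = - br (m x y) b" "br c (m x y) = - br (m x y) c" "br (br x y) z = - br z (br x y)" for x y z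
        by (rule skew)+
      have 4: "m a (br b c) = br (m a b) c - br (m a c) b + m (br a b) c - m (br a c) b"
        "m b (br a c) = br (m b a) c - br (m b c) a + m (br b a) c - m (br b c) a" 
        "m c (br a b) = br (m c a) b - br (m c b) a + m (br c a) b - m (br c b) a" by (rule gd)+
      have 5: "br a (br b c) = br b (br a c) - br c (br a b)"
        using jac[of a b c] skew[of c a] by (simp add: bilinD[OF bil(3)])
      show "\<phi> (?F X L a (?F (X + L) M b c)) = \<phi> (?F X (L + M) (?F (- L - M) L a b) c + ?F X M b (?F (X + M) L a c))"
        by (simp add: expand \<phi>lin 1 2 3 4 5) (simp add: algebra_simps)
    qed
  qed
qed

section \<open>Comparison of coefficients\<close>

text \<open>
  The compatibility conditions are polynomials of degree at most two in three parameters, and ten values determine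
  such a polynomial.
\<close>

lemma quadratic_scalar_iff:
  fixes c\<^sub>0 :: "'k::field_char_0"
  shows "(\<forall>X Y L. c\<^sub>0 + X * c\<^sub>X + Y * c\<^sub>Y + L * c\<^sub>L + X * X * c\<^sub>X\<^sub>X + Y * Y * c\<^sub>Y\<^sub>Y + L * L * c\<^sub>L\<^sub>L
       + X * Y * c\<^sub>X\<^sub>Y + X * L * c\<^sub>X\<^sub>L + Y * L * c\<^sub>Y\<^sub>L = 0) \<longleftrightarrow>
     c\<^sub>0 = 0 \<and> c\<^sub>X = 0 \<and> c\<^sub>Y = 0 \<and> c\<^sub>L = 0 \<and> c\<^sub>X\<^sub>X = 0 \<and> c\<^sub>Y\<^sub>Y = 0 \<and> c\<^sub>L\<^sub>L = 0 \<and> c\<^sub>X\<^sub>Y = 0 \<and> c\<^sub>X\<^sub>L = 0 \<and> c\<^sub>Y\<^sub>L = 0"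
    (is "(\<forall>X Y L. ?P X Y L = 0) \<longleftrightarrow> ?R")
proof
  assume "\<forall>X Y L. ?P X Y L = 0"
  then have P: "?P X Y L = 0" for X Y L by blast
  \<comment> \<open>The values at \<open>1\<close> and \<open>-1\<close> give \<open>u + v = 0\<close> and \<open>v - u = 0\<close> for the coefficients \<open>u\<close> of \<open>X\<close> and \<open>v\<close> of \<open>X\<^sup>2\<close>;
    these separate because \<open>2\<close> is invertible.\<close>
  have lin_quad: "u = 0 \<and> v = 0" if "u + v = 0" "v - u = 0" for u v :: 'k
  proof -
    have "2 * v = (u + v) + (v - u)" by simp
    then show ?thesis using that by simp
  qed
  have 0: "c\<^sub>0 = 0" using P[of 0 0 0] by simp
  have X: "c\<^sub>X = 0 \<and> c\<^sub>X\<^sub>X = 0"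
    by (rule lin_quad) (use P[of 1 0 0] P[of "-1" 0 0] 0 in simp_all)
  have Y: "c\<^sub>Y = 0 \<and> c\<^sub>Y\<^sub>Y = 0"
    by (rule lin_quad) (use P[of 0 1 0] P[of 0 "-1" 0] 0 in simp_all)
  have L: "c\<^sub>L = 0 \<and> c\<^sub>L\<^sub>L = 0"
    by (rule lin_quad) (use P[of 0 0 1] P[of 0 0 "-1"] 0 in simp_all)
  show ?R using 0 X Y L P[of 1 1 0] P[of 1 0 1] P[of 0 1 1] by simp
qed simp

lemma linear_scalar_iff:
  fixes c\<^sub>0 :: "'k::field_char_0"
  shows "(\<forall>X Y L. c\<^sub>0 + X * c\<^sub>X + Y * c\<^sub>Y + L * c\<^sub>L = 0) \<longleftrightarrow> c\<^sub>0 = 0 \<and> c\<^sub>X = 0 \<and> c\<^sub>Y = 0 \<and> c\<^sub>L = 0"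
  using quadratic_scalar_iff[of c\<^sub>0 c\<^sub>X c\<^sub>Y c\<^sub>L 0 0 0 0 0 0] by simp

lemma quadratic_tensor_iff:
  fixes c\<^sub>0 :: "'b \<Rightarrow> 'k::field_char_0"
  shows "(\<forall>X Y L. c\<^sub>0 + fun_scale X c\<^sub>X + fun_scale Y c\<^sub>Y + fun_scale L c\<^sub>L
       + fun_scale (X * X) c\<^sub>X\<^sub>X + fun_scale (Y * Y) c\<^sub>Y\<^sub>Y + fun_scale (L * L) c\<^sub>L\<^sub>L
       + fun_scale (X * Y) c\<^sub>X\<^sub>Y + fun_scale (X * L) c\<^sub>X\<^sub>L + fun_scale (Y * L) c\<^sub>Y\<^sub>L = 0) \<longleftrightarrow>
     c\<^sub>0 = 0 \<and> c\<^sub>X = 0 \<and> c\<^sub>Y = 0 \<and> c\<^sub>L = 0 \<and> c\<^sub>X\<^sub>X = 0 \<and> c\<^sub>Y\<^sub>Y = 0 \<and> c\<^sub>L\<^sub>L = 0 \<and> c\<^sub>X\<^sub>Y = 0 \<and> c\<^sub>X\<^sub>L = 0 \<and> c\<^sub>Y\<^sub>L = 0"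
    (is "?l \<longleftrightarrow> ?r")
proof -
  have "?l \<longleftrightarrow> (\<forall>\<beta> X Y L. c\<^sub>0 \<beta> + X * c\<^sub>X \<beta> + Y * c\<^sub>Y \<beta> + L * c\<^sub>L \<beta> + X * X * c\<^sub>X\<^sub>X \<beta> + Y * Y * c\<^sub>Y\<^sub>Y \<beta> + L * L * c\<^sub>L\<^sub>L \<beta>
      + X * Y * c\<^sub>X\<^sub>Y \<beta> + X * L * c\<^sub>X\<^sub>L \<beta> + Y * L * c\<^sub>Y\<^sub>L \<beta> = 0)"
    by (auto simp: fun_eq_iff fun_scale_def)
  also have "\<dots> \<longleftrightarrow> ?r"
    unfolding quadratic_scalar_iff by (auto simp: fun_eq_iff)
  finally show ?thesis .
qed

lemma linear_tensor_iff:
  fixes c\<^sub>0 :: "'b \<Rightarrow> 'k::field_char_0"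
  shows "(\<forall>X Y L. c\<^sub>0 + fun_scale X c\<^sub>X + fun_scale Y c\<^sub>Y + fun_scale L c\<^sub>L = 0) \<longleftrightarrow> c\<^sub>0 = 0 \<and> c\<^sub>X = 0 \<and> c\<^sub>Y = 0 \<and> c\<^sub>L = 0"
  using quadratic_tensor_iff[of c\<^sub>0 c\<^sub>X c\<^sub>Y c\<^sub>L 0 0 0 0 0 0] by (simp only: fun_scale_right add_0_right simp_thms)

section \<open>Expansion of the compatibility conditions\<close>

lemma map_left_fun_add:
  assumes f: "Vector_Spaces.linear s s f" and g: "Vector_Spaces.linear s s g" and t: "t \<in> tensor2 s"
  shows "map_left s (\<lambda>u. f u + g u) t = map_left s f t + map_left s g t"
proof -
  note s = lin_vs(1)[OF f]
  have fg: "Vector_Spaces.linear s s (\<lambda>u. f u + g u)"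
    using f g s by (intro linI) (auto simp: lin_add lin_scale module.scale_right_distrib[OF vector_space_module[OF s]] ac_simps)
  show ?thesis
    by (rule tensor2_induct[OF s t])
      (simp_all only: f g fg map_left_0 map_left_lin tensor2_closed lin_add[OF pure2_linear(2)[OF s]] add_0 ac_simps)
qed

lemma map_left_fun_scale:
  assumes f: "Vector_Spaces.linear s s f" and t: "t \<in> tensor2 s"
  shows "map_left s (\<lambda>u. s c (f u)) t = fun_scale c (map_left s f t)"
proof -
  note s = lin_vs(1)[OF f]
  have cf: "Vector_Spaces.linear s s (\<lambda>u. s c (f u))"
    by (rule lin_compose[OF f scale_linear[OF s]])
  show ?thesis
    by (rule tensor2_induct[OF s t])
      (simp_all only: f cf map_left_0 map_left_lin tensor2_closed lin_scale[OF pure2_linear(2)[OF s]] fun_scale_right)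
qed

lemma map_right_fun_add:
  assumes f: "Vector_Spaces.linear s s f" and g: "Vector_Spaces.linear s s g" and t: "t \<in> tensor2 s"
  shows "map_right s (\<lambda>u. f u + g u) t = map_right s f t + map_right s g t"
proof -
  note s = lin_vs(1)[OF f]
  have fg: "Vector_Spaces.linear s s (\<lambda>u. f u + g u)"
    using f g s by (intro linI) (auto simp: lin_add lin_scale module.scale_right_distrib[OF vector_space_module[OF s]] ac_simps)
  show ?thesis
    by (rule tensor2_induct[OF s t])
      (simp_all only: f g fg map_right_0 map_right_lin tensor2_closed lin_add[OF pure2_linear(1)[OF s]] add_0 ac_simps)
qed

lemma map_right_fun_scale:
  assumes f: "Vector_Spaces.linear s s f" and t: "t \<in> tensor2 s"
  shows "map_right s (\<lambda>u. s c (f u)) t = fun_scale c (map_right s f t)"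
proof -
  note s = lin_vs(1)[OF f]
  have cf: "Vector_Spaces.linear s s (\<lambda>u. s c (f u))"
    by (rule lin_compose[OF f scale_linear[OF s]])
  show ?thesis
    by (rule tensor2_induct[OF s t])
      (simp_all only: f cf map_right_0 map_right_lin tensor2_closed lin_scale[OF pure2_linear(1)[OF s]] fun_scale_right)
qed

lemma fun_scale_neg_one: "fun_scale (- 1) t = - t"
  by (simp add: fun_scale_def fun_eq_iff)

lemma tensor2_lin_neg:
  assumes "\<And>c x. x \<in> tensor2 s \<Longrightarrow> h (fun_scale c x) = fun_scale c (h x)" and "x \<in> tensor2 s"
  shows "h (- x) = - h x"
  using assms(1)[OF assms(2), of "- 1"] by (simp only: fun_scale_neg_one)

lemma tensor2_lin_diff:
  assumes add: "\<And>x y. x \<in> tensor2 s \<Longrightarrow> y \<in> tensor2 s \<Longrightarrow> h (x + y) = h x + h y"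
    and scale: "\<And>c x. x \<in> tensor2 s \<Longrightarrow> h (fun_scale c x) = fun_scale c (h x)"
    and x: "x \<in> tensor2 s" and y: "y \<in> tensor2 s"
  shows "h (x - y) = h x - h y"
  using add[OF x tensor2_closed(4)[OF y]] tensor2_lin_neg[where h = h, OF scale y] by simp

lemma map_left_diff:
  assumes f: "Vector_Spaces.linear s s f"
  shows "x \<in> tensor2 s \<Longrightarrow> map_left s f (- x) = - map_left s f x"
    and "x \<in> tensor2 s \<Longrightarrow> y \<in> tensor2 s \<Longrightarrow> map_left s f (x - y) = map_left s f x - map_left s f y"
  by (simp_all only: tensor2_lin_neg[where h = "map_left s f", OF map_left_lin(2)[OF f]]
      tensor2_lin_diff[where h = "map_left s f", OF map_left_lin(1)[OF f] map_left_lin(2)[OF f]])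

lemma map_right_diff:
  assumes f: "Vector_Spaces.linear s s f"
  shows "x \<in> tensor2 s \<Longrightarrow> map_right s f (- x) = - map_right s f x"
    and "x \<in> tensor2 s \<Longrightarrow> y \<in> tensor2 s \<Longrightarrow> map_right s f (x - y) = map_right s f x - map_right s f y"
  by (simp_all only: tensor2_lin_neg[where h = "map_right s f", OF map_right_lin(2)[OF f]]
      tensor2_lin_diff[where h = "map_right s f", OF map_right_lin(1)[OF f] map_right_lin(2)[OF f]])

lemma flip_diff:
  assumes s: "vector_space s"
  shows "x \<in> tensor2 s \<Longrightarrow> flip s (- x) = - flip s x"
    and "x \<in> tensor2 s \<Longrightarrow> y \<in> tensor2 s \<Longrightarrow> flip s (x - y) = flip s x - flip s y"
  by (simp_all only: tensor2_lin_neg[where h = "flip s", OF flip_lin(2)[OF s]]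
      tensor2_lin_diff[where h = "flip s", OF flip_lin(1)[OF s] flip_lin(2)[OF s]])

lemma flip_0: "vector_space s \<Longrightarrow> flip s 0 = 0"
  by (rule tensor2_lin_0) (rule flip_lin)

lemma flip_flip:
  assumes s: "vector_space s" and t: "t \<in> tensor2 s"
  shows "flip s (flip s t) = t"
  by (rule tensor2_induct[OF s t]) (simp_all only: flip_0[OF s] flip_lin[OF s] tensor2_closed flip_closed[OF s])

lemma flip_map:
  assumes f: "Vector_Spaces.linear s s f" and t: "t \<in> tensor2 s"
  shows "flip s (map_left s f t) = map_right s f (flip s t)" "flip s (map_right s f t) = map_left s f (flip s t)"
proof -
  note s = lin_vs(1)[OF f]
  note r = flip_0[OF s] flip_lin[OF s] map_left_0[OF f] map_right_0[OF f] map_left_lin[OF f] map_right_lin[OF f]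
    tensor2_closed flip_closed[OF s] map_left_closed[OF f] map_right_closed[OF f]
  show "flip s (map_left s f t) = map_right s f (flip s t)" "flip s (map_right s f t) = map_left s f (flip s t)"
    by (rule tensor2_induct[OF s t]; simp only: r)+
qed

text \<open>
  The symbol of \<open>\<delta>\<close>: the evaluation of \<open>(\<partial> \<otimes> I)\<Delta>\<^sub>1 - \<tau>(\<partial> \<otimes> I)\<Delta>\<^sub>1 + \<delta>\<^sub>0\<close> at \<open>\<partial> \<otimes> I = X\<close> and \<open>I \<otimes> \<partial> = Y\<close>.
\<close>

definition cobracket_symbol ::
  "('k::field \<Rightarrow> 'a::ab_group_add \<Rightarrow> 'a) \<Rightarrow> ('a \<Rightarrow> ('k, 'a) tens2) \<Rightarrow> ('a \<Rightarrow> ('k, 'a) tens2) \<Rightarrow> 'k \<Rightarrow> 'k \<Rightarrow> 'a \<Rightarrow> ('k, 'a) tens2" where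
  "cobracket_symbol s D1 D0 X Y a = fun_scale X (D1 a) - fun_scale Y (flip s (D1 a)) + D0 a"

text \<open>
  The products and coproducts on \<open>A\<close> with just enough of their axioms for the expansions in the parameters.
\<close>

locale pgd_data =
  fixes s :: "'k::field_char_0 \<Rightarrow> 'a::ab_group_add \<Rightarrow> 'a"
    and m d br :: "'a \<Rightarrow> 'a \<Rightarrow> 'a"
    and D1 D2 D0 :: "'a \<Rightarrow> ('k, 'a) tens2"
  assumes m: "bilin_map s s m" and d: "bilin_map s s d" and br: "bilin_map s s br"
    and d_comm: "d a b = d b a" and br_skew: "br a b = - br b a"
    and D1: "comul s D1" and D2: "comul s D2" and D0: "comul s D0"
begin

lemma s: "vector_space s" using m by (simp add: bilin_iff)

text \<open>
  A defect is the difference of the two sides of a compatibility condition of PGD-bialgebras; the Novikov and the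
  differential Novikov-Poisson conditions are numbered in the usual order. The coefficients in the parameters of a conformal
  compatibility condition turn out to be combinations of defects.
\<close>

definition "novikov_defect1 a b =
  D1 (m a b) - (map_left s (\<lambda>x. m x b) (D1 a) + map_right s (star m a) (D1 b + flip s (D1 b)))"

definition "novikov_defect2 a b =
  map_left s (star m a) (D1 b) - map_right s (star m a) (flip s (D1 b))
  - (map_left s (star m b) (D1 a) - map_right s (star m b) (flip s (D1 a)))"

definition "novikov_defect3 a b =
  map_right s (\<lambda>x. m x a) (D1 b + flip s (D1 b)) - map_left s (\<lambda>x. m x a) (D1 b + flip s (D1 b))
  - (map_right s (\<lambda>x. m x b) (D1 a + flip s (D1 a)) - map_left s (\<lambda>x. m x b) (D1 a + flip s (D1 a)))"

definition "lie_defect a b =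
  D0 (br a b) - ((map_left s (br a) (D0 b) + map_right s (br a) (D0 b))
    - (map_left s (br b) (D0 a) + map_right s (br b) (D0 a)))"

definition "gd_defect a b =
  D0 (m b a) + D1 (br a b)
  - (map_left s (\<lambda>x. m x a) (D0 b) + map_left s (m b) (D0 a) + map_right s (star m b) (D0 a)
     + (map_left s (br a) (D1 b) + map_right s (br a) (D1 b))
     - map_right s (br b) (D1 a + flip s (D1 a)))"

definition "poisson_defect1 a b =
  D0 (d a b) - (map_left s (d a) (D0 b) + map_left s (d b) (D0 a) + map_right s (br a) (D2 b) + map_right s (br b) (D2 a))"

definition "poisson_defect2 a b =
  D2 (br a b) - (map_left s (br a) (D2 b) + map_right s (br a) (D2 b) - map_right s (d b) (D0 a) + map_left s (d b) (D0 a))"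

definition "dnp_defect1 a b =
  D1 (d a b) - (map_left s (d a) (D1 b) - map_right s (star m b) (D2 a))"

definition "dnp_defect2 a b =
  D2 (m a b) - (map_left s (\<lambda>x. m x b) (D2 a) - map_right s (d a) (D1 b + flip s (D1 b)))"

definition "dnp_defect3 a b =
  map_left s (m a) (D2 b) + map_right s (m b) (D2 a) + map_right s (d b) (D1 a) + map_left s (d a) (flip s (D1 b))"

abbreviation "F \<equiv> bracket_symbol s m br"
abbreviation "\<delta> \<equiv> cobracket_symbol s D1 D0"

lemma comul_lin:
  "D1 (a + b) = D1 a + D1 b" "D1 (s c a) = fun_scale c (D1 a)" "D1 (- a) = - D1 a"
  "D2 (a + b) = D2 a + D2 b" "D2 (s c a) = fun_scale c (D2 a)" "D2 (- a) = - D2 a"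
  "D0 (a + b) = D0 a + D0 b" "D0 (s c a) = fun_scale c (D0 a)" "D0 (- a) = - D0 a"
  using D1 D2 D0 by (auto simp: comul_def lin_add lin_scale lin_neg)

lemma in_tensor2 [simp]: "D1 a \<in> tensor2 s" "D2 a \<in> tensor2 s" "D0 a \<in> tensor2 s" "t \<in> tensor2 s \<Longrightarrow> flip s t \<in> tensor2 s"
  using D1 D2 D0 by (auto simp: comul_def flip_closed[OF s])

lemma linear_star: "Vector_Spaces.linear s s (star m a)"
proof -
  have "star m a = (\<lambda>u. m a u + m u a)" by (simp add: star_def fun_eq_iff)
  with m show ?thesis by (simp add: bilin_map_def Vector_Spaces.linear_iff ac_simps module.scale_right_distrib[OF vector_space_module[OF s]])
qed

lemmas linear_ops [simp] = bilinD(9,10)[OF m] bilinD(9,10)[OF d] bilinD(9,10)[OF br] linear_star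

lemma map_expand:
  assumes t: "t \<in> tensor2 s"
  shows "map_left s (star m a) t = map_left s (m a) t + map_left s (\<lambda>u. m u a) t"
    "map_right s (star m a) t = map_right s (m a) t + map_right s (\<lambda>u. m u a) t"
    "map_left s (F X L a) t = fun_scale X (map_left s (\<lambda>u. m u a) t) + fun_scale L (map_left s (star m a) t) + map_left s (br a) t"
    "map_right s (F X L a) t = fun_scale X (map_right s (\<lambda>u. m u a) t) + fun_scale L (map_right s (star m a) t) + map_right s (br a) t"
proof -
  have st: "star m a = (\<lambda>u. m a u + m u a)" by (simp add: star_def fun_eq_iff)
  show "map_left s (star m a) t = map_left s (m a) t + map_left s (\<lambda>u. m u a) t"
    "map_right s (star m a) t = map_right s (m a) t + map_right s (\<lambda>u. m u a) t"
    unfolding st by (simp_all only: map_left_fun_add map_right_fun_add map_left_fun_scale map_right_fun_scale linear_ops t)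
  have sc: "Vector_Spaces.linear s s f \<Longrightarrow> Vector_Spaces.linear s s (\<lambda>u. s c (f u))" for f c
    by (rule lin_compose[OF _ scale_linear[OF s]])
  have ad: "Vector_Spaces.linear s s f \<Longrightarrow> Vector_Spaces.linear s s g \<Longrightarrow> Vector_Spaces.linear s s (\<lambda>u. f u + g u)" for f g
    using s by (simp add: Vector_Spaces.linear_iff ac_simps module.scale_right_distrib[OF vector_space_module[OF s]])
  have F: "F X L a = (\<lambda>u. s X (m u a) + s L (star m a u) + br a u)"
    by (simp add: bracket_symbol_def fun_eq_iff)
  have scale: "Vector_Spaces.linear s s f \<Longrightarrow> map_left s (\<lambda>u. s c (f u)) t = fun_scale c (map_left s f t)"
    "Vector_Spaces.linear s s f \<Longrightarrow> map_right s (\<lambda>u. s c (f u)) t = fun_scale c (map_right s f t)" for f c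
    by (rule map_left_fun_scale[OF _ t] map_right_fun_scale[OF _ t], assumption)+
  show "map_left s (F X L a) t = fun_scale X (map_left s (\<lambda>u. m u a) t) + fun_scale L (map_left s (star m a) t) + map_left s (br a) t"
   "map_right s (F X L a) t = fun_scale X (map_right s (\<lambda>u. m u a) t) + fun_scale L (map_right s (star m a) t) + map_right s (br a) t"
    unfolding F by (simp_all only: map_left_fun_add map_right_fun_add scale linear_ops sc ad t)
qed

lemma fun_scale_apply: "fun_scale c t x = c * t x"
  by (simp add: fun_scale_def)

lemmas tensor_expand = map_expand map_left_lin(1,2) map_right_lin(1,2) map_left_diff map_right_diff
  flip_lin(1,2)[OF s] flip_diff[OF s] flip_flip[OF s] flip_map comul_lin map_left_closed map_right_closed

text \<open>
  Skew symmetry of \<open>\<delta>\<close> makes the left-hand side change sign under \<open>\<tau>\<close> combined with the exchange of \<open>X\<close> and \<open>Y\<close>. Hence the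
  coefficients of \<open>Y\<close>, \<open>Y\<^sup>2\<close> and \<open>YL\<close> are those of \<open>X\<close>, \<open>X\<^sup>2\<close> and \<open>XL\<close> up to \<open>-\<tau>\<close>. The coefficients of \<open>L\<close> and \<open>XL\<close> are, up to the second
  Novikov defect, symmetrisations of those of \<open>X\<close> and \<open>X\<^sup>2\<close> in \<open>a\<close> and \<open>b\<close>.
\<close>

lemma bracket_compat_expand:
  assumes skew: "\<And>a. D0 a = - flip s (D0 a)"
  shows "\<delta> X Y (F (X + Y) L a b)
      - ((map_left s (F X L a) (\<delta> (X + L) Y b) + map_right s (F Y L a) (\<delta> X (Y + L) b))
        - (map_left s (F X (- L - X - Y) b) (\<delta> (- L - Y) Y a) + map_right s (F Y (- L - X - Y) b) (\<delta> X (- L - X) a)))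
    = lie_defect a b + fun_scale X (gd_defect a b) + fun_scale Y (- flip s (gd_defect a b))
      + fun_scale L (gd_defect a b + gd_defect b a)
      + fun_scale (X * X) (novikov_defect1 b a) + fun_scale (Y * Y) (- flip s (novikov_defect1 b a))
      + fun_scale (L * L) (- novikov_defect2 a b)
      + fun_scale (X * Y) (novikov_defect1 b a - flip s (novikov_defect1 b a) - novikov_defect3 a b)
      + fun_scale (X * L) (novikov_defect1 a b + novikov_defect1 b a - novikov_defect2 a b)
      + fun_scale (Y * L) (flip s (novikov_defect2 a b) - flip s (novikov_defect1 a b) - flip s (novikov_defect1 b a))"
proof (rule ext)
  fix \<beta>
  have sk: "flip s (D0 a) = - D0 a" for a using skew[of a] by (metis minus_minus)
  note ba = br_skew[of b a]
  show "(\<delta> X Y (F (X + Y) L a b)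
      - ((map_left s (F X L a) (\<delta> (X + L) Y b) + map_right s (F Y L a) (\<delta> X (Y + L) b))
        - (map_left s (F X (- L - X - Y) b) (\<delta> (- L - Y) Y a) + map_right s (F Y (- L - X - Y) b) (\<delta> X (- L - X) a)))) \<beta>
    = (lie_defect a b + fun_scale X (gd_defect a b) + fun_scale Y (- flip s (gd_defect a b))
      + fun_scale L (gd_defect a b + gd_defect b a)
      + fun_scale (X * X) (novikov_defect1 b a) + fun_scale (Y * Y) (- flip s (novikov_defect1 b a))
      + fun_scale (L * L) (- novikov_defect2 a b)
      + fun_scale (X * Y) (novikov_defect1 b a - flip s (novikov_defect1 b a) - novikov_defect3 a b)
      + fun_scale (X * L) (novikov_defect1 a b + novikov_defect1 b a - novikov_defect2 a b)
      + fun_scale (Y * L) (flip s (novikov_defect2 a b) - flip s (novikov_defect1 a b) - flip s (novikov_defect1 b a))) \<beta>"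
    unfolding cobracket_symbol_def novikov_defect1_def novikov_defect2_def novikov_defect3_def lie_defect_def gd_defect_def
    unfolding bracket_symbol_def[of s m br "X + Y" L a b] star_def[of m a b] ba comul_lin
    by (simp add: tensor_expand sk fun_scale_apply) (simp add: algebra_simps)
qed

text \<open>
  The coefficient of \<open>X\<close> is the first differential Novikov-Poisson condition. The third one
  enters through the coefficient of \<open>Y\<close>, from which it differs by instances of the first two and their images under \<open>\<tau>\<close>.
\<close>

lemma product_cobracket_expand:
  "\<delta> X Y (d a b)
      - (map_left s (d a) (\<delta> (X + L) Y b) + map_left s (d b) (\<delta> (- L - Y) Y a)
        + map_right s (F Y L a) (D2 b) + map_right s (F Y (- L - X - Y) b) (D2 a))
    = poisson_defect1 a b + fun_scale X (dnp_defect1 a b)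
      + fun_scale Y (dnp_defect3 a b - flip s (dnp_defect1 b a) + flip s (dnp_defect2 b a) - dnp_defect2 b a)
      + fun_scale L (dnp_defect1 a b - dnp_defect1 b a)"
  if cocomm: "\<And>a. flip s (D2 a) = D2 a"
proof (rule ext)
  fix \<beta>
  show "(\<delta> X Y (d a b)
      - (map_left s (d a) (\<delta> (X + L) Y b) + map_left s (d b) (\<delta> (- L - Y) Y a)
        + map_right s (F Y L a) (D2 b) + map_right s (F Y (- L - X - Y) b) (D2 a))) \<beta>
    = (poisson_defect1 a b + fun_scale X (dnp_defect1 a b)
      + fun_scale Y (dnp_defect3 a b - flip s (dnp_defect1 b a) + flip s (dnp_defect2 b a) - dnp_defect2 b a)
      + fun_scale L (dnp_defect1 a b - dnp_defect1 b a)) \<beta>"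
    unfolding cobracket_symbol_def poisson_defect1_def dnp_defect1_def dnp_defect2_def dnp_defect3_def d_comm[of b a]
    by (simp add: tensor_expand cocomm fun_scale_apply) (simp add: algebra_simps)
qed

text \<open>
  Here the coefficients of \<open>X\<close> and \<open>Y\<close> are the second differential Novikov-Poisson condition and its image under \<open>\<tau>\<close>. The
  coefficient of \<open>L\<close> yields the third condition once more.
\<close>

lemma bracket_coproduct_expand:
  "D2 (F (X + Y) L a b)
      - (map_left s (F X L a) (D2 b) + map_right s (F Y L a) (D2 b)
        - map_right s (d b) (\<delta> X (- L - X) a) + map_left s (d b) (\<delta> (- L - Y) Y a))
    = poisson_defect2 a b + fun_scale X (dnp_defect2 b a) + fun_scale Y (flip s (dnp_defect2 b a))
      + fun_scale L (dnp_defect2 b a + flip s (dnp_defect2 a b) - dnp_defect3 a b + dnp_defect1 a b - dnp_defect1 b a)"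
  if cocomm: "\<And>a. flip s (D2 a) = D2 a"
proof (rule ext)
  fix \<beta>
  show "(D2 (F (X + Y) L a b)
      - (map_left s (F X L a) (D2 b) + map_right s (F Y L a) (D2 b)
        - map_right s (d b) (\<delta> X (- L - X) a) + map_left s (d b) (\<delta> (- L - Y) Y a))) \<beta>
    = (poisson_defect2 a b + fun_scale X (dnp_defect2 b a) + fun_scale Y (flip s (dnp_defect2 b a))
      + fun_scale L (dnp_defect2 b a + flip s (dnp_defect2 a b) - dnp_defect3 a b + dnp_defect1 a b - dnp_defect1 b a)) \<beta>"
    unfolding cobracket_symbol_def poisson_defect2_def dnp_defect1_def dnp_defect2_def dnp_defect3_def d_comm[of b a]
    unfolding bracket_symbol_def[of s m br "X + Y" L a b] star_def[of m a b] comul_lin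
    by (simp add: tensor_expand cocomm fun_scale_apply) (simp add: algebra_simps)
qed

lemma flip_zero: "flip s 0 = 0"
  by (rule flip_0[OF s])

lemma fun_scale_zero: "fun_scale 0 t = 0" "fun_scale c 0 = 0"
  by (auto simp: fun_scale_def zero_fun_def)

text \<open>
  The coefficients of \<open>X\<^sup>2\<close> and \<open>L\<^sup>2\<close> isolate the first two Novikov defects. Only then does the coefficient of \<open>XY\<close> isolate
  the third.
\<close>

lemma bracket_compat_iff:
  assumes skew: "\<And>a. D0 a = - flip s (D0 a)"
  shows "(\<forall>X Y L a b. \<delta> X Y (F (X + Y) L a b)
      = (map_left s (F X L a) (\<delta> (X + L) Y b) + map_right s (F Y L a) (\<delta> X (Y + L) b))
        - (map_left s (F X (- L - X - Y) b) (\<delta> (- L - Y) Y a) + map_right s (F Y (- L - X - Y) b) (\<delta> X (- L - X) a)))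
    \<longleftrightarrow> (\<forall>a b. novikov_defect1 a b = 0) \<and> (\<forall>a b. novikov_defect2 a b = 0) \<and> (\<forall>a b. novikov_defect3 a b = 0)
      \<and> (\<forall>a b. lie_defect a b = 0) \<and> (\<forall>a b. gd_defect a b = 0)"
    (is "(\<forall>X Y L a b. ?l X Y L a b = ?r X Y L a b) \<longleftrightarrow> ?R")
proof -
  have "(\<forall>X Y L a b. ?l X Y L a b = ?r X Y L a b) \<longleftrightarrow> (\<forall>a b X Y L. ?l X Y L a b - ?r X Y L a b = 0)"
    unfolding right_minus_eq by blast
  also have "\<dots> \<longleftrightarrow> ?R"
    unfolding bracket_compat_expand[OF skew] quadratic_tensor_iff neg_equal_0_iff_equal
  proof (rule iffI, goal_cases)
    case Q: 1
    then have 1: "novikov_defect1 a b = 0" for a b by blast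
    from Q have "novikov_defect1 b a - flip s (novikov_defect1 b a) - novikov_defect3 a b = 0" for a b by blast
    then have "novikov_defect3 a b = 0" for a b by (simp add: 1 flip_zero)
    with Q 1 show ?R by blast
  qed (simp add: flip_zero)
  finally show ?thesis .
qed

lemma product_compat_iff:
  assumes cocomm: "\<And>a. flip s (D2 a) = D2 a"
  shows "(\<forall>X Y L a b. \<delta> X Y (d a b)
      = map_left s (d a) (\<delta> (X + L) Y b) + map_left s (d b) (\<delta> (- L - Y) Y a)
        + map_right s (F Y L a) (D2 b) + map_right s (F Y (- L - X - Y) b) (D2 a)) \<and>
    (\<forall>X Y L a b. D2 (F (X + Y) L a b)
      = map_left s (F X L a) (D2 b) + map_right s (F Y L a) (D2 b)
        - map_right s (d b) (\<delta> X (- L - X) a) + map_left s (d b) (\<delta> (- L - Y) Y a))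
    \<longleftrightarrow> (\<forall>a b. poisson_defect1 a b = 0) \<and> (\<forall>a b. poisson_defect2 a b = 0)
      \<and> (\<forall>a b. dnp_defect1 a b = 0) \<and> (\<forall>a b. dnp_defect2 a b = 0) \<and> (\<forall>a b. dnp_defect3 a b = 0)"
    (is "(\<forall>X Y L a b. ?l X Y L a b = ?r X Y L a b) \<and> (\<forall>X Y L a b. ?l' X Y L a b = ?r' X Y L a b) \<longleftrightarrow> ?R")
proof -
  have "(\<forall>X Y L a b. ?l X Y L a b = ?r X Y L a b) \<and> (\<forall>X Y L a b. ?l' X Y L a b = ?r' X Y L a b) \<longleftrightarrow>
      (\<forall>a b X Y L. ?l X Y L a b - ?r X Y L a b = 0) \<and> (\<forall>a b X Y L. ?l' X Y L a b - ?r' X Y L a b = 0)"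
    unfolding right_minus_eq by blast
  also have "\<dots> \<longleftrightarrow> ?R"
    unfolding product_cobracket_expand[OF cocomm] bracket_coproduct_expand[OF cocomm] linear_tensor_iff
     
  proof (rule iffI, goal_cases)
    case Q: 1
    then have 12: "dnp_defect1 a b = 0" "dnp_defect2 a b = 0" for a b by blast+
    from Q have "dnp_defect3 a b - flip s (dnp_defect1 b a) + flip s (dnp_defect2 b a) - dnp_defect2 b a = 0"
      for a b by blast
    then have "dnp_defect3 a b = 0" for a b by (simp add: 12 flip_zero)
    with Q 12 show ?R by blast
  qed (simp add: flip_zero)
  finally show ?thesis .
qed

section \<open>Expansion of the coalgebra conditions\<close>

lemma comul_cobracket: "comul s (\<delta> X Y)"
proof -
  have "fun_scale c (fun_scale c' t) = fun_scale c' (fun_scale c t)" for c c' and t :: "('k, 'a) tens2"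
    by (simp add: fun_scale_def fun_eq_iff)
  then have "Vector_Spaces.linear s fun_scale (\<delta> X Y)"
    by (intro linI[OF s vector_space_fun_scale])
      (simp_all add: cobracket_symbol_def comul_lin flip_lin[OF s] fun_scale_right)
  then show ?thesis by (auto simp: comul_def cobracket_symbol_def)
qed

lemma cobracket_apply:
  "bilin_map s (*) \<beta> \<Longrightarrow> \<delta> X Y v \<beta> = X * D1 v \<beta> + (- Y) * D1 v (\<lambda>x y. \<beta> y x) + D0 v \<beta>"
  by (simp add: cobracket_symbol_def fun_scale_apply flip_apply)

lemma form_lincomb:
  assumes "t \<in> tensor2 s" "bilin_map s (*) \<alpha>" "bilin_map s (*) \<beta>" "bilin_map s (*) \<gamma>"
  shows "t (\<lambda>u v. X * \<alpha> u v + Y * \<beta> u v + \<gamma> u v) = X * t \<alpha> + Y * t \<beta> + t \<gamma>"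
proof -
  have sc: "bilin_map s (*) \<alpha> \<Longrightarrow> bilin_map s (*) (\<lambda>u v. c * \<alpha> u v)" for c \<alpha>
    by (simp add: bilin_iff algebra_simps)
  have ad: "bilin_map s (*) \<alpha> \<Longrightarrow> bilin_map s (*) \<beta> \<Longrightarrow> bilin_map s (*) (\<lambda>u v. \<alpha> u v + \<beta> u v)" for \<alpha> \<beta>
    by (simp add: bilin_iff algebra_simps)
  have "t (\<lambda>u v. X * \<alpha> u v + Y * \<beta> u v + \<gamma> u v) = t (\<lambda>u v. X * \<alpha> u v + Y * \<beta> u v) + t \<gamma>"
    by (rule tensor2_form_lin(3)[OF s assms(1) ad[OF sc[OF assms(2)] sc[OF assms(3)]] assms(4)])
  also have "t (\<lambda>u v. X * \<alpha> u v + Y * \<beta> u v) = t (\<lambda>u v. X * \<alpha> u v) + t (\<lambda>u v. Y * \<beta> u v)"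
    by (rule tensor2_form_lin(3)[OF s assms(1) sc[OF assms(2)] sc[OF assms(3)]])
  finally show ?thesis by (simp only: tensor2_form_lin(4)[OF s assms(1)] assms(2,3))
qed

lemma comul_right_cobracket:
  assumes \<gamma>: "trilin_map s (*) \<gamma>" and t: "t \<in> tensor2 s"
  shows "comul_right s (\<delta> X Y) t \<gamma>
    = X * comul_right s D1 t \<gamma> - Y * comul_right s D1 t (\<lambda>u x y. \<gamma> u y x) + comul_right s D0 t \<gamma>"
  unfolding comul_right_apply[OF comul_cobracket t \<gamma>] comul_right_apply[OF D1 t \<gamma>] comul_right_apply[OF D0 t \<gamma>]
    comul_right_apply[OF D1 t trilin_perms(1)[OF \<gamma>]] cobracket_apply[OF trilin_slices(2)[OF \<gamma>]]
  by (subst form_lincomb[OF t comul_slice_bilin(2)[OF D1 \<gamma>]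
        comul_slice_bilin(2)[OF D1 trilin_perms(1)[OF \<gamma>]] comul_slice_bilin(2)[OF D0 \<gamma>]]) simp

lemma comul_left_cobracket:
  assumes \<gamma>: "trilin_map s (*) \<gamma>" and t: "t \<in> tensor2 s"
  shows "comul_left s (\<delta> X Y) t \<gamma>
    = X * comul_left s D1 t \<gamma> - Y * comul_left s D1 t (\<lambda>x y v. \<gamma> y x v) + comul_left s D0 t \<gamma>"
  unfolding comul_left_apply[OF comul_cobracket t \<gamma>] comul_left_apply[OF D1 t \<gamma>] comul_left_apply[OF D0 t \<gamma>]
    comul_left_apply[OF D1 t trilin_perms(2)[OF \<gamma>]] cobracket_apply[OF trilin_slices(1)[OF \<gamma>]]
  by (subst form_lincomb[OF t comul_slice_bilin(1)[OF D1 \<gamma>]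
        comul_slice_bilin(1)[OF D1 trilin_perms(2)[OF \<gamma>]] comul_slice_bilin(1)[OF D0 \<gamma>]]) simp

lemma comul_of_flip:
  assumes D: "comul s D" and t: "t \<in> tensor2 s" and \<gamma>: "trilin_map s (*) \<gamma>"
  shows "comul_right s D (flip s t) \<gamma> = comul_left s D t (\<lambda>x y v. \<gamma> v x y)"
    and "comul_left s D (flip s t) \<gamma> = comul_right s D t (\<lambda>u x y. \<gamma> x y u)"
  using comul_slice_bilin(1,2)[OF D \<gamma>]
  by (simp_all add: comul_right_apply[OF D _ \<gamma>] comul_left_apply[OF D _ \<gamma>] t flip_apply
      comul_left_apply[OF D t trilin_perms(3)[OF \<gamma>]] comul_left_apply[OF D t trilin_perms(4)[OF \<gamma>]]
      comul_right_apply[OF D t trilin_perms(3)[OF \<gamma>]] comul_right_apply[OF D t trilin_perms(4)[OF \<gamma>]])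

lemma comul_of_cobracket:
  assumes D: "comul s D" and \<gamma>: "trilin_map s (*) \<gamma>"
  shows "comul_right s D (\<delta> X Y a) \<gamma>
      = X * comul_right s D (D1 a) \<gamma> - Y * comul_left s D (D1 a) (\<lambda>x y v. \<gamma> v x y) + comul_right s D (D0 a) \<gamma>"
    and "comul_left s D (\<delta> X Y a) \<gamma>
      = X * comul_left s D (D1 a) \<gamma> - Y * comul_right s D (D1 a) (\<lambda>u x y. \<gamma> x y u) + comul_left s D (D0 a) \<gamma>"
proof -
  have t: "\<delta> X Y a \<in> tensor2 s" by (simp add: cobracket_symbol_def)
  show "comul_right s D (\<delta> X Y a) \<gamma>
      = X * comul_right s D (D1 a) \<gamma> - Y * comul_left s D (D1 a) (\<lambda>x y v. \<gamma> v x y) + comul_right s D (D0 a) \<gamma>"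
    unfolding comul_of_flip(1)[OF D in_tensor2(1) \<gamma>, symmetric]
    unfolding comul_right_apply[OF D t \<gamma>] comul_right_apply[OF D in_tensor2(1) \<gamma>] comul_right_apply[OF D in_tensor2(3) \<gamma>]
      comul_right_apply[OF D in_tensor2(4)[OF in_tensor2(1)] \<gamma>]
    by (simp add: cobracket_symbol_def fun_scale_apply)
  show "comul_left s D (\<delta> X Y a) \<gamma>
      = X * comul_left s D (D1 a) \<gamma> - Y * comul_right s D (D1 a) (\<lambda>u x y. \<gamma> x y u) + comul_left s D (D0 a) \<gamma>"
    unfolding comul_of_flip(2)[OF D in_tensor2(1) \<gamma>, symmetric]
    unfolding comul_left_apply[OF D t \<gamma>] comul_left_apply[OF D in_tensor2(1) \<gamma>] comul_left_apply[OF D in_tensor2(3) \<gamma>]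
      comul_left_apply[OF D in_tensor2(4)[OF in_tensor2(1)] \<gamma>]
    by (simp add: cobracket_symbol_def fun_scale_apply)
qed

text \<open>
  A codefect is the same for an axiom of PGD-coalgebras other than coassociativity and (skew) symmetry. It lies in
  the tensor cube, and \<open>\<gamma>\<close> denotes the trilinear form at which it is evaluated; a permutation of the tensor factors is a
  permutation of the arguments of \<open>\<gamma>\<close>.
\<close>

definition "novikov_codefect1 a =
  comul_right s D1 (D1 a) - flip12 s (comul_right s D1 (D1 a))
  - (comul_left s D1 (D1 a) - flip12 s (comul_left s D1 (D1 a)))"

definition "novikov_codefect2 a = flip12 s (comul_right s D1 (flip s (D1 a))) - comul_left s D1 (D1 a)"

definition "lie_codefect a =
  comul_right s D0 (D0 a) - flip12 s (comul_right s D0 (D0 a)) - comul_left s D0 (D0 a)"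

definition "gd_codefect a =
  comul_right s D0 (D1 a) - flip12 s (comul_right s D1 (D0 a)) + flip12 s (comul_right s D0 (flip s (D1 a)))
  - (comul_left s D1 (D0 a) + comul_left s D0 (D1 a))"

definition "poisson_codefect a =
  comul_right s D2 (D0 a) - (comul_left s D0 (D2 a) + flip12 s (comul_right s D0 (D2 a)))"

definition "dnp_codefect1 a =
  comul_right s D2 (D1 a) - (comul_left s D1 (D2 a) + flip12 s (comul_right s D1 (D2 a)))"

definition "dnp_codefect2 a = comul_right s D2 (flip s (D1 a)) - flip12 s (comul_left s D1 (D2 a))"

lemma comul_closed [simp]:
  "t \<in> tensor2 s \<Longrightarrow> comul_right s D1 t \<in> tensor3 s" "t \<in> tensor2 s \<Longrightarrow> comul_left s D1 t \<in> tensor3 s"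
  "t \<in> tensor2 s \<Longrightarrow> comul_right s D2 t \<in> tensor3 s" "t \<in> tensor2 s \<Longrightarrow> comul_left s D2 t \<in> tensor3 s"
  "t \<in> tensor2 s \<Longrightarrow> comul_right s D0 t \<in> tensor3 s" "t \<in> tensor2 s \<Longrightarrow> comul_left s D0 t \<in> tensor3 s"
  "t \<in> tensor2 s \<Longrightarrow> comul_right s (\<delta> X Y) t \<in> tensor3 s" "t \<in> tensor2 s \<Longrightarrow> comul_left s (\<delta> X Y) t \<in> tensor3 s"
  "\<delta> X Y a \<in> tensor2 s" "u \<in> tensor3 s \<Longrightarrow> flip12 s u \<in> tensor3 s"
  using D1 D2 D0 comul_cobracket
  by (auto intro: comul_right_closed comul_left_closed flip12_closed[OF s] simp: cobracket_symbol_def)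

text \<open>
  Skew symmetry of \<open>\<delta>\<close> makes the co-Jacobi expression invariant under simultaneous cyclic permutations of the tensor factors
  and of \<open>X\<close>, \<open>Y\<close>, \<open>Z\<close>, and makes it change sign under simultaneous transpositions. Hence one codefect serves
  for the three squares, one for the three mixed products and one for the three linear terms.
\<close>

lemma lie_coalgebra_expand:
  assumes skew: "\<And>a. D0 a = - flip s (D0 a)" and \<gamma>: "trilin_map s (*) \<gamma>"
  shows "(comul_right s (\<delta> Y Z) (\<delta> X (Y + Z) a) - flip12 s (comul_right s (\<delta> X Z) (\<delta> Y (X + Z) a))
        - comul_left s (\<delta> X Y) (\<delta> (X + Y) Z a)) \<gamma>
    = lie_codefect a \<gamma> + X * gd_codefect a \<gamma> + Y * - gd_codefect a (\<lambda>x y z. \<gamma> y x z)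
      + Z * gd_codefect a (\<lambda>x y z. \<gamma> y z x)
      + X * X * novikov_codefect2 a \<gamma> + Y * Y * - novikov_codefect2 a (\<lambda>x y z. \<gamma> y x z)
      + Z * Z * novikov_codefect2 a (\<lambda>x y z. \<gamma> y z x)
      + X * Y * novikov_codefect1 a \<gamma> + X * Z * - novikov_codefect1 a (\<lambda>x y z. \<gamma> x z y)
      + Y * Z * novikov_codefect1 a (\<lambda>x y z. \<gamma> z x y)"
proof -
  note g = \<gamma> trilin_perms[OF \<gamma>]
  note expand = comul_right_cobracket comul_left_cobracket comul_of_cobracket[OF D1] comul_of_cobracket[OF D2]
    comul_of_cobracket[OF D0] comul_of_flip[OF D1] comul_of_flip[OF D2] comul_of_flip[OF D0] flip12_apply
  have sk: "D0 v \<beta> = - D0 v (\<lambda>x y. \<beta> y x)" if "bilin_map s (*) \<beta>" for v \<beta>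
  proof -
    have "D0 v \<beta> = (- flip s (D0 v)) \<beta>" using skew[of v] by (rule arg_cong)
    then show ?thesis using that by (simp add: flip_apply)
  qed
  \<comment> \<open>Skew symmetry of \<open>D0\<close> relates terms that differ by a permutation of \<open>\<gamma>\<close>: \<open>L01\<close> turns \<open>(D1 \<otimes> I)D0\<close> into \<open>(I \<otimes> D1)D0\<close>, and
    \<open>L10\<close> exchanges the first two factors of \<open>(D0 \<otimes> I)D1\<close>.\<close>
  have L01: "comul_left s D1 (D0 a) \<gamma> = - comul_right s D1 (D0 a) (\<lambda>u x y. \<gamma> x y u)" if \<gamma>: "trilin_map s (*) \<gamma>" for \<gamma>
    unfolding comul_left_apply[OF D1 in_tensor2(3) \<gamma>] comul_right_apply[OF D1 in_tensor2(3) trilin_perms(3)[OF \<gamma>]]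
    by (rule sk[OF comul_slice_bilin(1)[OF D1 \<gamma>]])
  have L10: "comul_left s D0 (D1 a) \<gamma> = - comul_left s D0 (D1 a) (\<lambda>x y v. \<gamma> y x v)" if \<gamma>: "trilin_map s (*) \<gamma>" for \<gamma>
  proof -
    have "D1 a (\<lambda>u v. D0 u (\<lambda>x y. \<gamma> x y v)) = D1 a (\<lambda>u v. - 1 * D0 u (\<lambda>x y. \<gamma> y x v))"
      using sk[OF trilin_slices(1)[OF \<gamma>]] by simp
    then show ?thesis
      unfolding comul_left_apply[OF D0 in_tensor2(1) \<gamma>] comul_left_apply[OF D0 in_tensor2(1) trilin_perms(2)[OF \<gamma>]]
      unfolding tensor2_form_lin(4)[OF s in_tensor2(1) comul_slice_bilin(1)[OF D0 trilin_perms(2)[OF \<gamma>]]] by simp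
  qed
  show ?thesis
    unfolding lie_codefect_def gd_codefect_def novikov_codefect1_def novikov_codefect2_def
    \<comment> \<open>\<open>g(3,4,6)\<close> picks one representative from each pair of forms exchanged by \<open>L10\<close>; with all six, rewriting would
      not terminate.\<close>
    by (simp add: expand g, simp add: g[THEN L01] g(3,4,6)[THEN L10], simp add: algebra_simps)
qed

text \<open>
  The coefficients of \<open>Y\<close> and \<open>Z\<close> differ only by the transposition of the last two factors, because \<open>D2\<close> is cocommutative.
\<close>

lemma poisson_coalgebra_expand:
  assumes cocomm: "\<And>a. flip s (D2 a) = D2 a" and \<gamma>: "trilin_map s (*) \<gamma>"
  shows "(comul_right s D2 (\<delta> X (Y + Z) a)
        - (comul_left s (\<delta> X Y) (D2 a) + flip12 s (comul_right s (\<delta> X Z) (D2 a)))) \<gamma>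
    = poisson_codefect a \<gamma> + X * dnp_codefect1 a \<gamma> + Y * - dnp_codefect2 a \<gamma>
      + Z * - dnp_codefect2 a (\<lambda>x y z. \<gamma> x z y)"
proof -
  note g = \<gamma> trilin_perms[OF \<gamma>]
  note expand = comul_right_cobracket comul_left_cobracket comul_of_cobracket[OF D1] comul_of_cobracket[OF D2]
    comul_of_cobracket[OF D0] comul_of_flip[OF D1] comul_of_flip[OF D2] comul_of_flip[OF D0] flip12_apply
  have sk: "D2 v \<beta> = D2 v (\<lambda>x y. \<beta> y x)" if "bilin_map s (*) \<beta>" for v \<beta>
    using flip_apply[OF in_tensor2(2)[of v] that] by (simp only: cocomm)
  have L12: "comul_left s D2 (D1 a) \<gamma> = comul_left s D2 (D1 a) (\<lambda>x y v. \<gamma> y x v)" if \<gamma>: "trilin_map s (*) \<gamma>" for \<gamma>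
    unfolding comul_left_apply[OF D2 in_tensor2(1) \<gamma>] comul_left_apply[OF D2 in_tensor2(1) trilin_perms(2)[OF \<gamma>]]
    by (simp only: sk[OF trilin_slices(1)[OF \<gamma>]])
  have L21: "comul_left s D1 (D2 a) \<gamma> = comul_right s D1 (D2 a) (\<lambda>u x y. \<gamma> x y u)" if \<gamma>: "trilin_map s (*) \<gamma>" for \<gamma>
    unfolding comul_left_apply[OF D1 in_tensor2(2) \<gamma>] comul_right_apply[OF D1 in_tensor2(2) trilin_perms(3)[OF \<gamma>]]
    by (rule sk[OF comul_slice_bilin(1)[OF D1 \<gamma>]])
  show ?thesis
    unfolding poisson_codefect_def dnp_codefect1_def dnp_codefect2_def
    by (simp add: expand g, simp add: g[THEN L21] g(3,4,6)[THEN L12], simp add: algebra_simps)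
qed

lemma codefect_in_tensor3:
  "novikov_codefect1 a \<in> tensor3 s" "novikov_codefect2 a \<in> tensor3 s" "lie_codefect a \<in> tensor3 s"
  "gd_codefect a \<in> tensor3 s" "poisson_codefect a \<in> tensor3 s" "dnp_codefect1 a \<in> tensor3 s"
  "dnp_codefect2 a \<in> tensor3 s"
  by (simp_all add: novikov_codefect1_def novikov_codefect2_def lie_codefect_def gd_codefect_def
      poisson_codefect_def dnp_codefect1_def dnp_codefect2_def)

lemma tensor3_eq_0_iff: "t \<in> tensor3 s \<Longrightarrow> t = 0 \<longleftrightarrow> (\<forall>\<gamma>. trilin_map s (*) \<gamma> \<longrightarrow> t \<gamma> = 0)"
  using tensor3_eq_iff[OF s, of t 0] by simp

lemma lie_coalgebra_compat_iff:
  assumes skew: "\<And>a. D0 a = - flip s (D0 a)"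
  shows "(\<forall>X Y Z a. comul_right s (\<delta> Y Z) (\<delta> X (Y + Z) a) - flip12 s (comul_right s (\<delta> X Z) (\<delta> Y (X + Z) a))
        = comul_left s (\<delta> X Y) (\<delta> (X + Y) Z a)) \<longleftrightarrow>
     (\<forall>a. novikov_codefect1 a = 0) \<and> (\<forall>a. novikov_codefect2 a = 0) \<and> (\<forall>a. lie_codefect a = 0) \<and> (\<forall>a. gd_codefect a = 0)"
    (is "(\<forall>X Y Z a. ?l X Y Z a = ?r X Y Z a) \<longleftrightarrow> ?R")
proof -
  have "(\<forall>X Y Z a. ?l X Y Z a = ?r X Y Z a) \<longleftrightarrow> (\<forall>X Y Z a. ?l X Y Z a - ?r X Y Z a = 0)"
    by simp
  also have "\<dots> \<longleftrightarrow> (\<forall>X Y Z a \<gamma>. trilin_map s (*) \<gamma> \<longrightarrow> (?l X Y Z a - ?r X Y Z a) \<gamma> = 0)"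
    by (subst tensor3_eq_0_iff) auto
  also have "\<dots> \<longleftrightarrow> (\<forall>a \<gamma>. trilin_map s (*) \<gamma> \<longrightarrow> (\<forall>X Y Z. (?l X Y Z a - ?r X Y Z a) \<gamma> = 0))"
    by blast
  also have "\<dots> \<longleftrightarrow> (\<forall>a \<gamma>. trilin_map s (*) \<gamma> \<longrightarrow> lie_codefect a \<gamma> = 0 \<and> gd_codefect a \<gamma> = 0 \<and>
      - gd_codefect a (\<lambda>x y z. \<gamma> y x z) = 0 \<and> gd_codefect a (\<lambda>x y z. \<gamma> y z x) = 0 \<and>
      novikov_codefect2 a \<gamma> = 0 \<and> - novikov_codefect2 a (\<lambda>x y z. \<gamma> y x z) = 0 \<and> novikov_codefect2 a (\<lambda>x y z. \<gamma> y z x) = 0 \<and>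
      novikov_codefect1 a \<gamma> = 0 \<and> - novikov_codefect1 a (\<lambda>x y z. \<gamma> x z y) = 0 \<and> novikov_codefect1 a (\<lambda>x y z. \<gamma> z x y) = 0)"
    by (intro all_cong1 imp_cong refl) (simp only: lie_coalgebra_expand[OF skew] quadratic_scalar_iff)
  also have "\<dots> \<longleftrightarrow> ?R"
    unfolding codefect_in_tensor3[THEN tensor3_eq_0_iff] by (auto dest: trilin_perms)
  finally show ?thesis .
qed

lemma poisson_coalgebra_compat_iff:
  assumes cocomm: "\<And>a. flip s (D2 a) = D2 a"
  shows "(\<forall>X Y Z a. comul_right s D2 (\<delta> X (Y + Z) a)
        = comul_left s (\<delta> X Y) (D2 a) + flip12 s (comul_right s (\<delta> X Z) (D2 a))) \<longleftrightarrow>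
     (\<forall>a. poisson_codefect a = 0) \<and> (\<forall>a. dnp_codefect1 a = 0) \<and> (\<forall>a. dnp_codefect2 a = 0)"
    (is "(\<forall>X Y Z a. ?l X Y Z a = ?r X Y Z a) \<longleftrightarrow> ?R")
proof -
  have "(\<forall>X Y Z a. ?l X Y Z a = ?r X Y Z a) \<longleftrightarrow> (\<forall>X Y Z a. ?l X Y Z a - ?r X Y Z a = 0)"
    by simp
  also have "\<dots> \<longleftrightarrow> (\<forall>X Y Z a \<gamma>. trilin_map s (*) \<gamma> \<longrightarrow> (?l X Y Z a - ?r X Y Z a) \<gamma> = 0)"
    by (subst tensor3_eq_0_iff) auto
  also have "\<dots> \<longleftrightarrow> (\<forall>a \<gamma>. trilin_map s (*) \<gamma> \<longrightarrow> (\<forall>X Y Z. (?l X Y Z a - ?r X Y Z a) \<gamma> = 0))"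
    by blast
  also have "\<dots> \<longleftrightarrow> (\<forall>a \<gamma>. trilin_map s (*) \<gamma> \<longrightarrow> poisson_codefect a \<gamma> = 0 \<and> dnp_codefect1 a \<gamma> = 0 \<and>
      - dnp_codefect2 a \<gamma> = 0 \<and> - dnp_codefect2 a (\<lambda>x y z. \<gamma> x z y) = 0)"
    by (intro all_cong1 imp_cong refl) (simp only: poisson_coalgebra_expand[OF cocomm] linear_scalar_iff)
  also have "\<dots> \<longleftrightarrow> ?R"
    unfolding codefect_in_tensor3[THEN tensor3_eq_0_iff] by (auto dest: trilin_perms)
  finally show ?thesis .
qed

section \<open>The equivalence\<close>

text \<open>
  The part of \<open>\<delta>\<close> built from \<open>D1\<close> is skew by construction.
\<close>

lemma cobracket_skew_iff:
  "(\<forall>X Y a. \<delta> X Y a = - flip s (\<delta> Y X a)) \<longleftrightarrow> (\<forall>a. D0 a = - flip s (D0 a))"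
proof
  assume "\<forall>X Y a. \<delta> X Y a = - flip s (\<delta> Y X a)"
  then have "\<delta> 0 0 a = - flip s (\<delta> 0 0 a)" for a by blast
  then show "\<forall>a. D0 a = - flip s (D0 a)"
    by (simp only: cobracket_symbol_def fun_scale_zero diff_self add_0) simp
next
  assume *: "\<forall>a. D0 a = - flip s (D0 a)"
  show "\<forall>X Y a. \<delta> X Y a = - flip s (\<delta> Y X a)"
  proof (intro allI)
    fix X Y a
    have "D0 a = - flip s (D0 a)" using * by blast
    then show "\<delta> X Y a = - flip s (\<delta> Y X a)"
      by (simp add: cobracket_symbol_def tensor_expand)
  qed
qed

text \<open>
  The conjuncts are grouped as the conformal axioms produce them: each parenthesised group is the right-hand side of one
  of the equivalences for the co-Jacobi identity, the co-Leibniz rule, the bracket and the mixed conditions.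
\<close>

lemma pgd_bialgebra_iff_defects:
  assumes "pgd_algebra s m d br"
  shows "pgd_bialgebra s m d br D1 D2 D0 \<longleftrightarrow>
    (\<forall>a. comul_left s D2 (D2 a) = comul_right s D2 (D2 a)) \<and>
    (\<forall>a. D2 a = flip s (D2 a)) \<and> (\<forall>a. D0 a = - flip s (D0 a)) \<and>
    ((\<forall>a. novikov_codefect1 a = 0) \<and> (\<forall>a. novikov_codefect2 a = 0) \<and> (\<forall>a. lie_codefect a = 0) \<and> (\<forall>a. gd_codefect a = 0)) \<and>
    ((\<forall>a. poisson_codefect a = 0) \<and> (\<forall>a. dnp_codefect1 a = 0) \<and> (\<forall>a. dnp_codefect2 a = 0)) \<and>
    ((\<forall>a b. novikov_defect1 a b = 0) \<and> (\<forall>a b. novikov_defect2 a b = 0) \<and> (\<forall>a b. novikov_defect3 a b = 0)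
      \<and> (\<forall>a b. lie_defect a b = 0) \<and> (\<forall>a b. gd_defect a b = 0)) \<and>
    (\<forall>a b. D2 (d a b) = map_right s (d a) (D2 b) + map_left s (d b) (D2 a)) \<and>
    ((\<forall>a b. poisson_defect1 a b = 0) \<and> (\<forall>a b. poisson_defect2 a b = 0)
      \<and> (\<forall>a b. dnp_defect1 a b = 0) \<and> (\<forall>a b. dnp_defect2 a b = 0) \<and> (\<forall>a b. dnp_defect3 a b = 0))"
proof -
  have A: "gd_algebra s m br" "poisson_algebra s d br" "diff_novikov_poisson_algebra s m d"
    using assms by (auto simp: pgd_algebra_def)
  then have A': "novikov_algebra s m" "lie_algebra s br" "comm_assoc_algebra s d"
    by (auto simp: gd_algebra_def poisson_algebra_def)
  show ?thesis
    unfolding pgd_bialgebra_def gd_bialgebra_def poisson_bialgebra_def diff_novikov_poisson_bialgebra_def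
      novikov_bialgebra_def lie_bialgebra_def comm_cocomm_asi_bialgebra_def gd_coalgebra_def poisson_coalgebra_def
      diff_novikov_poisson_coalgebra_def novikov_coalgebra_def lie_coalgebra_def cocomm_coassoc_coalgebra_def
      novikov_defect1_def novikov_defect2_def novikov_defect3_def lie_defect_def gd_defect_def
      poisson_defect1_def poisson_defect2_def dnp_defect1_def dnp_defect2_def dnp_defect3_def
      novikov_codefect1_def novikov_codefect2_def lie_codefect_def gd_codefect_def
      poisson_codefect_def dnp_codefect1_def dnp_codefect2_def right_minus_eq
    using A A' D1 D2 D0
    by (simp only: simp_thms) (rule iffI; elim conjE; intro conjI; assumption)
qed

end

theorem theorem5p11:
  fixes s :: "'k::field_char_0 \<Rightarrow> 'a::ab_group_add \<Rightarrow> 'a"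
    and Basis :: "'a set"
    and circ dot brk :: "'a \<Rightarrow> 'a \<Rightarrow> 'a"
    and \<Delta>\<^sub>1 \<Delta>\<^sub>2 \<delta>\<^sub>0 \<delta> \<Delta> :: "'a poly \<Rightarrow> ('k, 'a poly) tens2"
  assumes "finite_dimensional_vector_space s Basis"
    and "pgd_algebra s circ dot brk"
    and "kdel_comul (poly_scale s) (pCons 0) \<Delta>\<^sub>1"
    and "kdel_comul (poly_scale s) (pCons 0) \<Delta>\<^sub>2"
    and "kdel_comul (poly_scale s) (pCons 0) \<delta>\<^sub>0"
    and "\<forall>a. \<Delta>\<^sub>1 [:a:] \<in> const_tensor s ` tensor2 s"
    and "\<forall>a. \<Delta>\<^sub>2 [:a:] \<in> const_tensor s ` tensor2 s"
    and "\<forall>a. \<delta>\<^sub>0 [:a:] \<in> const_tensor s ` tensor2 s"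
    and "\<delta> = kdel_ext s (\<lambda>a.
           map_left (poly_scale s) (pCons 0) (\<Delta>\<^sub>1 [:a:])
           - flip (poly_scale s) (map_left (poly_scale s) (pCons 0) (\<Delta>\<^sub>1 [:a:]))
           + \<delta>\<^sub>0 [:a:])"
    and "\<Delta> = kdel_ext s (\<lambda>a. \<Delta>\<^sub>2 [:a:])"
  shows "poisson_conformal_bialgebra (poly_scale s) (pCons 0)
           (pgd_bracket circ brk) (pgd_product dot) \<delta> \<Delta>
         \<longleftrightarrow> pgd_bialgebra s circ dot brk (restr s \<Delta>\<^sub>1) (restr s \<Delta>\<^sub>2) (restr s \<delta>\<^sub>0)"
proof -
  note bil = pgd_algebraD(1-3)[OF assms(2)] and s = pgd_algebraD(5)[OF assms(2)]
  note ps = vector_space_poly_scale[OF s] and skew = lie_algebra_skew[OF pgd_algebraD(4)[OF assms(2)]]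
  have comm: "dot a b = dot b a" for a b
    using assms(2) unfolding pgd_algebra_def poisson_algebra_def comm_assoc_algebra_def by blast
  note S1 = restr_symbol[OF s assms(3,6)] and S2 = restr_symbol[OF s assms(4,7)] and S0 = restr_symbol[OF s assms(5,8)]
  interpret pgd_data s circ dot brk "restr s \<Delta>\<^sub>1" "restr s \<Delta>\<^sub>2" "restr s \<delta>\<^sub>0"
    by unfold_locales (rule bil comm skew coproduct_symbolD(2)[OF s S1] coproduct_symbolD(2)[OF s S2]
      coproduct_symbolD(2)[OF s S0])+
  have \<delta>: "coproduct_symbol s \<delta> (cobracket_symbol s (restr s \<Delta>\<^sub>1) (restr s \<delta>\<^sub>0))"
    unfolding assms(9)
  proof (rule kdel_ext_symbol[OF s])
    note pC = pCons_0_linear[OF s] and C = const_poly_linear[OF s]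
    note D1s = coproduct_symbolD[OF s S1] and D0s = coproduct_symbolD[OF s S0]
    note L1 = lin_compose[OF C D1s(6)] and L0 = lin_compose[OF C D0s(6)]
    show "Vector_Spaces.linear s fun_scale (\<lambda>a. map_left (poly_scale s) (pCons 0) (\<Delta>\<^sub>1 [:a:])
        - flip (poly_scale s) (map_left (poly_scale s) (pCons 0) (\<Delta>\<^sub>1 [:a:])) + \<delta>\<^sub>0 [:a:])"
      by (rule linI[OF s vector_space_fun_scale])
        (simp_all only: lin_add[OF L1] lin_add[OF L0] lin_scale[OF L1] lin_scale[OF L0] map_left_lin[OF pC] D1s(4) D0s(4)
          flip_lin[OF ps] map_left_closed[OF pC] fun_scale_right add_diff_add ac_simps)
    show "map_left (poly_scale s) (pCons 0) (\<Delta>\<^sub>1 [:a:])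
        - flip (poly_scale s) (map_left (poly_scale s) (pCons 0) (\<Delta>\<^sub>1 [:a:])) + \<delta>\<^sub>0 [:a:] \<in> tensor2 (poly_scale s)" for a
      by (intro tensor2_closed flip_closed[OF ps] map_left_closed[OF pC] D1s D0s)
    show "comul s (cobracket_symbol s (restr s \<Delta>\<^sub>1) (restr s \<delta>\<^sub>0) X Y)" for X Y
      by (rule comul_cobracket)
    have "teval s X Y (map_left (poly_scale s) (pCons 0) (\<Delta>\<^sub>1 [:a:])) = fun_scale X (restr s \<Delta>\<^sub>1 a)" for X Y a
      by (subst teval_map_left[OF pC scale_linear[OF s] veval_del[OF s] D1s(4)])
        (simp only: D1s(3) veval_const[OF s] map_left_scale[OF s] in_tensor2)
    then show "teval s X Y (map_left (poly_scale s) (pCons 0) (\<Delta>\<^sub>1 [:a:])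
        - flip (poly_scale s) (map_left (poly_scale s) (pCons 0) (\<Delta>\<^sub>1 [:a:])) + \<delta>\<^sub>0 [:a:])
      = cobracket_symbol s (restr s \<Delta>\<^sub>1) (restr s \<delta>\<^sub>0) X Y a" for X Y a
      by (simp only: teval_simps teval_flip[OF s] map_left_closed[OF pC] D1s(4) D0s(3) veval_const[OF s]
          flip_lin(2)[OF s] in_tensor2 cobracket_symbol_def)
  qed
  have \<Delta>: "coproduct_symbol s \<Delta> (\<lambda>X Y. restr s \<Delta>\<^sub>2)"
    unfolding assms(10)
  proof (rule kdel_ext_symbol[OF s])
    note D2s = coproduct_symbolD[OF s S2]
    show "Vector_Spaces.linear s fun_scale (\<lambda>a. \<Delta>\<^sub>2 [:a:])"
      by (rule lin_compose[OF const_poly_linear[OF s] D2s(6)])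
    show "teval s X Y (\<Delta>\<^sub>2 [:a:]) = restr s \<Delta>\<^sub>2 a" for X Y a
      by (simp only: D2s(3) veval_const[OF s])
  qed (rule D2 coproduct_symbolD(4)[OF s S2])+
  note conformal = poisson_conformal_bialgebra_iff[OF s pgd_bracket_symbol[OF bil(1,3)] pgd_product_symbol[OF bil(2)] \<delta> \<Delta>]
    poisson_conformal_coalgebra_iff[OF s \<delta> \<Delta>] cobracket_skew_iff
  note defects = pgd_bialgebra_iff_defects[OF assms(2)]
  \<comment> \<open>The comparison of coefficients uses that \<open>\<Delta>\<^sub>2\<close> is cocommutative and \<open>\<delta>\<^sub>0\<close> skew. Both structures demand
    this, so without it neither side of the equivalence holds.\<close>
  let ?symm = "(\<forall>a. restr s \<Delta>\<^sub>2 a = flip s (restr s \<Delta>\<^sub>2 a)) \<and> (\<forall>a. restr s \<delta>\<^sub>0 a = - flip s (restr s \<delta>\<^sub>0 a))"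
  show ?thesis (is "?conf \<longleftrightarrow> ?bialg")
  proof (cases ?symm)
    case True
    then have skew: "restr s \<delta>\<^sub>0 a = - flip s (restr s \<delta>\<^sub>0 a)" and cocomm: "flip s (restr s \<Delta>\<^sub>2 a) = restr s \<Delta>\<^sub>2 a" for a
      by simp_all
    show ?thesis
      unfolding conformal defects bracket_compat_iff[OF skew, symmetric] product_compat_iff[OF cocomm, symmetric]
        lie_coalgebra_compat_iff[OF skew, symmetric] poisson_coalgebra_compat_iff[OF cocomm, symmetric]
      using pgd_poisson_conformal_algebra[OF assms(1,2)]
      by (simp only: simp_thms eq_commute[of "comul_left s _ _"]) (rule iffI; elim conjE; intro conjI; assumption)
  next
    case False
    have bialg: "?bialg \<Longrightarrow> ?symm"
      unfolding defects by (elim conjE) (rule conjI; assumption)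
    have conf: "?conf \<Longrightarrow> ?symm"
      unfolding conformal simp_thms by (elim conjE) (rule conjI; assumption)
    show ?thesis
    proof
      assume ?conf
      from notE[OF False conf[OF this]] show ?bialg .
    next
      assume ?bialg
      from notE[OF False bialg[OF this]] show ?conf .
    qed
  qed
qed

end
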